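(* Let $H^{\mathrm{bulk}}$ satisfy the short-range assumption with constants $d,K_d$ and the bulk-gap assumption with constant $\Delta$, let $H=\iota^*H^{\mathrm{bulk}}\iota$ be its restriction to the open chain of length $L$, and set $$\delta=\sqrt{\frac{128\,\Delta\, d\, K_d}{L}},\qquad S=\tanh(H/\delta).$$ Then each of the two quantities $\mathcal I_{\mathrm{bulk}}=\tfrac12\operatorname{Tr}\big(CS[\theta(X),S]\big)$ and $\mathcal I_{\mathrm{edge}}=\operatorname{Tr}\big(C\theta(X)(1-S^2)\big)$ satisfies $$\mathcal I_{\mathrm{edge/bulk}}\in\mathbb Z+\gamma\, e^{-\sqrt{\frac{L\Delta}{128\, d\,K_d}}},$$ i.e. there is an integer $n$ with $|\mathcal I_{\mathrm{edge/bulk}}-n|\le|\gamma|\,e^{-\sqrt{L\Delta/(128 dK_d)}}$, where $|\gamma|$ is bounded by a polynomial function of the variables $(K_d,d,L)$.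
   Context: Let $L\in\mathbb N$, $\mathcal H_L=\ell^2(\{0,\dots,L-1\})\otimes\mathbb C^2$ with canonical basis $|x,s\rangle$, $x\in\{0,\dots,L-1\}$, $s\in\{A,B\}$, and $\mathcal H^{\mathrm{bulk}}=\ell^2(\mathbb Z)\otimes\mathbb C^2$. Let $\iota:\mathcal H_L\to\mathcal H^{\mathrm{bulk}}$ be extension by zero and $\iota^*$ the restriction to sites $\{0,\dots,L-1\}$. The chiral operator is $C=\begin{pmatrix}\mathbb 1_A&0\\0&-\mathbb 1_B\end{pmatrix}$, i.e. $C|x,A\rangle=|x,A\rangle$, $C|x,B\rangle=-|x,B\rangle$ (on either space). $H^{\mathrm{bulk}}$ is a bounded self-adjoint operator on $\mathcal H^{\mathrm{bulk}}$ with $H^{\mathrm{bulk}}C+CH^{\mathrm{bulk}}=0$, and $H=\iota^*H^{\mathrm{bulk}}\iota$ (a Hermitian $2L\times2L$ matrix with $HC+CH=0$). For an operator $T$, $T_{x,y}$ denotes its $2\times2$ matrix block between sites $x$ and $y$, and $\|\cdot\|$ is the operator norm. Short-range assumption: there exist $d>0$ and $K_d>0$ with $\sup_{x\in\mathbb Z}\sum_{x'\in\mathbb Z}\|H^{\mathrm{bulk}}_{x,x'}\|e^{|x-x'|/d}\le K_d$. Bulk-gap assumption: there exists $\Delta>0$ with $\operatorname{Spec}(H^{\mathrm{bulk}})\cap(-\Delta,\Delta)=\emptyset$. The switch function is $\theta:\{0,\dots,L-1\}\to\mathbb R$, $\theta(x)=1$ for $x<\lfloor L/2\rfloor$ and $\theta(x)=0$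 otherwise (equal to 1 near the left edge, 0 near the right edge, jumping in the middle of the chain), and $\theta(X)$ is the multiplication operator $(\theta(X)\psi)_x=\theta(x)\psi_x$. *)

theory Defs
  imports "Jordan_Normal_Form.Schur_Decomposition" "HOL-Analysis.Infinite_Sum"
begin

definition cvec_norm :: "complex vec \<Rightarrow> real" where
  "cvec_norm v = sqrt (\<Sum>i<dim_vec v. (cmod (v $ i))^2)"

definition mat_opnorm :: "complex mat \<Rightarrow> real" where
  "mat_opnorm B = Sup {cvec_norm (B *\<^sub>v v) | v. v \<in> carrier_vec (dim_col B) \<and> cvec_norm v \<le> 1}"

definition mat_trace :: "complex mat \<Rightarrow> complex" where
  "mat_trace A = (\<Sum>i<dim_row A. A $$ (i,i))"

text \<open>Functional calculus for a diagonalizable (e.g. Hermitian) n x n matrix A: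
  f(A) is the n x n matrix acting as multiplication by f(lambda) on every eigenvector
  of A with eigenvalue lambda.\<close>
definition mat_fun :: "(complex \<Rightarrow> complex) \<Rightarrow> complex mat \<Rightarrow> complex mat" where
  "mat_fun f A = (THE S. S \<in> carrier_mat (dim_row A) (dim_row A) \<and>
      (\<forall>v lam. v \<in> carrier_vec (dim_row A) \<longrightarrow> A *\<^sub>v v = lam \<cdot>\<^sub>v v \<longrightarrow> S *\<^sub>v v = f lam \<cdot>\<^sub>v v))"

text \<open>The bulk Hamiltonian is given by its 2x2 blocks \<open>Hb x y\<close> (x, y integers), internal
  index 0 = sublattice A, 1 = sublattice B.  Bulk vectors are \<open>\<psi> :: int \<Rightarrow> nat \<Rightarrow> complex\<close>
  (site, internal index), vanishing for internal index \<ge> 2.\<close>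

definition in_l2 :: "(int \<Rightarrow> nat \<Rightarrow> complex) \<Rightarrow> bool" where
  "in_l2 \<psi> \<longleftrightarrow> (\<forall>x s. 2 \<le> s \<longrightarrow> \<psi> x s = 0) \<and>
      (\<lambda>x. \<Sum>s<2. (cmod (\<psi> x s))^2) summable_on UNIV"

definition bulk_apply :: "(int \<Rightarrow> int \<Rightarrow> complex mat) \<Rightarrow> (int \<Rightarrow> nat \<Rightarrow> complex) \<Rightarrow> int \<Rightarrow> nat \<Rightarrow> complex" where
  "bulk_apply Hb \<psi> x s = (if s < 2 then (\<Sum>\<^sub>\<infinity>y. \<Sum>t<2. Hb x y $$ (s,t) * \<psi> y t) else 0)"

definition bulk_spectrum :: "(int \<Rightarrow> int \<Rightarrow> complex mat) \<Rightarrow> complex set" where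
  "bulk_spectrum Hb = {z. \<not> (\<forall>g. in_l2 g \<longrightarrow>
      (\<exists>!\<psi>. in_l2 \<psi> \<and> (\<forall>x s. bulk_apply Hb \<psi> x s - z * \<psi> x s = g x s)))}"

definition chiral2 :: "complex mat" where
  "chiral2 = mat 2 2 (\<lambda>(i,j). if i = j then (if i = 0 then 1 else -1) else 0)"

text \<open>Basis vector |x,s> of H_L has index 2x+s.\<close>
definition restrict_chain :: "nat \<Rightarrow> (int \<Rightarrow> int \<Rightarrow> complex mat) \<Rightarrow> complex mat" where
  "restrict_chain L Hb = mat (2*L) (2*L)
      (\<lambda>(i,j). Hb (int (i div 2)) (int (j div 2)) $$ (i mod 2, j mod 2))"

definition chiral_chain :: "nat \<Rightarrow> complex mat" where
  "chiral_chain L = mat (2*L) (2*L) (\<lambda>(i,j). if i = j then (if i mod 2 = 0 then 1 else -1) else 0)"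

definition switch :: "nat \<Rightarrow> nat \<Rightarrow> complex" where
  "switch L x = (if x < L div 2 then 1 else 0)"

definition theta_chain :: "nat \<Rightarrow> complex mat" where
  "theta_chain L = mat (2*L) (2*L) (\<lambda>(i,j). if i = j then switch L (i div 2) else 0)"

definition commutator :: "complex mat \<Rightarrow> complex mat \<Rightarrow> complex mat" where
  "commutator A B = A * B - B * A"

definition poly3 :: "nat \<Rightarrow> (nat \<Rightarrow> nat \<Rightarrow> nat \<Rightarrow> real) \<Rightarrow> real \<Rightarrow> real \<Rightarrow> real \<Rightarrow> real" where
  "poly3 N c a b e = (\<Sum>i\<le>N. \<Sum>j\<le>N. \<Sum>k\<le>N. c i j k * a^i * b^j * e^k)"

end

theory Submission
  imports "HOL-Analysis.L2_Norm" "HOL-Analysis.Inner_Product" "Jordan_Normal_Form.Spectral_Radius" Defs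
begin

text \<open>Since \<open>S\<close> anticommutes with \<open>C\<close>, cyclicity of the trace gives \<open>I\<^sub>b\<^sub>u\<^sub>l\<^sub>k = I\<^sub>e\<^sub>d\<^sub>g\<^sub>e = \<Sum>\<^sub>j (1 - tanh\<^sup>2(e\<^sub>j/\<delta>)) q\<^sub>j\<close>
  exactly, where \<open>u\<^sub>j\<close> is an orthonormal eigenbasis of \<open>H\<close> and \<open>q\<^sub>j = \<langle>u\<^sub>j, C \<theta> u\<^sub>j\<rangle>\<close>.

  The bulk gap means \<open>\<parallel>H\<^sup>b\<^sup>u\<^sup>l\<^sup>k \<phi>\<parallel> \<ge> \<Delta> \<parallel>\<phi>\<parallel>\<close>. Testing this on an eigenvector \<open>u\<^sub>j\<close> with \<open>\<bar>e\<^sub>j\<bar> \<le> \<Delta>/2\<close>,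
  multiplied by an exponential weight that grows with rate \<open>\<mu> = \<Delta>/(4 d K\<^sub>d)\<close> away from the two edges, shows
  that \<open>u\<^sub>j\<close> is exponentially small in the middle of the chain, so that \<open>[\<theta>, H] u\<^sub>j\<close> has norm at most
  \<open>\<eta> = \<Delta> L\<^sup>2 e\<^sup>-\<^sup>1\<^sup>6\<^sup>y\<close> with \<open>y = L \<Delta>/(128 d K\<^sub>d)\<close> (if \<open>y < 1\<close> the claim is trivial).
  As \<open>2 e\<^sub>j q\<^sub>j = \<langle>u\<^sub>j, C [\<theta>, H] u\<^sub>j\<rangle>\<close>, only energies close to zero contribute. By the pigeonhole principle
  the numbers \<open>\<bar>e\<^sub>j\<bar>\<close> leave a gap of length \<open>\<Delta>/(2(2L+1))\<close> inside \<open>[0, \<Delta>/2]\<close>. The compressions of the projections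
  \<open>\<theta> (1 \<plusminus> C)/2\<close> to the eigenvectors below this gap are almost idempotent, hence have almost integer
  trace, and the difference of the two traces is the sum of the \<open>q\<^sub>j\<close> below the gap.\<close>

section \<open>Spectral gaps of bounded symmetric operators\<close>

text \<open>The open chain can have eigenvalues inside the bulk gap, so no energy fixed in advance
  is a safe place to cut its spectrum. The cut depends on the spectrum instead; this costs a factor
  of order L in the reciprocal of the gap, which e^(-16y) absorbs. The cut is made in |e_j| rather
  than in e_j, so that e_j - e_k and e_j + e_k both stay away from zero across it: the first
  controls the matrix elements of \<theta>, the second those of C \<theta>, and together they
  control both projections. The rate e^(-sqrt y) does not come from localisation, which is much
  better, but from the tail of 1 - tanh^2 above \<Delta>/2: there the weight is at most 4
  e^(-\<Delta>/\<delta>), and the prescribed \<delta> satisfies \<Delta>/\<delta> = sqrt y. A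
  separate difficulty is that \<open>bulk_spectrum\<close> speaks of unique solvability of (H - z) f
  = g and gives no bound on the solution. Turning this into a quantitative gap needs a complete
  inner product space, hence the type \<open>l2\<close>; its outcome is then restated for finite
  sums.\<close>

text \<open>Gliding hump: adding \<open>\<plusminus>3\<^sup>-\<^sup>k w\<^sub>k/\<parallel>w\<^sub>k\<parallel>\<close> with the right sign makes the pairing with \<open>w\<^sub>k\<close> large, and the
  later summands are too small to undo this.\<close>

lemma uniform_boundedness_inner:
  fixes v :: "nat \<Rightarrow> 'a::{real_inner,banach}"
  assumes pw: "\<And>g. \<exists>B. \<forall>n. \<bar>inner (v n) g\<bar> \<le> B"
  shows "\<exists>B. \<forall>n. norm (v n) \<le> B"
proof (rule ccontr)
  assume "\<not> ?thesis"
  then have "\<forall>k. \<exists>n. norm (v n) > 4 ^ k" by (metis not_le)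
  then obtain idx where idx: "\<And>k. norm (v (idx k)) > 4 ^ k" by metis
  define w where "w k = v (idx k)" for k
  have wn: "norm (w k) > 4 ^ k" for k using idx by (simp add: w_def)
  have w0: "norm (w k) > 0" for k by (rule less_trans[OF _ wn]) simp
  define step where
    "step k g = (if 0 \<le> inner (w k) g then 1 else -1 :: real) / (3 ^ k * norm (w k))" for k g
  define G where "G = rec_nat (0::'a) (\<lambda>k g. g + step k g *\<^sub>R w k)"
  have G_Suc: "G (Suc k) = G k + step k (G k) *\<^sub>R w k" for k by (simp add: G_def)
  define D where "D k = step k (G k) *\<^sub>R w k" for k
  have Dn: "norm (D k) = (1/3) ^ k" for k
    using w0[of k] by (simp add: D_def step_def power_one_over field_simps)
  have G_sum: "G k = (\<Sum>j<k. D j)" for k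
    by (induction k) (simp_all add: G_Suc D_def, simp add: G_def)
  have geo: "summable (\<lambda>k. (1/3::real) ^ k)" by (simp add: summable_geometric)
  have sumD: "summable (\<lambda>k. norm (D k))" unfolding Dn by (rule geo)
  then have sD: "summable D" by (rule summable_norm_cancel)
  define g where "g = suminf D"
  have tail: "norm (g - G (Suc k)) \<le> (1/3)^k / 2" for k
  proof -
    have eq: "g - G (Suc k) = (\<Sum>j. D (j + Suc k))"
      unfolding g_def G_sum using suminf_minus_initial_segment[OF sD, of "Suc k"] by simp
    have s: "summable (\<lambda>j. norm (D (j + Suc k)))"
      using sumD by (subst summable_iff_shift)
    have "norm (g - G (Suc k)) \<le> (\<Sum>j. norm (D (j + Suc k)))"
      unfolding eq by (rule summable_norm[OF s])
    also have "\<dots> = (\<Sum>j. (1/3)^Suc k * (1/3::real) ^ j)"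
      by (simp add: Dn power_add mult_ac)
    also have "\<dots> = (1/3)^Suc k * (\<Sum>j. (1/3::real) ^ j)" by (rule suminf_mult[OF geo])
    also have "\<dots> = (1/3)^k / 2" by (simp add: suminf_geometric)
    finally show ?thesis .
  qed
  have big: "\<bar>inner (w k) (G (Suc k))\<bar> \<ge> norm (w k) / 3 ^ k" for k
  proof -
    have "inner (w k) (w k) = norm (w k) * norm (w k)" by (metis power2_eq_square power2_norm_eq_inner)
    then have "step k (G k) * inner (w k) (w k) = (if 0 \<le> inner (w k) (G k) then 1 else -1) * (norm (w k) / 3 ^ k)"
      using w0[of k] by (simp add: step_def)
    then show ?thesis
      using w0[of k] by (simp add: G_Suc inner_add_right split: if_splits)
  qed
  obtain B where B: "\<And>n. \<bar>inner (v n) g\<bar> \<le> B" using pw[of g] by blast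
  \<comment> \<open>The ratio 1/3 makes the tail after the k-th summand at most half of that
    summand, so half of the pairing \<open>norm (w k) / 3 ^ k\<close> survives in the limit. As
    \<open>norm (w k)\<close> exceeds 4^k, the pairings with \<open>g\<close> are unbounded.\<close>
  have "(4/3) ^ k \<le> 2 * B" for k
  proof -
    have "\<bar>inner (w k) (g - G (Suc k))\<bar> \<le> norm (w k) * ((1/3)^k / 2)"
      by (rule order_trans[OF Cauchy_Schwarz_ineq2 mult_left_mono[OF tail]]) simp
    then have "norm (w k) * (1/3)^k / 2 \<le> \<bar>inner (w k) g\<bar>"
      using big[of k] by (simp add: inner_diff_right power_one_over)
    also have "\<dots> \<le> B" using B by (simp add: w_def)
    finally have "norm (w k) * (1/3)^k \<le> 2 * B" by simp
    moreover have "(4/3) ^ k = 4 ^ k * (1/3 :: real)^k" by (simp flip: power_mult_distrib)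
    moreover have "4 ^ k * (1/3 :: real)^k \<le> norm (w k) * (1/3)^k"
      using wn[of k] by (intro mult_right_mono) auto
    ultimately show ?thesis by linarith
  qed
  moreover obtain k where "2 * B < (4/3) ^ k"
    using real_arch_pow[of "4/3" "2*B"] by auto
  ultimately show False by (meson not_le)
qed

text \<open>If the bound failed, there would be vectors \<open>v n\<close> of norm n + 1 with images
  of norm at most 1. Every \<open>g\<close> is some \<open>T y\<close>, and by symmetry its pairing
  with \<open>v n\<close> equals that of \<open>T (v n)\<close> with \<open>y\<close>, which is
  bounded in n. Uniform boundedness then contradicts the growing norms.\<close>

lemma symmetric_surj_bounded_below:
  fixes T :: "'a::{real_inner,banach} \<Rightarrow> 'a"
  assumes lin: "linear T" and sym: "\<And>x y. inner (T x) y = inner x (T y)" and surj: "surj T"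
  shows "\<exists>c>0. \<forall>x. c * norm x \<le> norm (T x)"
proof (rule ccontr)
  assume "\<not> ?thesis"
  then have "\<exists>x. norm (T x) < 1 / real (Suc n) * norm x" for n
    by (metis not_le of_nat_0_less_iff zero_less_Suc zero_less_divide_1_iff)
  then obtain x where x: "\<And>n. norm (T (x n)) < 1 / real (Suc n) * norm (x n)" by metis
  have x0: "norm (x n) > 0" for n
    by (metis linorder_not_less x linear_0[OF lin] mult_zero_right norm_ge_zero norm_zero
        zero_less_norm_iff)
  define v where "v n = (real (Suc n) / norm (x n)) *\<^sub>R x n" for n
  have nv: "norm (v n) = real (Suc n)" for n using x0[of n] by (simp add: v_def)
  have Tv: "norm (T (v n)) \<le> 1" for n
    using x[of n] x0[of n] by (simp add: v_def linear_scale[OF lin] field_simps)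
  have "\<exists>B. \<forall>n. \<bar>inner (v n) g\<bar> \<le> B" for g
  proof -
    obtain y where y: "g = T y" using surj by (metis surjD)
    have "\<bar>inner (v n) g\<bar> \<le> norm y" for n
    proof -
      have "\<bar>inner (v n) g\<bar> = \<bar>inner (T (v n)) y\<bar>" by (simp add: y sym)
      also have "\<dots> \<le> norm (T (v n)) * norm y" by (rule Cauchy_Schwarz_ineq2)
      also have "\<dots> \<le> 1 * norm y" by (intro mult_right_mono Tv) simp
      finally show ?thesis by simp
    qed
    then show ?thesis by blast
  qed
  then obtain B where B: "\<And>n. norm (v n) \<le> B" using uniform_boundedness_inner by blast
  obtain n where "B < real n" using reals_Archimedean2 by blast
  with B[of n] show False by (simp add: nv)
qed

text \<open>If the infimum \<open>a\<close> of \<open>\<parallel>H x\<parallel>\<^sup>2\<close> over unit vectors were smaller than \<open>\<Delta>\<^sup>2\<close>, the positive operator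
  \<open>P = H\<^sup>2 - a = (H - \<surd>a)(H + \<surd>a)\<close> would be bounded below, whereas \<open>\<parallel>P x\<parallel>\<^sup>2 \<le> M \<langle>x, P x\<rangle>\<close>
  becomes arbitrarily small on unit vectors.\<close>

lemma symmetric_gap_lower_bound:
  fixes H :: "'a::{real_inner,banach} \<Rightarrow> 'a"
  assumes bl: "bounded_linear H" and sym: "\<And>x y. inner (H x) y = inner x (H y)"
    and surj: "\<And>E. \<bar>E\<bar> < \<Delta> \<Longrightarrow> surj (\<lambda>x. H x - E *\<^sub>R x)"
  shows "\<Delta> * norm x \<le> norm (H x)"
proof (rule ccontr)
  assume neg: "\<not> ?thesis"
  interpret H: bounded_linear H by (rule bl)
  have x0: "norm x > 0"
  proof (rule ccontr)
    assume "\<not> norm x > 0" then have "x = 0" by simp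
    with neg show False by (simp add: H.zero)
  qed
  define A where "A = (\<lambda>z. (norm (H z))\<^sup>2) ` {z. norm z = 1}"
  define a where "a = Inf A"
  have bdd: "bdd_below A" unfolding A_def by (intro bdd_belowI[of _ 0]) auto
  define x1 where "x1 = (1 / norm x) *\<^sub>R x"
  have nx1: "norm x1 = 1" using x0 by (simp add: x1_def)
  have x1A: "(norm (H x1))\<^sup>2 \<in> A" using nx1 by (auto simp: A_def)
  have "norm (H x1) < \<Delta>" using neg x0 by (simp add: x1_def H.scaleR field_simps)
  then have \<Delta>0: "0 < \<Delta>" and x1\<Delta>: "(norm (H x1))\<^sup>2 < \<Delta>\<^sup>2"
    using norm_ge_zero[of "H x1"] by (linarith, intro power_strict_mono) auto
  have a0: "0 \<le> a" unfolding a_def using x1A by (intro cInf_greatest) (auto simp: A_def)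
  have "a \<le> (norm (H x1))\<^sup>2" unfolding a_def by (rule cInf_lower[OF x1A bdd])
  then have a\<Delta>: "a < \<Delta>\<^sup>2" using x1\<Delta> by linarith
  define r where "r = sqrt a"
  have r0: "0 \<le> r" and rr: "r * r = a" using a0 by (auto simp: r_def)
  have r\<Delta>: "r < \<Delta>" unfolding r_def using real_sqrt_less_mono[OF a\<Delta>] \<Delta>0 by simp
  have low: "a * (norm z)\<^sup>2 \<le> (norm (H z))\<^sup>2" for z
  proof (cases "z = 0")
    case False
    define z1 where "z1 = (1 / norm z) *\<^sub>R z"
    have "(norm (H z1))\<^sup>2 \<in> A" using False by (auto simp: A_def z1_def)
    then have "a \<le> (norm (H z1))\<^sup>2" unfolding a_def by (rule cInf_lower[OF _ bdd])
    then show ?thesis using False by (simp add: z1_def H.scaleR power_divide field_simps)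
  qed (simp add: H.zero)
  have symE: "inner (H x - E *\<^sub>R x) y = inner x (H y - E *\<^sub>R y)" for E x y
    by (simp add: inner_diff_left inner_diff_right sym)
  have linE: "linear (\<lambda>x. H x - E *\<^sub>R x)" for E
    by (intro linearI) (simp_all add: H.add H.scaleR algebra_simps)
  obtain c1 where c1: "c1 > 0" "\<And>x. c1 * norm x \<le> norm (H x - r *\<^sub>R x)"
    using symmetric_surj_bounded_below[OF linE symE surj] r0 r\<Delta> by (metis abs_of_nonneg)
  obtain c2 where c2: "c2 > 0" "\<And>x. c2 * norm x \<le> norm (H x - (-r) *\<^sub>R x)"
    using symmetric_surj_bounded_below[OF linE symE surj, of "-r"] r0 r\<Delta> by (metis abs_of_nonneg abs_minus)
  define P where "P z = H (H z) - a *\<^sub>R z" for z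
  have Pfact: "P z = H (H z - (-r) *\<^sub>R z) - r *\<^sub>R (H z - (-r) *\<^sub>R z)" for z
    by (simp add: P_def H.add H.scaleR H.diff algebra_simps flip: rr)
  have Plow: "c1 * c2 * norm z \<le> norm (P z)" for z
  proof -
    have "c1 * (c2 * norm z) \<le> c1 * norm (H z - (-r) *\<^sub>R z)" using c1(1) c2(2)[of z] by simp
    also have "\<dots> \<le> norm (P z)" unfolding Pfact by (rule c1(2))
    finally show ?thesis by (simp add: mult.assoc)
  qed
  obtain K where K: "\<And>x. norm (H x) \<le> norm x * K" "K > 0" using H.pos_bounded by blast
  define M where "M = K * K + a"
  have M0: "M > 0" using K(2) a0 by (simp add: M_def add_pos_nonneg)
  have PM: "norm (P z) \<le> M * norm z" for z
  proof -
    have "norm (P z) \<le> norm (H (H z)) + norm (a *\<^sub>R z)" unfolding P_def by (rule norm_triangle_ineq4)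
    also have "norm (H (H z)) \<le> norm z * K * K"
      by (rule order_trans[OF K(1)]) (use K in \<open>simp add: mult_right_mono\<close>)
    finally show ?thesis using a0 by (simp add: M_def algebra_simps)
  qed
  have Pq: "inner z (P z) = (norm (H z))\<^sup>2 - a * (norm z)\<^sup>2" for z
    by (simp add: P_def inner_diff_right power2_norm_eq_inner sym)
  have Psym: "inner z (P y) = inner (P z) y" for z y
    by (simp add: P_def inner_diff_right inner_diff_left sym)
  \<comment> \<open>Cauchy-Schwarz for the positive form of \<open>P\<close>: the form is evaluated
    at z - t P z with t = 1/M, where the bound \<open>PM\<close> lets half of the linear term absorb
    the quadratic one.\<close>
  have CS: "(norm (P z))\<^sup>2 \<le> M * inner z (P z)" for z
  proof -
    define t where "t = 1 / M"
    define p where "p = P z"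
    have lin: "P (z - t *\<^sub>R p) = P z - t *\<^sub>R P p"
      by (simp add: P_def H.diff H.scaleR algebra_simps)
    have zp: "inner z (P p) = inner p p" "inner p (P z) = inner p p" by (simp_all add: Psym p_def)
    have "inner p (P p) \<le> norm p * norm (P p)" by (rule norm_cauchy_schwarz)
    also have "\<dots> \<le> norm p * (M * norm p)" by (intro mult_left_mono PM) simp
    also have "\<dots> = M * inner p p" by (simp add: power2_norm_eq_inner[symmetric] power2_eq_square)
    finally have "t * t * inner p (P p) \<le> t * t * (M * inner p p)" by (intro mult_left_mono) auto
    also have "\<dots> = t * inner p p" using M0 by (simp add: t_def)
    finally have "t * t * inner p (P p) \<le> t * inner p p" .
    moreover have "0 \<le> inner (z - t *\<^sub>R p) (P (z - t *\<^sub>R p))" unfolding Pq using low by simp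
    ultimately have "t * inner p p \<le> inner z (P z)"
      unfolding lin by (simp add: inner_diff_left inner_diff_right zp algebra_simps)
    then show ?thesis using M0 by (simp add: t_def p_def power2_norm_eq_inner field_simps)
  qed
  define \<epsilon> where "\<epsilon> = (c1 * c2)\<^sup>2 / M"
  have \<epsilon>0: "\<epsilon> > 0" using c1 c2 M0 by (simp add: \<epsilon>_def)
  have "a + \<epsilon> \<le> s" if sA: "s \<in> A" for s
  proof -
    obtain z where z: "norm z = 1" "s = (norm (H z))\<^sup>2" using sA by (auto simp: A_def)
    have "(c1 * c2)\<^sup>2 \<le> (norm (P z))\<^sup>2" using Plow[of z] z c1 c2 by (intro power_mono) auto
    also have "\<dots> \<le> M * (s - a)" using CS[of z] z by (simp add: Pq)
    finally show ?thesis using M0 by (simp add: \<epsilon>_def field_simps)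
  qed
  then have "a + \<epsilon> \<le> a" unfolding a_def using x1A by (intro cInf_greatest) auto
  with \<epsilon>0 show False by simp
qed

section \<open>The space of square-summable families\<close>

definition square_summable :: "('i \<Rightarrow> complex) \<Rightarrow> bool" where
  "square_summable f \<longleftrightarrow> (\<lambda>i. (cmod (f i))\<^sup>2) summable_on UNIV"

lemma L2_set_cmod_power2: "(L2_set (\<lambda>i. cmod (f i)) F)\<^sup>2 = (\<Sum>i\<in>F. (cmod (f i))\<^sup>2)"
  by (simp add: L2_set_def sum_nonneg)

text \<open>Uniform bounds on finite sections are the working form of square summability:
  Minkowski's inequality for \<open>L2_set\<close> and the Schur test are statements about finite
  sets and reach infinite families through this rule.\<close>

lemma square_summableI:
  assumes "\<And>F. finite F \<Longrightarrow> L2_set (\<lambda>i. cmod (f i)) F \<le> B"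
  shows "square_summable f"
  unfolding square_summable_def
proof (rule nonneg_bdd_above_summable_on)
  show "bdd_above (sum (\<lambda>i. (cmod (f i))\<^sup>2) ` {F. F \<subseteq> UNIV \<and> finite F})"
  proof (rule bdd_aboveI2)
    fix F :: "'a set" assume "F \<in> {F. F \<subseteq> UNIV \<and> finite F}"
    then have "L2_set (\<lambda>i. cmod (f i)) F \<le> B" using assms by simp
    then have "(L2_set (\<lambda>i. cmod (f i)) F)\<^sup>2 \<le> B\<^sup>2" by (intro power_mono) auto
    then show "(\<Sum>i\<in>F. (cmod (f i))\<^sup>2) \<le> B\<^sup>2" by (simp only: L2_set_cmod_power2)
  qed
qed simp

lemma L2_set_le_infsum:
  assumes "square_summable f" "finite F"
  shows "L2_set (\<lambda>i. cmod (f i)) F \<le> sqrt (\<Sum>\<^sub>\<infinity>i. (cmod (f i))\<^sup>2)"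
  unfolding L2_set_def
  using assms by (intro real_sqrt_le_mono finite_sum_le_infsum) (auto simp: square_summable_def)

lemma square_summable_add:
  assumes "square_summable f" "square_summable g"
  shows "square_summable (\<lambda>i. f i + g i)"
proof (rule square_summableI)
  fix F :: "'a set" assume F: "finite F"
  have "L2_set (\<lambda>i. cmod (f i + g i)) F \<le> L2_set (\<lambda>i. cmod (f i) + cmod (g i)) F"
    by (intro L2_set_mono norm_triangle_ineq) auto
  also have "\<dots> \<le> L2_set (\<lambda>i. cmod (f i)) F + L2_set (\<lambda>i. cmod (g i)) F"
    by (rule L2_set_triangle_ineq)
  also have "\<dots> \<le> sqrt (\<Sum>\<^sub>\<infinity>i. (cmod (f i))\<^sup>2) + sqrt (\<Sum>\<^sub>\<infinity>i. (cmod (g i))\<^sup>2)"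
    using assms F by (intro add_mono L2_set_le_infsum)
  finally show "L2_set (\<lambda>i. cmod (f i + g i)) F
    \<le> sqrt (\<Sum>\<^sub>\<infinity>i. (cmod (f i))\<^sup>2) + sqrt (\<Sum>\<^sub>\<infinity>i. (cmod (g i))\<^sup>2)" .
qed

lemma square_summable_cmult:
  assumes "square_summable f"
  shows "square_summable (\<lambda>i. c * f i)"
  using assms unfolding square_summable_def norm_mult power_mult_distrib
  by (rule summable_on_cmult_right)

lemma square_summable_inner:
  assumes "square_summable f" "square_summable g"
  shows "(\<lambda>i. inner (f i) (g i)) summable_on UNIV"
proof (rule abs_summable_summable, rule abs_summable_on_comparison_test')
  show "(\<lambda>i. (cmod (f i))\<^sup>2 + (cmod (g i))\<^sup>2) summable_on UNIV"
    using assms unfolding square_summable_def by (rule summable_on_add)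
  fix i
  have "norm (inner (f i) (g i)) \<le> cmod (f i) * cmod (g i)" by (simp add: Cauchy_Schwarz_ineq2)
  also have "\<dots> \<le> (cmod (f i))\<^sup>2 + (cmod (g i))\<^sup>2"
    using sum_squares_bound[of "cmod (f i)" "cmod (g i)"]
      mult_nonneg_nonneg[OF norm_ge_zero[of "f i"] norm_ge_zero[of "g i"]] by linarith
  finally show "norm (inner (f i) (g i)) \<le> (cmod (f i))\<^sup>2 + (cmod (g i))\<^sup>2" .
qed

text \<open>A type of its own lets the results for \<open>real_inner\<close> and
  \<open>banach\<close> apply. The inner product is the real part of the Hermitian one; this matches
  the use made of it, since only real energies are subtracted from the Hamiltonian.\<close>

typedef 'i l2 = "{f :: 'i \<Rightarrow> complex. square_summable f}"
  morphisms coord of_coord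
  by (rule exI[of _ "\<lambda>_. 0"]) (simp add: square_summable_def)

setup_lifting type_definition_l2

lemma square_summable_coord [simp]: "square_summable (coord f)"
  using coord by blast

instantiation l2 :: (type) real_vector
begin
lift_definition zero_l2 :: "'a l2" is "\<lambda>_. 0" by (simp add: square_summable_def)
lift_definition plus_l2 :: "'a l2 \<Rightarrow> 'a l2 \<Rightarrow> 'a l2" is "\<lambda>f g i. f i + g i"
  by (rule square_summable_add)
lift_definition uminus_l2 :: "'a l2 \<Rightarrow> 'a l2" is "\<lambda>f i. - f i" by (simp add: square_summable_def)
lift_definition minus_l2 :: "'a l2 \<Rightarrow> 'a l2 \<Rightarrow> 'a l2" is "\<lambda>f g i. f i - g i"
  subgoal for f g
    using square_summable_add[of f "\<lambda>i. - g i"] by (simp add: square_summable_def)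
  done
lift_definition scaleR_l2 :: "real \<Rightarrow> 'a l2 \<Rightarrow> 'a l2" is "\<lambda>r f i. r *\<^sub>R f i"
  unfolding scaleR_conv_of_real by (rule square_summable_cmult)
instance
  by standard (transfer; simp add: fun_eq_iff algebra_simps)+
end

instantiation l2 :: (type) real_inner
begin
definition inner_l2 :: "'a l2 \<Rightarrow> 'a l2 \<Rightarrow> real" where
  "inner_l2 f g = (\<Sum>\<^sub>\<infinity>i. inner (coord f i) (coord g i))"
definition norm_l2 :: "'a l2 \<Rightarrow> real" where "norm_l2 f = sqrt (inner f f)"
definition dist_l2 :: "'a l2 \<Rightarrow> 'a l2 \<Rightarrow> real" where "dist_l2 f g = norm (f - g)"
definition sgn_l2 :: "'a l2 \<Rightarrow> 'a l2" where "sgn_l2 f = inverse (norm f) *\<^sub>R f"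
definition uniformity_l2 :: "('a l2 \<times> 'a l2) filter" where
  "uniformity_l2 = (INF e\<in>{0 <..}. principal {(x, y). dist x y < e})"
definition open_l2 :: "'a l2 set \<Rightarrow> bool" where
  "open_l2 U = (\<forall>x\<in>U. eventually (\<lambda>(x', y). x' = x \<longrightarrow> y \<in> U) uniformity)"
instance
proof
  fix x y z :: "'a l2" and r :: real
  show "inner x y = inner y x" by (simp add: inner_l2_def inner_commute)
  show "inner (x + y) z = inner x z + inner y z"
    by (simp add: inner_l2_def plus_l2.rep_eq inner_add_left infsum_add square_summable_inner)
  show "inner (r *\<^sub>R x) y = r * inner x y"
    by (simp add: inner_l2_def scaleR_l2.rep_eq infsum_cmult_right')
  show "0 \<le> inner x x" unfolding inner_l2_def by (intro infsum_nonneg) simp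
  show "inner x x = 0 \<longleftrightarrow> x = 0"
  proof
    assume "inner x x = 0"
    then have "inner (coord x i) (coord x i) = 0" for i
      unfolding inner_l2_def
      by (rule nonneg_infsum_le_0D[OF eq_refl]) (auto simp: square_summable_inner)
    then show "x = 0" by (transfer) auto
  qed (simp add: inner_l2_def zero_l2.rep_eq)
  show "norm x = sqrt (inner x x)" by (simp add: norm_l2_def)
  show "dist x y = norm (x - y)" by (simp add: dist_l2_def)
  show "sgn x = inverse (norm x) *\<^sub>R x" by (simp add: sgn_l2_def)
  show "uniformity = (INF e\<in>{0 <..}. principal {(x :: 'a l2, y). dist x y < e})"
    by (simp add: uniformity_l2_def)
  show "open U = (\<forall>x\<in>U. \<forall>\<^sub>F (x', y) in uniformity. x' = x \<longrightarrow> y \<in> U)" for U :: "'a l2 set"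
    by (simp add: open_l2_def)
qed
end

lemma norm_l2_eq: "norm f = sqrt (\<Sum>\<^sub>\<infinity>i. (cmod (coord f i))\<^sup>2)"
  by (simp add: norm_l2_def inner_l2_def power2_norm_eq_inner)

lemma L2_set_coord_le_norm:
  assumes "finite F"
  shows "L2_set (\<lambda>i. cmod (coord f i)) F \<le> norm f"
  using L2_set_le_infsum[OF square_summable_coord assms] by (simp add: norm_l2_eq)

lemma norm_l2_leI:
  assumes "\<And>F. finite F \<Longrightarrow> L2_set (\<lambda>i. cmod (coord f i)) F \<le> B"
  shows "norm f \<le> B"
proof -
  have B0: "0 \<le> B" using assms[of "{}"] by simp
  have "(\<Sum>\<^sub>\<infinity>i. (cmod (coord f i))\<^sup>2) \<le> B\<^sup>2"
  proof (rule infsum_le_finite_sums)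
    show "(\<lambda>i. (cmod (coord f i))\<^sup>2) summable_on UNIV"
      using square_summable_coord by (simp add: square_summable_def)
    fix F :: "'a set" assume "finite F"
    then have "(L2_set (\<lambda>i. cmod (coord f i)) F)\<^sup>2 \<le> B\<^sup>2" using assms by (intro power_mono) auto
    then show "(\<Sum>i\<in>F. (cmod (coord f i))\<^sup>2) \<le> B\<^sup>2" by (simp only: L2_set_cmod_power2)
  qed
  then show ?thesis unfolding norm_l2_eq using B0 real_sqrt_le_mono by fastforce
qed

lemma cmod_coord_le_norm: "cmod (coord f i) \<le> norm f"
  using L2_set_coord_le_norm[of "{i}" f] by simp

lemma norm_l2_finite_support:
  assumes "finite G" "\<And>i. i \<notin> G \<Longrightarrow> coord f i = 0"
  shows "norm f = L2_set (\<lambda>i. cmod (coord f i)) G"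
proof -
  have "(\<Sum>\<^sub>\<infinity>i. (cmod (coord f i))\<^sup>2) = (\<Sum>\<^sub>\<infinity>i\<in>G. (cmod (coord f i))\<^sup>2)"
    using assms(2) by (intro infsum_cong_neutral) auto
  then show ?thesis using assms(1) by (simp add: norm_l2_eq L2_set_def)
qed

instance l2 :: (type) banach
proof
  fix X :: "nat \<Rightarrow> 'a l2" assume X: "Cauchy X"
  have coordX: "cmod (coord (X m) i - coord (X n) i) \<le> dist (X m) (X n)" for m n i
    using cmod_coord_le_norm[of "X m - X n" i] by (simp add: minus_l2.rep_eq dist_l2_def)
  have "convergent (\<lambda>n. coord (X n) i)" for i
  proof (rule Cauchy_convergent)
    show "Cauchy (\<lambda>n. coord (X n) i)"
      unfolding Cauchy_def dist_norm
      using X[unfolded Cauchy_def] coordX by (meson le_less_trans)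
  qed
  then obtain f where f: "\<And>i. (\<lambda>n. coord (X n) i) \<longlonglongrightarrow> f i" unfolding convergent_def by metis
  \<comment> \<open>Bounds on finite sections survive coordinatewise limits. Used with
    \<open>g = X N\<close> and bound 1 this puts the limit into the space; used with
    \<open>g = X n\<close> and bound e/2 it gives convergence in norm.\<close>
  have lim: "L2_set (\<lambda>i. cmod (f i - coord g i)) F \<le> B"
    if F: "finite F" and B: "eventually (\<lambda>n. norm (X n - g) \<le> B) sequentially" for F B g
  proof (rule tendsto_upperbound)
    show "(\<lambda>n. L2_set (\<lambda>i. cmod (coord (X n) i - coord g i)) F)
      \<longlonglongrightarrow> L2_set (\<lambda>i. cmod (f i - coord g i)) F"
      unfolding L2_set_def by (intro tendsto_intros f)
    show "\<forall>\<^sub>F n in sequentially. L2_set (\<lambda>i. cmod (coord (X n) i - coord g i)) F \<le> B"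
      using B by eventually_elim
        (use L2_set_coord_le_norm[OF F] in \<open>metis (no_types, lifting) L2_set_cong minus_l2.rep_eq order_trans\<close>)
  qed simp
  have ev: "\<exists>N. \<forall>n\<ge>N. eventually (\<lambda>m. norm (X m - X n) \<le> e) sequentially" if "e > 0" for e
  proof -
    obtain N where N: "\<And>m n. m \<ge> N \<Longrightarrow> n \<ge> N \<Longrightarrow> dist (X m) (X n) < e"
      using X \<open>e > 0\<close> unfolding Cauchy_def by blast
    then show ?thesis
      unfolding eventually_sequentially dist_norm by (meson less_imp_le)
  qed
  obtain N where "eventually (\<lambda>m. norm (X m - X N) \<le> 1) sequentially" using ev[of 1] by auto
  then have "square_summable (\<lambda>i. f i - coord (X N) i)" using lim by (intro square_summableI)
  then have "square_summable (\<lambda>i. (f i - coord (X N) i) + coord (X N) i)"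
    by (intro square_summable_add) auto
  then have ssf: "square_summable f" by simp
  define Y where "Y = of_coord f"
  have cY: "coord Y = f" using ssf by (simp add: Y_def of_coord_inverse)
  have "X \<longlonglongrightarrow> Y"
    unfolding lim_sequentially
  proof (intro allI impI)
    fix e :: real assume "e > 0"
    then obtain N where N: "\<forall>n\<ge>N. eventually (\<lambda>m. norm (X m - X n) \<le> e/2) sequentially"
      using ev[of "e/2"] by auto
    have "dist (X n) Y < e" if "n \<ge> N" for n
    proof -
      have "norm (Y - X n) \<le> e / 2"
        using lim[OF _ N[rule_format, OF that]]
        by (intro norm_l2_leI) (simp only: minus_l2.rep_eq cY)
      then show ?thesis using \<open>e > 0\<close> by (simp add: dist_norm norm_minus_commute)
    qed
    then show "\<exists>N. \<forall>n\<ge>N. dist (X n) Y < e" by blast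
  qed
  then show "convergent X" by (auto simp: convergent_def)
qed

section \<open>Hermitian kernels\<close>

text \<open>Schur test: split \<open>k\<close> as \<open>sqrt k * sqrt k\<close> and apply
  Cauchy-Schwarz. Row sums bound the first factor; after the two sums are exchanged, column sums
  bound the second.\<close>

lemma schur_test_finite:
  fixes k :: "'i \<Rightarrow> 'j \<Rightarrow> real"
  assumes fin: "finite F" "finite G" and k0: "\<And>i j. i \<in> F \<Longrightarrow> j \<in> G \<Longrightarrow> 0 \<le> k i j"
    and row: "\<And>i. i \<in> F \<Longrightarrow> (\<Sum>j\<in>G. k i j) \<le> K" and col: "\<And>j. j \<in> G \<Longrightarrow> (\<Sum>i\<in>F. k i j) \<le> K"
    and K0: "0 \<le> K"
  shows "L2_set (\<lambda>i. \<Sum>j\<in>G. k i j * b j) F \<le> K * L2_set b G"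
proof -
  have sq: "(\<Sum>j\<in>G. k i j * b j)\<^sup>2 \<le> K * (\<Sum>j\<in>G. k i j * (b j)\<^sup>2)" if i: "i \<in> F" for i
  proof -
    have "\<bar>\<Sum>j\<in>G. k i j * b j\<bar> \<le> (\<Sum>j\<in>G. \<bar>sqrt (k i j)\<bar> * \<bar>sqrt (k i j) * b j\<bar>)"
      by (rule order_trans[OF sum_abs])
        (auto intro!: sum_mono simp: abs_mult k0[OF i] simp flip: mult.assoc)
    also have "\<dots> \<le> L2_set (\<lambda>j. sqrt (k i j)) G * L2_set (\<lambda>j. sqrt (k i j) * b j) G"
      by (rule L2_set_mult_ineq)
    finally have "\<bar>\<Sum>j\<in>G. k i j * b j\<bar>\<^sup>2
        \<le> (L2_set (\<lambda>j. sqrt (k i j)) G * L2_set (\<lambda>j. sqrt (k i j) * b j) G)\<^sup>2"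
      by (intro power_mono) auto
    also have "\<dots> = (\<Sum>j\<in>G. k i j) * (\<Sum>j\<in>G. k i j * (b j)\<^sup>2)"
      using k0[OF i] by (simp add: power_mult_distrib L2_set_def sum_nonneg)
    also have "\<dots> \<le> K * (\<Sum>j\<in>G. k i j * (b j)\<^sup>2)"
      using row[OF i] k0[OF i] by (intro mult_right_mono sum_nonneg) auto
    finally show ?thesis by simp
  qed
  have "(\<Sum>i\<in>F. (\<Sum>j\<in>G. k i j * b j)\<^sup>2) \<le> (\<Sum>i\<in>F. K * (\<Sum>j\<in>G. k i j * (b j)\<^sup>2))"
    by (intro sum_mono sq)
  also have "\<dots> = K * (\<Sum>j\<in>G. (\<Sum>i\<in>F. k i j) * (b j)\<^sup>2)"
    by (simp add: sum_distrib_left sum_distrib_right sum.swap[of _ G F])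
  also have "\<dots> \<le> K * (\<Sum>j\<in>G. K * (b j)\<^sup>2)"
    using col K0 by (intro mult_left_mono sum_mono mult_right_mono) auto
  also have "\<dots> = (K * L2_set b G)\<^sup>2"
    by (simp add: L2_set_def power_mult_distrib sum_nonneg power2_eq_square[of K] mult.assoc
        flip: sum_distrib_left)
  finally have "L2_set (\<lambda>i. \<Sum>j\<in>G. k i j * b j) F \<le> sqrt ((K * L2_set b G)\<^sup>2)"
    unfolding L2_set_def[of _ F] by (rule real_sqrt_le_mono)
  then show ?thesis using K0 by (simp add: abs_mult)
qed

lemma schur_test_finite_complex:
  fixes q :: "'i \<Rightarrow> 'j \<Rightarrow> complex"
  assumes "finite F" "finite G"
    and q: "\<And>i j. i \<in> F \<Longrightarrow> j \<in> G \<Longrightarrow> cmod (q i j) \<le> k i j * b j"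
    and "\<And>i j. i \<in> F \<Longrightarrow> j \<in> G \<Longrightarrow> 0 \<le> k i j"
    and "\<And>i. i \<in> F \<Longrightarrow> (\<Sum>j\<in>G. k i j) \<le> K" and "\<And>j. j \<in> G \<Longrightarrow> (\<Sum>i\<in>F. k i j) \<le> K"
    and "0 \<le> K"
  shows "L2_set (\<lambda>i. cmod (\<Sum>j\<in>G. q i j)) F \<le> K * L2_set b G"
proof -
  have "L2_set (\<lambda>i. cmod (\<Sum>j\<in>G. q i j)) F \<le> L2_set (\<lambda>i. \<Sum>j\<in>G. k i j * b j) F"
    by (intro L2_set_mono order_trans[OF norm_sum] sum_mono q) auto
  also have "\<dots> \<le> K * L2_set b G" using assms by (intro schur_test_finite) auto
  finally show ?thesis .
qed

locale hermitian_kernel =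
  fixes h :: "'i \<Rightarrow> 'i \<Rightarrow> complex" and K :: real
  assumes hermitian: "h j i = cnj (h i j)"
    and row_summable: "(\<lambda>j. cmod (h i j)) summable_on UNIV"
    and row_sum: "(\<Sum>\<^sub>\<infinity>j. cmod (h i j)) \<le> K"
begin

lemma row_sum_finite: "finite G \<Longrightarrow> (\<Sum>j\<in>G. cmod (h i j)) \<le> K"
  by (rule order_trans[OF finite_sum_le_infsum[OF row_summable] row_sum]) auto

lemma bound_nonneg: "0 \<le> K"
  using row_sum_finite[of "{}"] by simp

lemma col_sum_finite: "finite F \<Longrightarrow> (\<Sum>i\<in>F. cmod (h i j)) \<le> K"
  using row_sum_finite[of F j] by (metis (mono_tags, lifting) complex_mod_cnj hermitian sum.cong)

lemma finite_section_bound: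
  assumes "finite F" "finite G"
  shows "L2_set (\<lambda>i. cmod (\<Sum>j\<in>G. h i j * f j)) F \<le> K * L2_set (\<lambda>j. cmod (f j)) G"
  using assms
  by (intro schur_test_finite_complex[where k = "\<lambda>i j. cmod (h i j)"])
    (auto simp: norm_mult row_sum_finite col_sum_finite bound_nonneg)

lemma abs_summable_row: "(\<lambda>j. h i j * coord f j) abs_summable_on UNIV"
proof (rule abs_summable_on_comparison_test')
  show "(\<lambda>j. cmod (h i j) * norm f) summable_on UNIV"
    by (rule summable_on_cmult_left[OF row_summable])
  show "norm (h i j * coord f j) \<le> cmod (h i j) * norm f" for j
    by (simp add: norm_mult mult_left_mono cmod_coord_le_norm)
qed

lemma summable_row: "(\<lambda>j. h i j * coord f j) summable_on UNIV"
  by (rule abs_summable_summable[OF abs_summable_row])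

lemma L2_set_row_infsum:
  assumes F: "finite F"
  shows "L2_set (\<lambda>i. cmod (\<Sum>\<^sub>\<infinity>j. h i j * coord f j)) F \<le> K * norm f"
proof (rule tendsto_upperbound)
  show "((\<lambda>G. L2_set (\<lambda>i. cmod (\<Sum>j\<in>G. h i j * coord f j)) F)
      \<longlongrightarrow> L2_set (\<lambda>i. cmod (\<Sum>\<^sub>\<infinity>j. h i j * coord f j)) F) (finite_subsets_at_top UNIV)"
    unfolding L2_set_def by (intro tendsto_intros infsum_tendsto summable_row)
  have "L2_set (\<lambda>i. cmod (\<Sum>j\<in>G. h i j * coord f j)) F \<le> K * norm f" if "finite G" for G
    by (rule order_trans[OF finite_section_bound[OF F that]])
      (intro mult_left_mono L2_set_coord_le_norm that bound_nonneg)
  then show "\<forall>\<^sub>F G in finite_subsets_at_top UNIV.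
      L2_set (\<lambda>i. cmod (\<Sum>j\<in>G. h i j * coord f j)) F \<le> K * norm f"
    by (simp add: eventually_finite_subsets_at_top_weakI)
qed simp

definition kernel_op :: "'i l2 \<Rightarrow> 'i l2" where
  "kernel_op f = of_coord (\<lambda>i. \<Sum>\<^sub>\<infinity>j. h i j * coord f j)"

lemma coord_kernel_op: "coord (kernel_op f) i = (\<Sum>\<^sub>\<infinity>j. h i j * coord f j)"
  unfolding kernel_op_def
  using square_summableI[OF L2_set_row_infsum] by (simp add: of_coord_inverse)

lemma bounded_linear_kernel_op: "bounded_linear kernel_op"
proof (rule bounded_linear_intro[where K = K])
  fix f g and r :: real
  show "kernel_op (f + g) = kernel_op f + kernel_op g"
    by (simp add: coord_inject[symmetric] fun_eq_iff coord_kernel_op plus_l2.rep_eq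
        distrib_left infsum_add summable_row)
  show "kernel_op (r *\<^sub>R f) = r *\<^sub>R kernel_op f"
    by (simp add: coord_inject[symmetric] fun_eq_iff coord_kernel_op scaleR_l2.rep_eq infsum_scaleR_right)
  show "norm (kernel_op f) \<le> norm f * K"
    by (rule norm_l2_leI) (use L2_set_row_infsum in \<open>simp add: coord_kernel_op mult.commute\<close>)
qed

text \<open>Exchanging the two infinite sums requires absolute summability of the double family. The
  finite Schur test, applied to the moduli of \<open>h\<close>, bounds every finite partial sum by
  \<open>K * norm f * norm g\<close>.\<close>

lemma kernel_op_symmetric: "inner (kernel_op f) g = inner f (kernel_op g)"
proof -
  let ?a = "\<lambda>i j. inner (h i j * coord f j) (coord g i)"
  have bound: "(\<Sum>(i,j)\<in>X. norm (?a i j)) \<le> K * norm f * norm g" if X: "finite X" for X :: "('i \<times> 'i) set"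
  proof -
    define F where "F = fst ` X"
    define G where "G = snd ` X"
    have fin: "finite F" "finite G" and sub: "X \<subseteq> F \<times> G" using X by (auto simp: F_def G_def image_iff) force+
    have "(\<Sum>(i,j)\<in>X. norm (?a i j)) \<le> (\<Sum>(i,j)\<in>F \<times> G. norm (?a i j))"
      using fin sub by (intro sum_mono2) auto
    also have "\<dots> = (\<Sum>i\<in>F. \<Sum>j\<in>G. norm (?a i j))" by (simp add: sum.cartesian_product)
    also have "\<dots> \<le> (\<Sum>i\<in>F. \<bar>\<Sum>j\<in>G. cmod (h i j) * cmod (coord f j)\<bar> * \<bar>cmod (coord g i)\<bar>)"
    proof (rule sum_mono)
      fix i
      have "(\<Sum>j\<in>G. norm (?a i j)) \<le> (\<Sum>j\<in>G. cmod (h i j) * cmod (coord f j) * cmod (coord g i))"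
        by (intro sum_mono) (metis Cauchy_Schwarz_ineq2 norm_mult real_norm_def)
      then show "(\<Sum>j\<in>G. norm (?a i j)) \<le> \<bar>\<Sum>j\<in>G. cmod (h i j) * cmod (coord f j)\<bar> * \<bar>cmod (coord g i)\<bar>"
        by (simp add: sum_distrib_right sum_nonneg)
    qed
    also have "\<dots> \<le> L2_set (\<lambda>i. \<Sum>j\<in>G. cmod (h i j) * cmod (coord f j)) F * L2_set (\<lambda>i. cmod (coord g i)) F"
      by (rule L2_set_mult_ineq)
    also have "\<dots> \<le> (K * L2_set (\<lambda>j. cmod (coord f j)) G) * norm g"
      using fin by (intro mult_mono schur_test_finite L2_set_coord_le_norm)
        (auto simp: row_sum_finite col_sum_finite bound_nonneg)
    also have "\<dots> \<le> K * norm f * norm g"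
      using fin by (intro mult_right_mono mult_left_mono L2_set_coord_le_norm) (auto simp: bound_nonneg)
    finally show ?thesis .
  qed
  have "(\<lambda>(i,j). ?a i j) summable_on UNIV \<times> UNIV"
  proof (rule abs_summable_summable, rule nonneg_bdd_above_summable_on)
    show "bdd_above (sum (\<lambda>x. norm (case x of (i,j) \<Rightarrow> ?a i j)) ` {F. F \<subseteq> UNIV \<times> UNIV \<and> finite F})"
      using bound by (intro bdd_aboveI2[where M = "K * norm f * norm g"])
        (auto simp: case_prod_unfold)
  qed simp
  note swap = infsum_swap_banach[OF this]
  have inner_row: "inner (\<Sum>\<^sub>\<infinity>j. h i j * coord f j) c = (\<Sum>\<^sub>\<infinity>j. inner (h i j * coord f j) c)" for i c f
    by (rule infsumI[symmetric, OF has_sum_bounded_linear[OF bounded_linear_inner_left has_sum_infsum[OF summable_row]]])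
  have "inner (kernel_op f) g = (\<Sum>\<^sub>\<infinity>i. \<Sum>\<^sub>\<infinity>j. ?a i j)"
    unfolding inner_l2_def coord_kernel_op inner_row ..
  also have "\<dots> = (\<Sum>\<^sub>\<infinity>j. \<Sum>\<^sub>\<infinity>i. ?a i j)" by (rule swap)
  also have "\<dots> = (\<Sum>\<^sub>\<infinity>j. \<Sum>\<^sub>\<infinity>i. inner (h j i * coord g i) (coord f j))"
  proof (intro infsum_cong)
    fix i j
    show "?a i j = inner (h j i * coord g i) (coord f j)"
      by (subst hermitian[of j i]) (simp add: inner_complex_def algebra_simps)
  qed
  also have "\<dots> = inner (kernel_op g) f"
    unfolding inner_l2_def coord_kernel_op inner_row ..
  finally show ?thesis by (simp add: inner_commute)
qed

text \<open>Transports the abstract gap inequality back to a finitely supported \<open>f\<close> and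
  finite sections of its image, so that the decay argument can work with finite sums alone.\<close>

lemma spectral_gap_coercive:
  assumes surj: "\<And>E g. \<bar>E\<bar> < \<Delta> \<Longrightarrow> square_summable g \<Longrightarrow>
      \<exists>f. square_summable f \<and> (\<forall>i. (\<Sum>\<^sub>\<infinity>j. h i j * f j) - of_real E * f i = g i)"
    and G: "finite G"
    and le: "\<And>F. finite F \<Longrightarrow> L2_set (\<lambda>i. cmod (\<Sum>j\<in>G. h i j * f j)) F \<le> B"
  shows "\<Delta> * L2_set (\<lambda>j. cmod (f j)) G \<le> B"
proof -
  define f' where "f' = of_coord (\<lambda>j. if j \<in> G then f j else 0)"
  have "square_summable (\<lambda>j. if j \<in> G then f j else 0)"
  proof (rule square_summableI)
    fix F :: "'i set" assume F: "finite F"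
    have "(\<Sum>j\<in>F. (cmod (if j \<in> G then f j else 0))\<^sup>2) = (\<Sum>j\<in>F \<inter> G. (cmod (f j))\<^sup>2)"
      using F by (subst sum.inter_restrict) (auto intro!: sum.cong)
    also have "\<dots> \<le> (\<Sum>j\<in>G. (cmod (f j))\<^sup>2)" using G by (intro sum_mono2) auto
    finally show "L2_set (\<lambda>j. cmod (if j \<in> G then f j else 0)) F \<le> L2_set (\<lambda>j. cmod (f j)) G"
      by (simp add: L2_set_def)
  qed
  then have cf: "coord f' = (\<lambda>j. if j \<in> G then f j else 0)" by (simp add: f'_def of_coord_inverse)
  have "norm f' = L2_set (\<lambda>j. cmod (coord f' j)) G"
    using G by (intro norm_l2_finite_support) (auto simp: cf)
  also have "\<dots> = L2_set (\<lambda>j. cmod (f j)) G" by (intro L2_set_cong) (auto simp: cf)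
  finally have nf: "norm f' = L2_set (\<lambda>j. cmod (f j)) G" .
  have opf: "coord (kernel_op f') i = (\<Sum>j\<in>G. h i j * f j)" for i
  proof -
    have "(\<Sum>\<^sub>\<infinity>j. h i j * coord f' j) = (\<Sum>\<^sub>\<infinity>j\<in>G. h i j * f j)"
      by (intro infsum_cong_neutral) (auto simp: cf)
    then show ?thesis using G by (simp add: coord_kernel_op)
  qed
  have "surj (\<lambda>x. kernel_op x - E *\<^sub>R x)" if E: "\<bar>E\<bar> < \<Delta>" for E
    unfolding surj_def
  proof (rule allI)
    fix g
    obtain u where u: "square_summable u" "\<And>i. (\<Sum>\<^sub>\<infinity>j. h i j * u j) - of_real E * u i = coord g i"
      using surj[OF E square_summable_coord] by blast
    have "g = kernel_op (of_coord u) - E *\<^sub>R of_coord u"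
      using u by (simp add: coord_inject[symmetric] fun_eq_iff minus_l2.rep_eq scaleR_l2.rep_eq
          coord_kernel_op of_coord_inverse scaleR_conv_of_real)
    then show "\<exists>x. g = kernel_op x - E *\<^sub>R x" by blast
  qed
  then have "\<Delta> * norm f' \<le> norm (kernel_op f')"
    by (intro symmetric_gap_lower_bound bounded_linear_kernel_op kernel_op_symmetric)
  also have "\<dots> \<le> B" by (rule norm_l2_leI) (simp add: opf le)
  finally show ?thesis by (simp add: nf)
qed

end

section \<open>Exponential decay of eigenvectors in the gap\<close>

text \<open>Pays for the variation of the weight along a hop with the short-range factor: r is the
  hopping distance in units of d and t the small rate. From e^(tr) - 1 \<le> t r e^(tr) the claim
  follows because r \<le> e^(3r/4) and t \<le> 1/4, so that the two exponents add up to r.\<close>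

lemma exp_minus_one_le:
  fixes r t :: real
  assumes "0 \<le> r" "0 \<le> t" "t \<le> 1/4"
  shows "exp (t * r) - 1 \<le> t * exp r"
proof -
  have "1 - exp (- (t * r)) \<le> t * r" using exp_ge_add_one_self[of "- (t * r)"] by linarith
  then have "exp (t * r) * (1 - exp (- (t * r))) \<le> exp (t * r) * (t * r)" by (intro mult_left_mono) auto
  then have "exp (t * r) - 1 \<le> t * (r * exp (t * r))"
    by (simp add: algebra_simps flip: exp_add)
  also have "r * exp (t * r) \<le> exp (3/4 * r) * exp (1/4 * r)"
  proof (intro mult_mono)
    have "(1 + 3/8 * r)\<^sup>2 \<le> (exp (3/8 * r))\<^sup>2" using assms exp_ge_add_one_self[of "3/8 * r"] by (intro power_mono) auto
    also have "\<dots> = exp (3/4 * r)" by (simp add: power2_eq_square flip: exp_add)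
    finally have "(1 + 3/8 * r)\<^sup>2 \<le> exp (3/4 * r)" .
    moreover have "r \<le> (1 + 3/8 * r)\<^sup>2"
    proof -
      have "(1 + 3/8 * r)\<^sup>2 - r = (3/8 * r - 1/3)\<^sup>2 + 8/9" by (simp add: power2_eq_square algebra_simps)
      then show ?thesis by (metis add_nonneg_nonneg diff_ge_0_iff_ge divide_nonneg_nonneg zero_le_numeral zero_le_power2)
    qed
    ultimately show "r \<le> exp (3/4 * r)" by linarith
    show "exp (t * r) \<le> exp (1/4 * r)"
      unfolding exp_le_cancel_iff by (intro mult_right_mono assms)
  qed (use assms in auto)
  also have "\<dots> = exp r" by (simp flip: exp_add)
  finally show ?thesis using assms(2) by (simp add: mult_left_mono)
qed

lemma abs_exp_diff_le:
  fixes a b s :: real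
  assumes "\<bar>a - b\<bar> \<le> s"
  shows "\<bar>exp a - exp b\<bar> \<le> exp a * (exp s - 1)"
proof -
  have eb: "exp b = exp a * exp (b - a)" by (simp flip: exp_add)
  have "exp (b - a) \<le> exp s" using assms by simp
  moreover have "exp (- s) \<le> exp (b - a)" using assms by simp
  \<comment> \<open>This makes the upward deviation \<open>exp s - 1\<close> dominate the downward
    deviation \<open>1 - exp (- s)\<close> as well.\<close>
  moreover have "2 \<le> exp s + exp (- s)"
    using exp_ge_add_one_self[of s] exp_ge_add_one_self[of "- s"] by linarith
  ultimately have "\<bar>1 - exp (b - a)\<bar> \<le> exp s - 1" by linarith
  then have "exp a * \<bar>1 - exp (b - a)\<bar> \<le> exp a * (exp s - 1)" by (intro mult_left_mono) auto
  moreover have "\<bar>exp a - exp b\<bar> = exp a * \<bar>1 - exp (b - a)\<bar>"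
  proof -
    have "exp a - exp b = exp a * (1 - exp (b - a))" by (subst eb) (simp add: algebra_simps)
    then show ?thesis by (simp add: abs_mult)
  qed
  ultimately show ?thesis by simp
qed

locale gapped_kernel =
  fixes h :: "int \<Rightarrow> int \<Rightarrow> complex" and d K \<Delta> :: real
  assumes hermitian: "h j i = cnj (h i j)"
    and d_pos: "0 < d" and K_pos: "0 < K" and gap_pos: "0 < \<Delta>"
    and row_sum: "finite G \<Longrightarrow> (\<Sum>j\<in>G. cmod (h i j) * exp (real_of_int \<bar>i div 2 - j div 2\<bar> / d)) \<le> K"
    and coercive: "\<lbrakk>finite G; \<And>F. finite F \<Longrightarrow> L2_set (\<lambda>i. cmod (\<Sum>j\<in>G. h i j * f j)) F \<le> B\<rbrakk>
      \<Longrightarrow> \<Delta> * L2_set (\<lambda>j. cmod (f j)) G \<le> B"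
begin

text \<open>Site and sublattice are merged into one integer index, so \<open>i div 2\<close> is the
  site and \<open>\<rho>\<close> the distance between sites.\<close>

abbreviation \<rho> :: "int \<Rightarrow> int \<Rightarrow> real" where "\<rho> i j \<equiv> real_of_int \<bar>i div 2 - j div 2\<bar>"

lemma col_sum:
  assumes "finite F"
  shows "(\<Sum>i\<in>F. cmod (h i j) * exp (\<rho> i j / d)) \<le> K"
proof -
  have "(\<Sum>i\<in>F. cmod (h i j) * exp (\<rho> i j / d)) = (\<Sum>i\<in>F. cmod (h j i) * exp (\<rho> j i / d))"
    by (intro sum.cong refl arg_cong2[where f = "(*)"])
      (metis complex_mod_cnj hermitian, simp add: abs_minus_commute)
  then show ?thesis using row_sum[OF assms, of j] by simp
qed

lemma weighted_schur:
  assumes "finite F" "finite G" "0 \<le> c"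
    and "\<And>i j. i \<in> F \<Longrightarrow> j \<in> G \<Longrightarrow> cmod (q i j) \<le> c * (cmod (h i j) * exp (\<rho> i j / d)) * b j"
  shows "L2_set (\<lambda>i. cmod (\<Sum>j\<in>G. q i j)) F \<le> c * K * L2_set b G"
  using assms K_pos
  by (intro schur_test_finite_complex[where k = "\<lambda>i j. c * (cmod (h i j) * exp (\<rho> i j / d))"])
    (simp_all only: row_sum col_sum mult_left_mono mult_nonneg_nonneg norm_ge_zero exp_ge_zero less_imp_le
      flip: sum_distrib_left)

text \<open>Coercivity tested on a single basis vector, whose image is one column of
  \<open>h\<close>. It guarantees that the decay rate is at most 1/(4d).\<close>

lemma gap_le: "\<Delta> \<le> K"
proof -
  have "\<Delta> * L2_set (\<lambda>j. cmod ((\<lambda>_. 1) j)) {0::int} \<le> 1 * K * L2_set (\<lambda>_. 1) {0::int}"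
  proof (rule coercive)
    fix F :: "int set" assume F: "finite F"
    show "L2_set (\<lambda>i. cmod (\<Sum>j\<in>{0}. h i j * 1)) F \<le> 1 * K * L2_set (\<lambda>_. 1) {0::int}"
      by (rule weighted_schur) (use F d_pos in \<open>auto simp: mult_le_cancel_left1\<close>)
  qed simp
  then show ?thesis by simp
qed

text \<open>The rate is chosen so that commuting the weight past \<open>h\<close> costs \<mu> d K =
  \<Delta>/4. With \<Delta>/2 already spent on the energy, a quarter of the gap remains.\<close>

definition \<mu> :: real where "\<mu> = \<Delta> / (4 * d * K)"

lemma mu_bounds: "0 < \<mu>" "\<mu> * d \<le> 1/4" "\<mu> * d * K = \<Delta> / 4"
  using gap_pos d_pos K_pos gap_le by (auto simp: \<mu>_def field_simps)

text \<open>Distance from the site of \<open>i\<close> to the nearest site outside the chain, hence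
  1 at both end sites. Clipping at 0 makes the weight equal to 1 outside, so the part of
  \<open>h u\<close> that leaks out of the chain is not amplified.\<close>

definition depth :: "nat \<Rightarrow> int \<Rightarrow> real" where
  "depth L i = real_of_int (max 0 (min (i div 2 + 1) (int L - i div 2)))"

lemma depth_lipschitz: "\<bar>depth L i - depth L j\<bar> \<le> \<rho> i j"
  unfolding depth_def by linarith

lemma depth_outside: "i \<notin> {0..<2 * int L} \<Longrightarrow> depth L i = 0"
  by (auto simp: depth_def)

text \<open>The weighted eigenvector, supported on the chain, is tested against the bulk gap. Its
  image consists of the energy term, the commutator with the weight and the leakage out of the
  chain. The first two take \<Delta>/2 and \<Delta>/4 of the gap; the last is measured by the
  unweighted \<open>u\<close> and carries e^(-1/d) because leaving the chain is a hop of at least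
  one site.\<close>

lemma eigenvector_decay:
  fixes L :: nat and u :: "int \<Rightarrow> complex"
  defines "G \<equiv> {0..<2 * int L}"
  defines "\<phi> \<equiv> \<lambda>i. of_real (exp (\<mu> * depth L i)) * u i"
  assumes eig: "\<And>i. i \<in> G \<Longrightarrow> (\<Sum>j\<in>G. h i j * u j) = of_real E * u i"
    and E: "\<bar>E\<bar> \<le> \<Delta> / 2"
  shows "L2_set (\<lambda>i. cmod (\<phi> i)) G \<le> 4 * (K / \<Delta>) * exp (- 1 / d) * L2_set (\<lambda>i. cmod (u i)) G"
proof -
  define w where "w i = exp (\<mu> * depth L i)" for i
  have finG: "finite G" by (simp add: G_def)
  define \<Phi> where "\<Phi> = L2_set (\<lambda>i. cmod (\<phi> i)) G"
  define U where "U = L2_set (\<lambda>i. cmod (u i)) G"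
  have \<phi>: "\<phi> i = of_real (w i) * u i" for i by (simp add: \<phi>_def w_def)
  have outside: "i \<notin> G \<Longrightarrow> w i = 1" for i using depth_outside[of i L] by (simp add: w_def G_def)
  have "\<Delta> * \<Phi> \<le> \<Delta> / 2 * \<Phi> + (\<mu> * d * K * \<Phi> + exp (- 1 / d) * K * U)"
    unfolding \<Phi>_def
  proof (rule coercive[OF finG], fold \<Phi>_def)
    fix F :: "int set" assume F: "finite F"
    \<comment> \<open>\<open>?t1\<close> is the energy term, \<open>?t2\<close> the commutator of
      \<open>h\<close> with the weight, \<open>?t3\<close> the leakage; the weight in front of
      \<open>?t3\<close> has disappeared because it is 1 outside the chain.\<close>
    let ?t1 = "\<lambda>i. if i \<in> G then of_real E * \<phi> i else 0"
    let ?t2 = "\<lambda>i. \<Sum>j\<in>G. h i j * of_real (w j - w i) * u j"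
    let ?t3 = "\<lambda>i. \<Sum>j\<in>G. if i \<in> G then 0 else h i j * u j"
    have split: "(\<Sum>j\<in>G. h i j * \<phi> j) = ?t1 i + (?t2 i + ?t3 i)" for i
    proof -
      have "(\<Sum>j\<in>G. h i j * \<phi> j) = ?t2 i + of_real (w i) * (\<Sum>j\<in>G. h i j * u j)"
        by (simp add: \<phi> sum_distrib_left algebra_simps flip: sum.distrib)
      moreover have "of_real (w i) * (\<Sum>j\<in>G. h i j * u j) = ?t1 i + ?t3 i"
        using outside[of i] eig[of i] by (cases "i \<in> G") (simp_all add: \<phi>)
      ultimately show ?thesis by simp
    qed
    have "L2_set (\<lambda>i. cmod (\<Sum>j\<in>G. h i j * \<phi> j)) F
        \<le> L2_set (\<lambda>i. cmod (?t1 i) + (cmod (?t2 i) + cmod (?t3 i))) F"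
      unfolding split
      by (intro L2_set_mono order_trans[OF norm_triangle_ineq] add_left_mono norm_triangle_ineq) auto
    also have "\<dots> \<le> L2_set (\<lambda>i. cmod (?t1 i)) F + L2_set (\<lambda>i. cmod (?t2 i) + cmod (?t3 i)) F"
      by (rule L2_set_triangle_ineq)
    also have "\<dots> \<le> L2_set (\<lambda>i. cmod (?t1 i)) F + (L2_set (\<lambda>i. cmod (?t2 i)) F + L2_set (\<lambda>i. cmod (?t3 i)) F)"
      by (intro add_left_mono L2_set_triangle_ineq)
    also have "\<dots> \<le> \<Delta> / 2 * \<Phi> + (\<mu> * d * K * \<Phi> + exp (- 1 / d) * K * U)"
    proof (intro add_mono)
      have "(\<Sum>i\<in>F. (cmod (?t1 i))\<^sup>2) = (\<Sum>i\<in>F \<inter> G. (cmod (of_real E * \<phi> i))\<^sup>2)"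
        using F by (subst sum.inter_restrict) (auto intro!: sum.cong)
      also have "\<dots> \<le> (\<Sum>i\<in>G. (cmod (of_real E * \<phi> i))\<^sup>2)" using finG by (intro sum_mono2) auto
      finally have "L2_set (\<lambda>i. cmod (?t1 i)) F \<le> L2_set (\<lambda>i. cmod (of_real E * \<phi> i)) G"
        by (simp add: L2_set_def)
      also have "\<dots> = \<bar>E\<bar> * \<Phi>" by (simp add: \<Phi>_def norm_mult L2_set_right_distrib)
      also have "\<dots> \<le> \<Delta> / 2 * \<Phi>" using E by (intro mult_right_mono) (auto simp: \<Phi>_def)
      finally show "L2_set (\<lambda>i. cmod (?t1 i)) F \<le> \<Delta> / 2 * \<Phi>" .
      show "L2_set (\<lambda>i. cmod (?t2 i)) F \<le> \<mu> * d * K * \<Phi>"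
        unfolding \<Phi>_def
      proof (rule weighted_schur[OF F finG])
        fix i j assume "i \<in> F" "j \<in> G"
        have "\<bar>w j - w i\<bar> \<le> w j * (exp (\<mu> * \<rho> i j) - 1)"
          unfolding w_def
        proof (rule abs_exp_diff_le)
          have "\<bar>\<mu> * depth L j - \<mu> * depth L i\<bar> = \<mu> * \<bar>depth L i - depth L j\<bar>"
            using mu_bounds(1) by (simp add: abs_mult abs_minus_commute flip: right_diff_distrib)
          also have "\<dots> \<le> \<mu> * \<rho> i j" using mu_bounds(1) depth_lipschitz by (intro mult_left_mono) auto
          finally show "\<bar>\<mu> * depth L j - \<mu> * depth L i\<bar> \<le> \<mu> * \<rho> i j" .
        qed
        also have "exp (\<mu> * \<rho> i j) - 1 \<le> \<mu> * d * exp (\<rho> i j / d)"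
          using exp_minus_one_le[of "\<rho> i j / d" "\<mu> * d"] mu_bounds d_pos by simp
        finally have "\<bar>w j - w i\<bar> \<le> w j * (\<mu> * d * exp (\<rho> i j / d))"
          by (simp add: w_def)
        then have "cmod (h i j) * \<bar>w j - w i\<bar> * cmod (u j)
            \<le> cmod (h i j) * (w j * (\<mu> * d * exp (\<rho> i j / d))) * cmod (u j)"
          by (intro mult_right_mono mult_left_mono) auto
        then show "cmod (h i j * of_real (w j - w i) * u j)
            \<le> \<mu> * d * (cmod (h i j) * exp (\<rho> i j / d)) * cmod (\<phi> j)"
          by (simp add: \<phi> norm_mult w_def mult_ac del: of_real_diff)
      qed (use mu_bounds d_pos in auto)
      show "L2_set (\<lambda>i. cmod (?t3 i)) F \<le> exp (- 1 / d) * K * U"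
        unfolding U_def
      proof (rule weighted_schur[OF F finG])
        fix i j assume "i \<in> F" and j: "j \<in> G"
        show "cmod (if i \<in> G then 0 else h i j * u j)
            \<le> exp (- 1 / d) * (cmod (h i j) * exp (\<rho> i j / d)) * cmod (u j)"
        proof (cases "i \<in> G")
          case False
          then have "i div 2 < 0 \<or> int L \<le> i div 2" unfolding G_def atLeastLessThan_iff by presburger
          moreover have "0 \<le> j div 2" "j div 2 < int L" using j by (auto simp: G_def)
          ultimately have "1 \<le> \<bar>i div 2 - j div 2\<bar>" by linarith
          then have "1 \<le> \<rho> i j" by linarith
          then have "1 \<le> exp (- 1 / d) * exp (\<rho> i j / d)"
            using d_pos by (simp add: divide_right_mono flip: exp_add add_divide_distrib)
          then have "cmod (h i j) * cmod (u j) * 1 \<le> cmod (h i j) * cmod (u j) * (exp (- 1 / d) * exp (\<rho> i j / d))"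
            by (intro mult_left_mono) auto
          then show ?thesis using False by (simp add: norm_mult mult_ac)
        qed auto
      qed simp
    qed
    finally show "L2_set (\<lambda>i. cmod (\<Sum>j\<in>G. h i j * \<phi> j)) F
        \<le> \<Delta> / 2 * \<Phi> + (\<mu> * d * K * \<Phi> + exp (- 1 / d) * K * U)" .
  qed
  then have "\<Delta> / 4 * \<Phi> \<le> exp (- 1 / d) * K * U" unfolding mu_bounds(3) by linarith
  then show ?thesis using gap_pos unfolding \<Phi>_def[symmetric] U_def[symmetric]
    by (simp add: field_simps)
qed

text \<open>The factors \<open>e\<^sup>-\<^sup>1\<^sup>/\<^sup>d\<close>, which come from hopping by at least one site, absorb the factor \<open>1/d\<close> in
  \<open>K/\<Delta> \<le> L/(128 d)\<close>; this is why the final prefactor is a polynomial in \<open>L\<close> alone.\<close>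

lemma eigenvector_commutator_bound:
  fixes L :: nat and u :: "int \<Rightarrow> complex" and \<theta> :: "int \<Rightarrow> complex"
  defines "G \<equiv> {0..<2 * int L}"
  assumes eig: "\<And>i. i \<in> G \<Longrightarrow> (\<Sum>j\<in>G. h i j * u j) = of_real E * u i"
    and E: "\<bar>E\<bar> \<le> \<Delta> / 2" and unit: "L2_set (\<lambda>i. cmod (u i)) G = 1"
    and \<theta>: "\<And>i. \<theta> i = (if i div 2 < int (L div 2) then 1 else 0)"
    and y: "1 \<le> real L * \<Delta> / (128 * d * K)"
  shows "L2_set (\<lambda>i. cmod (\<Sum>j\<in>G. (\<theta> i - \<theta> j) * h i j * u j)) G
    \<le> \<Delta> * (real L)\<^sup>2 * exp (- 16 * (real L * \<Delta> / (128 * d * K)))"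
proof -
  define w where "w i = exp (\<mu> * depth L i)" for i
  define \<phi> where "\<phi> i = of_real (w i) * u i" for i
  \<comment> \<open>The first factor is the gain from crossing the middle of the chain. The second
    is what the short-range factor e^(\<rho>/d) still yields after \<mu> \<rho> has been paid: \<mu>
    d \<le> 1/4 and \<rho> \<ge> 1 leave at least 1/(2d) in the exponent.\<close>
  define c where "c = exp (- (\<mu> * real L / 2)) * exp (- 1 / (2 * d))"
  have finG: "finite G" by (simp add: G_def)
  have "L2_set (\<lambda>i. cmod (\<Sum>j\<in>G. (\<theta> i - \<theta> j) * h i j * u j)) G \<le> c * K * L2_set (\<lambda>i. cmod (\<phi> i)) G"
  proof (rule weighted_schur[OF finG finG])
    fix i j assume i: "i \<in> G" and j: "j \<in> G"
    show "cmod ((\<theta> i - \<theta> j) * h i j * u j) \<le> c * (cmod (h i j) * exp (\<rho> i j / d)) * cmod (\<phi> j)"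
    proof (cases "\<theta> i = \<theta> j")
      case True then show ?thesis by (simp add: c_def)
    next
      case False
      then have across: "i div 2 < int (L div 2) \<and> int (L div 2) \<le> j div 2 \<or>
          j div 2 < int (L div 2) \<and> int (L div 2) \<le> i div 2"
        by (auto simp: \<theta> split: if_splits)
      then have \<rho>1: "1 \<le> \<rho> i j" by auto
      have jr: "0 \<le> j div 2" "j div 2 < int L" using j by (auto simp: G_def)
      \<comment> \<open>A hop across the cut either is long or starts close to the middle, where the
        depth is about L/2; in every case depth plus hopping distance is at least L/2. Rounding in
        \<open>L div 2\<close> is covered by the integer inequality.\<close>
      have "int L - 2 * \<bar>i div 2 - j div 2\<bar> \<le> 2 * max 0 (min (j div 2 + 1) (int L - j div 2))"
        using across jr by (auto simp: max_def min_def zdiv_int)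
      then have "real L - 2 * \<rho> i j \<le> 2 * depth L j" unfolding depth_def by linarith
      then have "\<mu> * (real L / 2) \<le> \<mu> * (depth L j + \<rho> i j)" using mu_bounds(1) by (intro mult_left_mono) auto
      moreover have "\<mu> * \<rho> i j \<le> \<rho> i j / d - 1 / (2 * d)"
      proof -
        have "\<mu> * d * \<rho> i j \<le> 1/4 * \<rho> i j" using mu_bounds(2) by (intro mult_right_mono) auto
        then have "\<mu> * d * \<rho> i j \<le> \<rho> i j - 1/2" using \<rho>1 by linarith
        then show ?thesis using d_pos by (simp add: field_simps)
      qed
      ultimately have "0 \<le> - (\<mu> * real L / 2) + - 1 / (2 * d) + \<rho> i j / d + \<mu> * depth L j"
        by (simp add: algebra_simps)
      then have "1 \<le> c * exp (\<rho> i j / d) * w j"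
        by (simp add: c_def w_def flip: exp_add)
      then have "cmod (h i j) * cmod (u j) * 1 \<le> cmod (h i j) * cmod (u j) * (c * exp (\<rho> i j / d) * w j)"
        by (intro mult_left_mono) auto
      moreover have "cmod (\<theta> i - \<theta> j) = 1" using across by (auto simp: \<theta>)
      ultimately show ?thesis by (simp add: norm_mult \<phi>_def w_def mult_ac)
    qed
  qed (simp add: c_def)
  also have "\<dots> \<le> c * K * (4 * (K / \<Delta>) * exp (- 1 / d) * 1)"
    using eigenvector_decay[of L u E] eig E K_pos unit
    by (intro mult_left_mono) (auto simp: G_def \<phi>_def w_def c_def)
  also have "\<dots> = 4 * \<Delta> * exp (- (\<mu> * real L / 2)) * (K / \<Delta> * exp (- 1 / (2 * d))) * (K / \<Delta> * exp (- 1 / d))"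
    using gap_pos by (simp add: c_def)
  also have "\<dots> \<le> 4 * \<Delta> * exp (- (\<mu> * real L / 2)) * (real L / 64) * (real L / 64)"
  proof -
    have e1: "exp (- 1 / (2 * d)) \<le> 2 * d"
    proof -
      have "1 / (2 * d) \<le> exp (1 / (2 * d))" using exp_ge_add_one_self[of "1 / (2 * d)"] by linarith
      then show ?thesis using d_pos by (simp add: exp_minus field_simps)
    qed
    have "K / \<Delta> * exp (- 1 / (2 * d)) \<le> K / \<Delta> * (2 * d)"
      using e1 K_pos gap_pos by (intro mult_left_mono) auto
    also have "\<dots> \<le> real L / 64" using y gap_pos d_pos K_pos by (simp add: field_simps)
    finally have k1: "K / \<Delta> * exp (- 1 / (2 * d)) \<le> real L / 64" .
    have "exp (- 1 / d) \<le> exp (- 1 / (2 * d))" using d_pos by (simp add: field_simps)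
    then have "K / \<Delta> * exp (- 1 / d) \<le> K / \<Delta> * exp (- 1 / (2 * d))"
      using K_pos gap_pos by (intro mult_left_mono) auto
    then have k2: "K / \<Delta> * exp (- 1 / d) \<le> real L / 64" using k1 by linarith
    show ?thesis using k1 k2 gap_pos K_pos by (intro mult_mono) auto
  qed
  also have "\<dots> \<le> \<Delta> * (real L)\<^sup>2 * exp (- (\<mu> * real L / 2))"
    using gap_pos by (simp add: power2_eq_square)
  also have "\<mu> * real L / 2 = 16 * (real L * \<Delta> / (128 * d * K))"
    using d_pos K_pos by (simp add: \<mu>_def)
  finally show ?thesis by simp
qed

end

section \<open>The spectral theorem for Hermitian matrices\<close>

definition orthonormal :: "nat \<Rightarrow> (nat \<Rightarrow> nat \<Rightarrow> complex) \<Rightarrow> bool" where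
  "orthonormal n u \<longleftrightarrow> (\<forall>j<n. \<forall>k<n. (\<Sum>i<n. cnj (u j i) * u k i) = (if j = k then 1 else 0))"

lemma orthonormalD:
  "orthonormal n u \<Longrightarrow> j < n \<Longrightarrow> k < n \<Longrightarrow> (\<Sum>i<n. cnj (u j i) * u k i) = (if j = k then 1 else 0)"
  by (simp add: orthonormal_def)

text \<open>Orthonormality says that one square matrix is a left inverse of another; being square,
  it is a right inverse too. This is where having as many vectors as coordinates enters.\<close>

lemma orthonormal_complete:
  assumes u: "orthonormal n u" and ik: "i < n" "k < n"
  shows "(\<Sum>j<n. u j i * cnj (u j k)) = (if i = k then 1 else 0)"
proof -
  define A where "A = mat n n (\<lambda>(j,i). cnj (u j i))"
  define B where "B = mat n n (\<lambda>(i,k). u k i)"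
  have A: "A \<in> carrier_mat n n" and B: "B \<in> carrier_mat n n" by (auto simp: A_def B_def)
  have "A * B = 1\<^sub>m n"
    by (rule eq_matI) (auto simp: A_def B_def scalar_prod_def orthonormalD[OF u] atLeast0LessThan)
  then have "B * A = 1\<^sub>m n" by (rule mat_mult_left_right_inverse[OF A B])
  then have "(B * A) $$ (i,k) = 1\<^sub>m n $$ (i,k)" by simp
  then show ?thesis using ik by (simp add: A_def B_def scalar_prod_def atLeast0LessThan)
qed

lemma cnj_mult_self: "cnj z * z = of_real ((cmod z)\<^sup>2)"
  by (simp only: complex_norm_square mult.commute)

lemma orthonormal_norm:
  assumes "orthonormal n u" "j < n"
  shows "(\<Sum>i<n. (cmod (u j i))\<^sup>2) = 1"
proof -
  have "complex_of_real (\<Sum>i<n. (cmod (u j i))\<^sup>2) = (\<Sum>i<n. cnj (u j i) * u j i)"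
    by (simp only: cnj_mult_self of_real_sum)
  also have "\<dots> = 1" using orthonormalD[OF assms assms(2)] by simp
  finally show ?thesis by (metis of_real_eq_1_iff)
qed

lemma orthonormal_entry_le:
  assumes "orthonormal n u" "j < n" "i < n"
  shows "cmod (u j i) \<le> 1"
proof -
  have "(cmod (u j i))\<^sup>2 \<le> (\<Sum>i<n. (cmod (u j i))\<^sup>2)"
    using assms(3) by (intro member_le_sum) auto
  then show ?thesis using orthonormal_norm[OF assms(1,2)] using power2_le_imp_le[of "cmod (u j i)" 1] by simp
qed

text \<open>The witness is a Householder reflection; the phase \<open>c\<close> makes \<open>c * v 0\<close> real, so that it maps the first
  basis vector to \<open>c v\<close>.\<close>

lemma unit_vector_extends_to_orthonormal:
  fixes v :: "nat \<Rightarrow> complex"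
  assumes n: "0 < n" and v: "(\<Sum>i<n. (cmod (v i))\<^sup>2) = 1"
  shows "\<exists>W c. orthonormal n W \<and> (\<forall>i<n. W 0 i = c * v i)"
proof -
  define c where "c = (if v 0 = 0 then 1 else cnj (v 0) / cmod (v 0))"
  have c1: "cmod c = 1" by (auto simp: c_def norm_divide)
  have cv0: "c * v 0 = of_real (cmod (v 0))"
    using cnj_mult_self[of "v 0"] by (simp add: c_def power2_eq_square)
  define r where "r = cmod (v 0)"
  define x where "x i = c * v i - (if i = 0 then 1 else 0)" for i
  define s where "s = (\<Sum>i<n. cnj (x i) * x i)"
  \<comment> \<open>If c v is already the first basis vector, then \<open>s = 0\<close>, so
    \<open>t = 0\<close> by the convention for division by zero and \<open>W\<close> becomes the
    identity, as it should.\<close>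
  define t where "t = 2 / s"
  have cc: "cnj c * c = 1" unfolding cnj_mult_self c1 by simp
  have s_eq: "s = 2 - 2 * of_real r"
  proof -
    have "cnj (x i) * x i = of_real ((cmod (v i))\<^sup>2) + (if i = 0 then 1 - 2 * of_real r else 0)" for i
    proof (cases "i = 0")
      case True
      have x0: "x 0 = of_real r - 1" by (simp add: x_def cv0 r_def)
      show ?thesis unfolding True x0 by (simp add: r_def power2_eq_square algebra_simps)
    next
      case False
      have "cnj (x i) * x i = (cnj c * c) * (cnj (v i) * v i)" using False by (simp add: x_def)
      also have "\<dots> = of_real ((cmod (v i))\<^sup>2)" by (simp only: cc cnj_mult_self[of "v i"] mult_1_left)
      finally show ?thesis using False by simp
    qed
    then have "s = of_real (\<Sum>i<n. (cmod (v i))\<^sup>2) + (\<Sum>i<n. if i = 0 then 1 - 2 * of_real r else 0)"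
      by (simp add: s_def sum.distrib)
    also have "\<dots> = 2 - 2 * of_real r" using n by (simp add: v)
    finally show ?thesis .
  qed
  define W where "W j i = (if i = j then 1 else 0) - t * x i * cnj (x j)" for j i
  have cnjt: "cnj t = t" by (simp add: t_def s_eq)
  have "orthonormal n W"
    unfolding orthonormal_def
  proof (intro allI impI)
    fix j k assume jk: "j < n" "k < n"
    have "(\<Sum>i<n. cnj (W j i) * W k i) =
        (\<Sum>i<n. (if i = j then (if i = k then 1 else 0) - t * x i * cnj (x k) else 0)
          - (if i = k then t * cnj (x i) * x j else 0) + t * t * x j * cnj (x k) * (cnj (x i) * x i))"
      by (intro sum.cong) (auto simp: W_def cnjt algebra_simps)
    also have "\<dots> = (if j = k then 1 else 0) + x j * cnj (x k) * (t * t * s - 2 * t)"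
    proof -
      have "(\<Sum>i<n. t * t * x j * cnj (x k) * (cnj (x i) * x i)) = t * t * x j * cnj (x k) * s"
        by (simp only: s_def sum_distrib_left)
      then show ?thesis unfolding sum.distrib sum_subtractf using jk by (simp add: algebra_simps)
    qed
    also have "t * t * s - 2 * t = 0" by (simp add: t_def)
    finally show "(\<Sum>i<n. cnj (W j i) * W k i) = (if j = k then 1 else 0)" by simp
  qed
  moreover have "W 0 i = c * v i" if i: "i < n" for i
  proof (cases "s = 0")
    case True
    have "complex_of_real (\<Sum>i<n. (cmod (x i))\<^sup>2) = 0"
      using True unfolding s_def cnj_mult_self of_real_sum .
    then have "(\<Sum>i<n. (cmod (x i))\<^sup>2) = 0" by (metis of_real_eq_0_iff)
    then have "x i = 0" using i by (subst (asm) sum_nonneg_eq_0_iff) auto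
    then show ?thesis by (simp add: W_def x_def)
  next
    case False
    have "cnj (x 0) = of_real r - 1" by (simp add: x_def cv0 r_def)
    then have "cnj (x 0) = - s / 2" by (simp add: s_eq)
    then have "t * cnj (x 0) = -1" using False by (simp add: t_def)
    moreover have "W 0 i = (if i = 0 then 1 else 0) - x i * (t * cnj (x 0))"
      by (simp add: W_def mult_ac)
    ultimately have "W 0 i = (if i = 0 then 1 else 0) + x i" by simp
    then show ?thesis by (simp add: x_def)
  qed
  ultimately show ?thesis by blast
qed

lemma complex_matrix_eigenvector:
  fixes a :: "nat \<Rightarrow> nat \<Rightarrow> complex"
  assumes n: "0 < n"
  shows "\<exists>v lam. (\<Sum>i<n. (cmod (v i))\<^sup>2) = 1 \<and> (\<forall>i<n. (\<Sum>k<n. a i k * v k) = lam * v i)"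
proof -
  define A where "A = mat n n (\<lambda>(i,k). a i k)"
  have A: "A \<in> carrier_mat n n" by (simp add: A_def)
  obtain lam where "eigenvalue A lam"
    using spectrum_non_empty[OF A n] by (auto simp: spectrum_def)
  then obtain w where w: "w \<in> carrier_vec n" "w \<noteq> 0\<^sub>v n" "A *\<^sub>v w = lam \<cdot>\<^sub>v w"
    using A by (auto simp: eigenvalue_def eigenvector_def)
  have ev: "(\<Sum>k<n. a i k * w $ k) = lam * w $ i" if "i < n" for i
  proof -
    have "(A *\<^sub>v w) $ i = (lam \<cdot>\<^sub>v w) $ i" using w by simp
    then show ?thesis using that w(1) by (simp add: A_def scalar_prod_def atLeast0LessThan)
  qed
  define N where "N = (\<Sum>i<n. (cmod (w $ i))\<^sup>2)"
  have "N \<noteq> 0"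
  proof
    assume "N = 0"
    then have "\<forall>i<n. w $ i = 0" unfolding N_def by (subst (asm) sum_nonneg_eq_0_iff) auto
    then have "w = 0\<^sub>v n" using w(1) by (intro eq_vecI) auto
    with w(2) show False by simp
  qed
  moreover have "N \<ge> 0" by (simp add: N_def sum_nonneg)
  ultimately have N: "N > 0" by simp
  define v where "v i = w $ i / of_real (sqrt N)" for i
  have "(\<Sum>i<n. (cmod (v i))\<^sup>2) = N / N"
    using N by (simp add: v_def norm_divide power_divide N_def flip: sum_divide_distrib)
  moreover have "(\<Sum>k<n. a i k * v k) = lam * v i" if "i < n" for i
    using ev[OF that] by (simp add: v_def flip: sum_divide_distrib)
  ultimately show ?thesis using N by auto
qed

text \<open>Induction on the dimension. In an orthonormal basis \<open>W\<close> starting with an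
  eigenvector, the matrix \<open>b\<close> of the operator has a first column that vanishes off the
  diagonal; hermiticity gives the same for the first row and makes the eigenvalue real. The
  remaining block \<open>a'\<close> is Hermitian and smaller, and its eigenvectors are carried back
  through \<open>W\<close>.\<close>

lemma hermitian_spectral_theorem:
  fixes a :: "nat \<Rightarrow> nat \<Rightarrow> complex"
  assumes "\<And>i j. i < n \<Longrightarrow> j < n \<Longrightarrow> a j i = cnj (a i j)"
  shows "\<exists>(e :: nat \<Rightarrow> real) u. orthonormal n u \<and>
    (\<forall>j<n. \<forall>i<n. (\<Sum>k<n. a i k * u j k) = of_real (e j) * u j i)"
  using assms
proof (induction n arbitrary: a)
  case 0
  then show ?case by (simp add: orthonormal_def)
next
  case (Suc n)
  note herm = Suc.prems
  let ?m = "Suc n"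
  obtain v lam where v: "(\<Sum>i<?m. (cmod (v i))\<^sup>2) = 1"
    and ev: "\<forall>i<?m. (\<Sum>k<?m. a i k * v k) = lam * v i"
    using complex_matrix_eigenvector[of ?m a] by blast
  obtain W c where W: "orthonormal ?m W" and W0: "\<forall>i<?m. W 0 i = c * v i"
    using unit_vector_extends_to_orthonormal[OF _ v] by blast
  have evW: "(\<Sum>k<?m. a i k * W 0 k) = lam * W 0 i" if i: "i < ?m" for i
  proof -
    have "(\<Sum>k<?m. a i k * W 0 k) = (\<Sum>k<?m. c * (a i k * v k))"
      using W0 by (intro sum.cong) auto
    also have "\<dots> = lam * W 0 i" using ev W0 i by (simp only: flip: sum_distrib_left) simp
    finally show ?thesis .
  qed
  define b where "b j k = (\<Sum>i<?m. cnj (W j i) * (\<Sum>l<?m. a i l * W k l))" for j k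
  have b_herm: "b k j = cnj (b j k)" for j k
  proof -
    have "cnj (b j k) = (\<Sum>i<?m. \<Sum>l<?m. W j i * (cnj (a i l) * cnj (W k l)))"
      by (simp add: b_def sum_distrib_left del: sum.lessThan_Suc)
    also have "\<dots> = (\<Sum>i<?m. \<Sum>l<?m. W j i * (a l i * cnj (W k l)))"
      by (intro sum.cong refl) (simp add: herm[symmetric])
    also have "\<dots> = (\<Sum>l<?m. \<Sum>i<?m. W j i * (a l i * cnj (W k l)))" by (rule sum.swap)
    also have "\<dots> = b k j" by (simp add: b_def sum_distrib_left mult_ac del: sum.lessThan_Suc)
    finally show ?thesis ..
  qed
  have bj0: "b j 0 = (if j = 0 then lam else 0)" if "j < ?m" for j
  proof -
    have "b j 0 = (\<Sum>i<?m. cnj (W j i) * (lam * W 0 i))"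
      unfolding b_def using evW by (intro sum.cong) auto
    also have "\<dots> = lam * (\<Sum>i<?m. cnj (W j i) * W 0 i)"
      by (simp add: sum_distrib_left mult_ac del: sum.lessThan_Suc)
    finally show ?thesis using orthonormalD[OF W that] by simp
  qed
  have lam_real: "lam = of_real (Re lam)"
  proof -
    have "lam = cnj lam" using b_herm[of 0 0] bj0[of 0] by simp
    then show ?thesis by (simp add: complex_eq_iff)
  qed
  have b0j: "b 0 (Suc j) = 0" if "j < n" for j
    using b_herm[of 0 "Suc j"] bj0[of "Suc j"] that by simp
  define a' where "a' p q = b (Suc p) (Suc q)" for p q
  have a'_herm: "a' q p = cnj (a' p q)" for p q unfolding a'_def by (rule b_herm)
  have "\<exists>(e :: nat \<Rightarrow> real) u. orthonormal n u \<and>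
      (\<forall>j<n. \<forall>i<n. (\<Sum>k<n. a' i k * u j k) = of_real (e j) * u j i)"
    by (rule Suc.IH) (rule a'_herm)
  then obtain e' :: "nat \<Rightarrow> real" and u' where u': "orthonormal n u'"
    and ev': "\<And>j i. j < n \<Longrightarrow> i < n \<Longrightarrow> (\<Sum>k<n. a' i k * u' j k) = of_real (e' j) * u' j i"
    by blast
  define u where "u j i = (case j of 0 \<Rightarrow> W 0 i | Suc j \<Rightarrow> (\<Sum>p<n. u' j p * W (Suc p) i))" for j i
  define e where "e j = (case j of 0 \<Rightarrow> Re lam | Suc j \<Rightarrow> e' j)" for j
  have u_simps: "u 0 i = W 0 i" "u (Suc j) i = (\<Sum>p<n. u' j p * W (Suc p) i)" for i j
    by (simp_all add: u_def)
  have WS: "(\<Sum>i<?m. cnj (W (Suc p) i) * W (Suc q) i) = (if p = q then 1 else 0)" if "p < n" "q < n" for p q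
    using orthonormalD[OF W, of "Suc p" "Suc q"] that by simp
  have W0S: "(\<Sum>i<?m. cnj (W 0 i) * W (Suc q) i) = 0" if "q < n" for q
    using orthonormalD[OF W, of 0 "Suc q"] that by simp
  have u0S: "(\<Sum>i<?m. cnj (u 0 i) * u (Suc k) i) = 0" for k
  proof -
    have "(\<Sum>i<?m. cnj (u 0 i) * u (Suc k) i) = (\<Sum>i<?m. \<Sum>p<n. u' k p * (cnj (W 0 i) * W (Suc p) i))"
      by (simp add: u_simps sum_distrib_left mult_ac del: sum.lessThan_Suc)
    also have "\<dots> = (\<Sum>p<n. u' k p * (\<Sum>i<?m. cnj (W 0 i) * W (Suc p) i))"
      by (subst sum.swap) (simp add: sum_distrib_left del: sum.lessThan_Suc)
    also have "\<dots> = 0" using W0S by (intro sum.neutral) auto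
    finally show ?thesis .
  qed
  have uSS: "(\<Sum>i<?m. cnj (u (Suc j) i) * u (Suc k) i) = (if j = k then 1 else 0)" if "j < n" "k < n" for j k
  proof -
    have "(\<Sum>i<?m. cnj (u (Suc j) i) * u (Suc k) i)
        = (\<Sum>i<?m. \<Sum>p<n. \<Sum>q<n. cnj (u' j p) * u' k q * (cnj (W (Suc p) i) * W (Suc q) i))"
      unfolding u_simps cnj_sum sum_product by (intro sum.cong refl) (simp add: mult_ac)
    also have "\<dots> = (\<Sum>p<n. \<Sum>i<?m. \<Sum>q<n. cnj (u' j p) * u' k q * (cnj (W (Suc p) i) * W (Suc q) i))"
      by (rule sum.swap)
    also have "\<dots> = (\<Sum>p<n. \<Sum>q<n. \<Sum>i<?m. cnj (u' j p) * u' k q * (cnj (W (Suc p) i) * W (Suc q) i))"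
      by (intro sum.cong refl sum.swap)
    also have "\<dots> = (\<Sum>p<n. \<Sum>q<n. cnj (u' j p) * u' k q * (\<Sum>i<?m. cnj (W (Suc p) i) * W (Suc q) i))"
      by (simp only: sum_distrib_left)
    also have "\<dots> = (\<Sum>p<n. \<Sum>q<n. if p = q then cnj (u' j p) * u' k q else 0)"
      by (intro sum.cong refl) (auto simp: WS simp del: sum.lessThan_Suc)
    also have "\<dots> = (\<Sum>p<n. cnj (u' j p) * u' k p)" by (intro sum.cong refl) simp
    also have "\<dots> = (if j = k then 1 else 0)" using orthonormalD[OF u' that] .
    finally show ?thesis .
  qed
  have "orthonormal ?m u"
    unfolding orthonormal_def
  proof (intro allI impI)
    fix j k assume jk: "j < ?m" "k < ?m"
    have uS0: "(\<Sum>i<?m. cnj (u (Suc j) i) * u 0 i) = 0" for j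
    proof -
      have "(\<Sum>i<?m. cnj (u (Suc j) i) * u 0 i) = cnj (\<Sum>i<?m. cnj (u 0 i) * u (Suc j) i)"
        by (simp add: mult.commute del: sum.lessThan_Suc)
      then show ?thesis by (simp only: u0S complex_cnj_zero)
    qed
    have u00: "(\<Sum>i<?m. cnj (u 0 i) * u 0 i) = 1"
      using orthonormalD[OF W, of 0 0] by (simp add: u_simps del: sum.lessThan_Suc)
    show "(\<Sum>i<?m. cnj (u j i) * u k i) = (if j = k then 1 else 0)"
      using jk by (cases j; cases k) (simp_all add: uSS uS0 u0S u00 del: sum.lessThan_Suc)
  qed
  moreover have "(\<Sum>l<?m. a i l * u j l) = of_real (e j) * u j i" if ji: "j < ?m" "i < ?m" for i j
  proof (cases j)
    case 0
    then show ?thesis using evW[OF ji(2)] lam_real by (simp add: u_simps e_def del: sum.lessThan_Suc)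
  next
    case (Suc k)
    then have k: "k < n" using ji by simp
    have exp: "(\<Sum>l<?m. a i l * W (Suc q) l) = (\<Sum>p<n. W (Suc p) i * a' p q)" if q: "q < n" for q
    proof -
      have "(\<Sum>p<?m. W p i * b p (Suc q)) = (\<Sum>p<?m. \<Sum>r<?m. (W p i * cnj (W p r)) * (\<Sum>l<?m. a r l * W (Suc q) l))"
        by (simp only: b_def sum_distrib_left mult.assoc)
      also have "\<dots> = (\<Sum>r<?m. (\<Sum>p<?m. W p i * cnj (W p r)) * (\<Sum>l<?m. a r l * W (Suc q) l))"
        by (subst sum.swap) (simp only: sum_distrib_right)
      also have "\<dots> = (\<Sum>r<?m. if i = r then (\<Sum>l<?m. a r l * W (Suc q) l) else 0)"
        by (intro sum.cong refl) (simp add: orthonormal_complete[OF W ji(2)] del: sum.lessThan_Suc)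
      also have "\<dots> = (\<Sum>l<?m. a i l * W (Suc q) l)" using ji(2) by (simp del: sum.lessThan_Suc)
      finally have "(\<Sum>l<?m. a i l * W (Suc q) l) = (\<Sum>p<?m. W p i * b p (Suc q))" ..
      also have "\<dots> = (\<Sum>p<n. W (Suc p) i * a' p q)"
        by (subst sum.lessThan_Suc_shift) (simp add: b0j[OF q] a'_def)
      finally show ?thesis .
    qed
    have "(\<Sum>l<?m. a i l * u j l) = (\<Sum>l<?m. \<Sum>q<n. u' k q * (a i l * W (Suc q) l))"
      by (simp add: Suc u_simps sum_distrib_left mult_ac del: sum.lessThan_Suc)
    also have "\<dots> = (\<Sum>q<n. u' k q * (\<Sum>l<?m. a i l * W (Suc q) l))"
      by (subst sum.swap) (simp only: sum_distrib_left)
    also have "\<dots> = (\<Sum>q<n. \<Sum>p<n. W (Suc p) i * (a' p q * u' k q))"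
      by (intro sum.cong refl) (simp add: exp sum_distrib_left mult_ac del: sum.lessThan_Suc)
    also have "\<dots> = (\<Sum>p<n. W (Suc p) i * (\<Sum>q<n. a' p q * u' k q))"
      by (subst sum.swap) (simp only: sum_distrib_left)
    also have "\<dots> = (\<Sum>p<n. of_real (e' k) * (u' k p * W (Suc p) i))"
      by (intro sum.cong refl) (simp add: ev'[OF k] mult_ac)
    also have "\<dots> = of_real (e j) * u j i" by (simp add: Suc e_def u_simps sum_distrib_left)
    finally show ?thesis .
  qed
  ultimately show ?case by blast
qed

section \<open>Almost integer traces\<close>

text \<open>A matrix is determined by its action on an orthonormal basis. Besides diagonalising,
  this identifies any matrix known on the eigenbasis: it gives uniqueness in \<open>mat_fun\<close>
  and the anticommutation of \<open>S\<close> with \<open>C\<close>.\<close>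

lemma spectral_expansion:
  assumes u: "orthonormal n u" and ev: "\<And>l. l < n \<Longrightarrow> (\<Sum>k<n. a i k * u l k) = f l * u l i"
    and k: "k < n"
  shows "a i k = (\<Sum>j<n. f j * u j i * cnj (u j k))"
proof -
  have "(\<Sum>j<n. f j * u j i * cnj (u j k)) = (\<Sum>j<n. \<Sum>l<n. a i l * (u j l * cnj (u j k)))"
    by (intro sum.cong refl) (simp only: lessThan_iff ev[symmetric] sum_distrib_right mult.assoc)
  also have "\<dots> = (\<Sum>l<n. a i l * (\<Sum>j<n. u j l * cnj (u j k)))"
    by (subst sum.swap) (simp only: sum_distrib_left)
  also have "\<dots> = (\<Sum>l<n. if l = k then a i l else 0)"
    by (intro sum.cong refl) (simp add: orthonormal_complete[OF u _ k])
  also have "\<dots> = a i k" using k by simp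
  finally show ?thesis ..
qed

text \<open>Of the two factors of t^2 - t = t (t - 1), the one farther from zero has modulus at
  least 1/2.\<close>

lemma dist_zero_one_le:
  fixes t :: real
  shows "\<bar>t - (if 1/2 \<le> t then 1 else 0)\<bar> \<le> 2 * \<bar>t\<^sup>2 - t\<bar>"
proof (cases "1/2 \<le> t")
  case True
  then have "1 * \<bar>t - 1\<bar> \<le> (2 * \<bar>t\<bar>) * \<bar>t - 1\<bar>" by (intro mult_right_mono) auto
  also have "\<dots> = 2 * \<bar>t\<^sup>2 - t\<bar>" by (simp add: abs_mult[symmetric] power2_eq_square algebra_simps)
  finally show ?thesis using True by simp
next
  case False
  then have "\<bar>t\<bar> * 1 \<le> \<bar>t\<bar> * (2 * \<bar>t - 1\<bar>)" by (intro mult_left_mono) auto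
  also have "\<dots> = 2 * \<bar>t\<^sup>2 - t\<bar>" by (simp add: abs_mult[symmetric] power2_eq_square algebra_simps)
  finally show ?thesis using False by simp
qed

text \<open>An entrywise error \<epsilon> in a^2 = a becomes |e^2 - e| \<le> n^2 \<epsilon> for
  every eigenvalue e, which is therefore within 2 n^2 \<epsilon> of 0 or 1. The integer counts the
  eigenvalues that are at least 1/2, and summing the n deviations gives the last factor n.\<close>

lemma almost_projection_trace:
  fixes a :: "nat \<Rightarrow> nat \<Rightarrow> complex"
  assumes herm: "\<And>i j. i < n \<Longrightarrow> j < n \<Longrightarrow> a j i = cnj (a i j)"
    and approx: "\<And>i j. i < n \<Longrightarrow> j < n \<Longrightarrow> cmod ((\<Sum>k<n. a i k * a k j) - a i j) \<le> \<epsilon>"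
  shows "\<exists>m::int. cmod ((\<Sum>i<n. a i i) - of_int m) \<le> 2 * real n ^ 3 * \<epsilon>"
proof -
  obtain e :: "nat \<Rightarrow> real" and u where u: "orthonormal n u"
    and ev: "\<And>j i. j < n \<Longrightarrow> i < n \<Longrightarrow> (\<Sum>k<n. a i k * u j k) = of_real (e j) * u j i"
    using hermitian_spectral_theorem[of n a] herm by blast
  have "(\<Sum>i<n. a i i) = (\<Sum>i<n. \<Sum>j<n. of_real (e j) * (cnj (u j i) * u j i))"
  proof (intro sum.cong refl)
    fix i assume "i \<in> {..<n}"
    then show "a i i = (\<Sum>j<n. of_real (e j) * (cnj (u j i) * u j i))"
      using spectral_expansion[OF u, of a i "\<lambda>j. of_real (e j)" i] ev by (simp add: mult_ac)
  qed
  also have "\<dots> = (\<Sum>j<n. of_real (e j) * (\<Sum>i<n. cnj (u j i) * u j i))"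
    by (subst sum.swap) (simp only: sum_distrib_left)
  also have "\<dots> = (\<Sum>j<n. of_real (e j))"
    by (intro sum.cong refl) (simp add: orthonormalD[OF u])
  finally have tr: "(\<Sum>i<n. a i i) = of_real (\<Sum>j<n. e j)" by simp
  have near: "\<bar>(e j)\<^sup>2 - e j\<bar> \<le> real n ^ 2 * \<epsilon>" if j: "j < n" for j
  proof -
    have sq: "(\<Sum>k<n. ((\<Sum>l<n. a i l * a l k) - a i k) * u j k) = of_real ((e j)\<^sup>2 - e j) * u j i"
      if i: "i < n" for i
    proof -
      have "(\<Sum>k<n. (\<Sum>l<n. a i l * a l k) * u j k) = (\<Sum>l<n. a i l * (\<Sum>k<n. a l k * u j k))"
        by (simp only: sum_distrib_right sum_distrib_left mult.assoc) (rule sum.swap)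
      also have "\<dots> = (\<Sum>l<n. of_real (e j) * (a i l * u j l))"
        by (intro sum.cong refl) (simp add: ev[OF j] mult_ac)
      also have "\<dots> = of_real ((e j)\<^sup>2) * u j i"
        by (simp add: ev[OF j i] power2_eq_square flip: sum_distrib_left)
      finally show ?thesis using ev[OF j i] by (simp add: left_diff_distrib sum_subtractf)
    qed
    have "complex_of_real ((e j)\<^sup>2 - e j) = of_real ((e j)\<^sup>2 - e j) * (\<Sum>i<n. cnj (u j i) * u j i)"
      using orthonormalD[OF u j j] by simp
    also have "\<dots> = (\<Sum>i<n. cnj (u j i) * (\<Sum>k<n. ((\<Sum>l<n. a i l * a l k) - a i k) * u j k))"
      by (subst sum_distrib_left, intro sum.cong refl) (subst sq, auto simp: mult_ac)
    finally have eq: "complex_of_real ((e j)\<^sup>2 - e j)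
      = (\<Sum>i<n. cnj (u j i) * (\<Sum>k<n. ((\<Sum>l<n. a i l * a l k) - a i k) * u j k))" .
    have "\<bar>(e j)\<^sup>2 - e j\<bar> = cmod (complex_of_real ((e j)\<^sup>2 - e j))" by (simp only: norm_of_real real_norm_def)
    also have "\<dots> \<le> (\<Sum>i<n. 1 * (\<Sum>k<n. \<epsilon> * 1))"
      unfolding eq norm_mult complex_mod_cnj
    proof (intro order_trans[OF norm_sum] sum_mono)
      fix i assume i: "i \<in> {..<n}"
      have "cmod (\<Sum>k<n. ((\<Sum>l<n. a i l * a l k) - a i k) * u j k) \<le> (\<Sum>k<n. \<epsilon> * 1)"
      proof (intro order_trans[OF norm_sum] sum_mono)
        fix k assume k: "k \<in> {..<n}"
        show "cmod (((\<Sum>l<n. a i l * a l k) - a i k) * u j k) \<le> \<epsilon> * 1"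
          unfolding norm_mult using i k order_trans[OF norm_ge_zero approx[of i k]]
          by (intro mult_mono approx orthonormal_entry_le[OF u j]) auto
      qed
      then show "cmod (cnj (u j i) * (\<Sum>k<n. ((\<Sum>l<n. a i l * a l k) - a i k) * u j k)) \<le> 1 * (\<Sum>k<n. \<epsilon> * 1)"
        using i orthonormal_entry_le[OF u j] unfolding norm_mult complex_mod_cnj
        by (intro mult_mono) auto
    qed
    also have "\<dots> = real n ^ 2 * \<epsilon>" by (simp add: power2_eq_square)
    finally show ?thesis .
  qed
  define m where "m = (\<Sum>j<n. if 1/2 \<le> e j then 1 else 0 :: int)"
  have "\<bar>(\<Sum>j<n. e j) - of_int m\<bar> \<le> (\<Sum>j<n. \<bar>e j - (if 1/2 \<le> e j then 1 else 0)\<bar>)"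
  proof -
    have "(\<Sum>j<n. e j) - of_int m = (\<Sum>j<n. e j - (if 1/2 \<le> e j then 1 else 0))"
    proof -
      have "of_int m = (\<Sum>j<n. if 1/2 \<le> e j then 1 else 0 :: real)"
        unfolding m_def of_int_sum by (intro sum.cong) auto
      then show ?thesis by (simp only: sum_subtractf)
    qed
    then show ?thesis by (simp only: sum_abs)
  qed
  also have "\<dots> \<le> (\<Sum>j<n. 2 * (real n ^ 2 * \<epsilon>))"
    by (intro sum_mono order_trans[OF dist_zero_one_le] mult_left_mono near) auto
  also have "\<dots> = 2 * real n ^ 3 * \<epsilon>" by (simp add: power2_eq_square power3_eq_cube)
  finally have "\<bar>(\<Sum>j<n. e j) - of_int m\<bar> \<le> 2 * real n ^ 3 * \<epsilon>" .
  moreover have "cmod ((\<Sum>i<n. a i i) - of_int m) = \<bar>(\<Sum>j<n. e j) - of_int m\<bar>"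
    unfolding tr by (metis norm_of_real of_real_diff of_real_of_int_eq real_norm_def)
  ultimately show ?thesis by (intro exI[of _ m]) simp
qed

text \<open>The interval from 0 to D is cut into n + 1 half-open intervals of equal length; n points
  miss one of them, and \<open>b\<close> is its left end.\<close>

lemma pigeonhole_gap:
  fixes x :: "nat \<Rightarrow> real"
  assumes "0 < D"
  shows "\<exists>b\<ge>0. b + D / (real n + 1) \<le> D \<and> (\<forall>j<n. x j \<le> b \<or> b + D / (real n + 1) < x j)"
proof (rule ccontr)
  assume neg: "\<not> ?thesis"
  define g where "g = D / (real n + 1)"
  have g: "0 < g" using assms by (simp add: g_def)
  have "\<exists>j<n. real k * g < x j \<and> x j \<le> (real k + 1) * g" if "k \<le> n" for k
  proof -
    have "real k * g + g = (real k + 1) * g" by (simp add: algebra_simps)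
    also have "\<dots> \<le> (real n + 1) * g" using that g by (intro mult_right_mono) auto
    also have "\<dots> = D" by (simp add: g_def)
    finally have "real k * g + g \<le> D" .
    with neg have "\<not> (\<forall>j<n. x j \<le> real k * g \<or> real k * g + g < x j)"
      using g unfolding g_def[symmetric] by (metis less_imp_le mult_nonneg_nonneg of_nat_0_le_iff)
    then show ?thesis by (auto simp: algebra_simps not_le not_less)
  qed
  then obtain J where J: "\<And>k. k \<le> n \<Longrightarrow> J k < n \<and> real k * g < x (J k) \<and> x (J k) \<le> (real k + 1) * g"
    by metis
  have "J k \<noteq> J k'" if "k < k'" "k' \<le> n" for k k'
  proof
    assume eq: "J k = J k'"
    have "x (J k) \<le> (real k + 1) * g" using J[of k] that by simp
    also have "\<dots> \<le> real k' * g" using that g by (intro mult_right_mono) auto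
    also have "\<dots> < x (J k)" using J[of k'] that eq by simp
    finally show False by simp
  qed
  then have "inj_on J {..n}" by (metis atMost_iff inj_onI linorder_neqE_nat)
  moreover have "J ` {..n} \<subseteq> {..<n}" using J by auto
  ultimately have "card {..n} \<le> card {..<n}" by (metis card_inj_on_le finite_lessThan)
  then show False by simp
qed

section \<open>Elementary estimates for the hyperbolic tangent\<close>

lemma one_minus_tanh_square_le:
  fixes x :: real
  shows "1 - (tanh x)\<^sup>2 \<le> 4 * exp (- 2 * \<bar>x\<bar>)"
proof -
  have "1 - (tanh x)\<^sup>2 = 1 - (tanh \<bar>x\<bar>)\<^sup>2" by (simp add: abs_if)
  also have "\<dots> = (1 - tanh \<bar>x\<bar>) * (1 + tanh \<bar>x\<bar>)" by (simp add: power2_eq_square algebra_simps)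
  also have "\<dots> \<le> (2 * exp (- 2 * \<bar>x\<bar>)) * 2"
  proof (intro mult_mono)
    have "tanh \<bar>x\<bar> = (1 - exp (- 2 * \<bar>x\<bar>)) / (1 + exp (- 2 * \<bar>x\<bar>))" by (rule tanh_real_altdef)
    moreover have "1 - (1 - q) / (1 + q) = 2 * q / (1 + q)" if "q > 0" for q :: real
      using that by (simp add: field_simps)
    ultimately have "1 - tanh \<bar>x\<bar> = 2 * exp (- 2 * \<bar>x\<bar>) / (1 + exp (- 2 * \<bar>x\<bar>))"
      by (simp only: exp_gt_zero)
    also have "\<dots> \<le> 2 * exp (- 2 * \<bar>x\<bar>) / 1" by (intro divide_left_mono) (auto intro: add_pos_pos)
    finally show "1 - tanh \<bar>x\<bar> \<le> 2 * exp (- 2 * \<bar>x\<bar>)" by simp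
    show "1 + tanh \<bar>x\<bar> \<le> 2" using tanh_real_lt_1[of "\<bar>x\<bar>"] by linarith
    show "0 \<le> 1 + tanh \<bar>x\<bar>" using tanh_real_gt_neg1[of "\<bar>x\<bar>"] by linarith
  qed auto
  finally show ?thesis by simp
qed

lemma abs_tanh_le: "\<bar>tanh x\<bar> \<le> \<bar>x :: real\<bar>"
proof -
  have nonneg: "tanh x \<le> x" if "0 \<le> x" for x :: real
  proof -
    have "(\<lambda>x. x - tanh x) 0 \<le> (\<lambda>x. x - tanh x) x"
    proof (rule DERIV_nonneg_imp_nondecreasing[OF that])
      fix y :: real
      have "((\<lambda>x. x - tanh x) has_real_derivative (tanh y)\<^sup>2) (at y)"
        by (auto intro!: derivative_eq_intros)
      then show "\<exists>D. ((\<lambda>x. x - tanh x) has_real_derivative D) (at y) \<and> 0 \<le> D" by auto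
    qed
    then show ?thesis by simp
  qed
  show ?thesis
    using nonneg[of x] nonneg[of "- x"] by (cases "0 \<le> x") (auto simp: abs_if not_le)
qed

section \<open>Functional calculus in an eigenbasis\<close>

locale eigensystem =
  fixes n :: nat and a :: "nat \<Rightarrow> nat \<Rightarrow> complex" and e :: "nat \<Rightarrow> real"
    and u :: "nat \<Rightarrow> nat \<Rightarrow> complex"
  assumes herm: "i < n \<Longrightarrow> j < n \<Longrightarrow> a j i = cnj (a i j)"
    and u: "orthonormal n u"
    and eig: "j < n \<Longrightarrow> i < n \<Longrightarrow> (\<Sum>k<n. a i k * u j k) = of_real (e j) * u j i"
begin

lemma left_eig:
  assumes "k < n" "l < n"
  shows "(\<Sum>i<n. cnj (u k i) * a i l) = of_real (e k) * cnj (u k l)"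
proof -
  have "(\<Sum>i<n. cnj (u k i) * a i l) = (\<Sum>i<n. cnj (a l i * u k i))"
    using assms(2) by (intro sum.cong refl) (simp add: herm[symmetric] mult.commute)
  also have "\<dots> = cnj (\<Sum>i<n. a l i * u k i)" by simp
  finally show ?thesis using eig[OF assms] by simp
qed

definition spectral_fun :: "(complex \<Rightarrow> complex) \<Rightarrow> nat \<Rightarrow> nat \<Rightarrow> complex" where
  "spectral_fun F i k = (\<Sum>j<n. F (of_real (e j)) * u j i * cnj (u j k))"

text \<open>\<open>v\<close> is an arbitrary eigenvector, as the definition of
  \<open>mat_fun\<close> demands, and may mix several \<open>u j\<close> of a degenerate eigenvalue.
  Its coefficient \<open>w j\<close> vanishes unless \<open>e j\<close> equals \<open>lam\<close>,
  so \<open>F\<close> takes the same value on every component present.\<close>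

lemma spectral_fun_apply:
  assumes v: "\<And>i. i < n \<Longrightarrow> (\<Sum>k<n. a i k * v k) = lam * v i" and i: "i < n"
  shows "(\<Sum>k<n. spectral_fun F i k * v k) = F lam * v i"
proof -
  define w where "w j = (\<Sum>k<n. cnj (u j k) * v k)" for j
  have w: "F (of_real (e j)) * w j = F lam * w j" if j: "j < n" for j
  proof -
    have "lam * w j = (\<Sum>i<n. cnj (u j i) * (\<Sum>k<n. a i k * v k))"
      unfolding w_def sum_distrib_left by (intro sum.cong refl) (subst sum_distrib_left[symmetric], simp add: v)
    also have "\<dots> = (\<Sum>k<n. (\<Sum>i<n. cnj (u j i) * a i k) * v k)"
      by (simp only: sum_distrib_left sum_distrib_right mult.assoc) (rule sum.swap)
    also have "\<dots> = of_real (e j) * w j"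
      unfolding w_def sum_distrib_left by (intro sum.cong refl) (subst left_eig[OF j], auto)
    finally show ?thesis by auto
  qed
  have "(\<Sum>k<n. spectral_fun F i k * v k) = (\<Sum>j<n. u j i * (F (of_real (e j)) * w j))"
    unfolding spectral_fun_def w_def sum_distrib_left sum_distrib_right
    by (subst sum.swap) (simp add: mult_ac)
  also have "\<dots> = (\<Sum>j<n. u j i * (F lam * w j))" by (intro sum.cong refl) (simp add: w)
  also have "\<dots> = F lam * (\<Sum>k<n. (\<Sum>j<n. u j i * cnj (u j k)) * v k)"
    unfolding w_def sum_distrib_left sum_distrib_right by (subst sum.swap) (simp add: mult_ac)
  also have "(\<Sum>k<n. (\<Sum>j<n. u j i * cnj (u j k)) * v k) = (\<Sum>k<n. if i = k then v k else 0)"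
    by (intro sum.cong refl) (simp add: orthonormal_complete[OF u i])
  also have "\<dots> = v i" using i by simp
  finally show ?thesis .
qed

lemma spectral_fun_mult:
  assumes "i < n"
  shows "(\<Sum>k<n. spectral_fun F i k * spectral_fun F k l)
    = (\<Sum>j<n. (F (of_real (e j)))\<^sup>2 * u j i * cnj (u j l))"
proof -
  have "(\<Sum>k<n. spectral_fun F i k * spectral_fun F k l)
      = (\<Sum>k<n. \<Sum>j<n. F (of_real (e j)) * cnj (u j l) * (spectral_fun F i k * u j k))"
    by (simp add: spectral_fun_def[of F _ l] sum_distrib_left mult_ac)
  also have "\<dots> = (\<Sum>j<n. F (of_real (e j)) * cnj (u j l) * (\<Sum>k<n. spectral_fun F i k * u j k))"
    by (subst sum.swap) (simp only: sum_distrib_left)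
  also have "\<dots> = (\<Sum>j<n. (F (of_real (e j)))\<^sup>2 * u j i * cnj (u j l))"
  proof (intro sum.cong refl)
    fix j assume "j \<in> {..<n}"
    then have "(\<Sum>k<n. spectral_fun F i k * u j k) = F (of_real (e j)) * u j i"
      using eig assms by (intro spectral_fun_apply) auto
    then show "F (of_real (e j)) * cnj (u j l) * (\<Sum>k<n. spectral_fun F i k * u j k)
        = (F (of_real (e j)))\<^sup>2 * u j i * cnj (u j l)"
      by (simp add: power2_eq_square mult_ac)
  qed
  finally show ?thesis .
qed

text \<open>Resolves the definite description in \<open>mat_fun\<close>: the spectral sum has the
  required action on all eigenvectors, and any competitor agrees with it on the eigenbasis and hence
  everywhere.\<close>

lemma mat_fun_eq:
  assumes A: "A \<in> carrier_mat n n" and Aa: "\<And>i k. i < n \<Longrightarrow> k < n \<Longrightarrow> A $$ (i,k) = a i k"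
  shows "mat_fun F A = mat n n (\<lambda>(i,k). spectral_fun F i k)"
proof -
  have dim: "dim_row A = n" using A by simp
  have mulv: "(B *\<^sub>v v) $ i = (\<Sum>k<n. B $$ (i,k) * v $ k)"
    if "B \<in> carrier_mat n n" "v \<in> carrier_vec n" "i < n" for B v i
    using that by (simp add: scalar_prod_def atLeast0LessThan)
  let ?S = "mat n n (\<lambda>(i,k). spectral_fun F i k)"
  show ?thesis
    unfolding mat_fun_def dim
  proof (rule the_equality, intro conjI allI impI)
    show "?S \<in> carrier_mat n n" by simp
    fix v lam assume v: "v \<in> carrier_vec n" and ev: "A *\<^sub>v v = lam \<cdot>\<^sub>v v"
    have ev': "(\<Sum>k<n. a i k * v $ k) = lam * v $ i" if "i < n" for i
    proof -
      have "(A *\<^sub>v v) $ i = lam * v $ i" using ev v that by simp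
      then show ?thesis using that by (simp add: mulv[OF A v] Aa)
    qed
    have sf: "(\<Sum>k<n. spectral_fun F i k * v $ k) = F lam * v $ i" if "i < n" for i
      by (rule spectral_fun_apply[OF ev' that])
    show "?S *\<^sub>v v = F lam \<cdot>\<^sub>v v"
    proof (rule eq_vecI)
      fix i assume "i < dim_vec (F lam \<cdot>\<^sub>v v)"
      then have i: "i < n" using v by simp
      show "(?S *\<^sub>v v) $ i = (F lam \<cdot>\<^sub>v v) $ i"
        using i v sf[OF i] by (subst mulv) auto
    qed (use v in auto)
  next
    fix S assume S: "S \<in> carrier_mat n n \<and>
      (\<forall>v lam. v \<in> carrier_vec n \<longrightarrow> A *\<^sub>v v = lam \<cdot>\<^sub>v v \<longrightarrow> S *\<^sub>v v = F lam \<cdot>\<^sub>v v)"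
    then have Sc: "S \<in> carrier_mat n n" by blast
    have Su: "(\<Sum>k<n. S $$ (i,k) * u j k) = F (of_real (e j)) * u j i" if ij: "i < n" "j < n" for i j
    proof -
      define v where "v = vec n (u j)"
      have vc: "v \<in> carrier_vec n" by (simp add: v_def)
      have "A *\<^sub>v v = of_real (e j) \<cdot>\<^sub>v v"
      proof (rule eq_vecI)
        fix i assume "i < dim_vec (complex_of_real (e j) \<cdot>\<^sub>v v)"
        then have i: "i < n" using vc by simp
        show "(A *\<^sub>v v) $ i = (of_real (e j) \<cdot>\<^sub>v v) $ i"
          using i eig[OF ij(2) i] by (simp add: mulv[OF A vc] Aa) (simp add: v_def)
      qed (use A vc in auto)
      then have "S *\<^sub>v v = F (of_real (e j)) \<cdot>\<^sub>v v" using S vc by blast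
      then have "(S *\<^sub>v v) $ i = (F (of_real (e j)) \<cdot>\<^sub>v v) $ i" by simp
      then show ?thesis using ij(1) vc by (simp add: mulv[OF Sc vc]) (simp add: v_def)
    qed
    show "S = ?S"
    proof (rule eq_matI)
      fix i k assume "i < dim_row ?S" "k < dim_col ?S"
      then have ik: "i < n" "k < n" by auto
      show "S $$ (i,k) = ?S $$ (i,k)"
        using spectral_expansion[OF u, of "\<lambda>i k. S $$ (i,k)" i "\<lambda>j. F (of_real (e j))" k] Su ik
        by (simp add: spectral_fun_def)
    qed (use Sc in auto)
  qed
qed

end

section \<open>Compressions of diagonal operators to the eigenvectors of a chiral matrix\<close>

locale chiral_eigensystem = eigensystem +
  fixes c \<theta> :: "nat \<Rightarrow> complex"
  assumes chiral: "i < n \<Longrightarrow> k < n \<Longrightarrow> c i * a i k = - (a i k * c k)"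
    and c_cases: "c i = 1 \<or> c i = -1" and \<theta>_cases: "\<theta> i = 0 \<or> \<theta> i = 1"
begin

text \<open>The matrix element \<langle>u_k, p u_j\<rangle> of the diagonal operator with entries
  \<open>p\<close>.\<close>

definition M :: "(nat \<Rightarrow> complex) \<Rightarrow> nat \<Rightarrow> nat \<Rightarrow> complex" where
  "M p k j = (\<Sum>i<n. cnj (u k i) * p i * u j i)"

definition q :: "nat \<Rightarrow> complex" where "q j = M (\<lambda>i. c i * \<theta> i) j j"

lemma L2_set_u: "j < n \<Longrightarrow> L2_set (\<lambda>i. cmod (u j i)) {..<n} = 1"
  using orthonormal_norm[OF u] by (simp add: L2_set_def)

lemma cmod_pairing_le:
  assumes "k < n" "\<And>i. i < n \<Longrightarrow> cmod (p i) \<le> 1"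
  shows "cmod (\<Sum>i<n. cnj (u k i) * p i * r i) \<le> L2_set (\<lambda>i. cmod (r i)) {..<n}"
proof -
  have "cmod (\<Sum>i<n. cnj (u k i) * p i * r i) \<le> (\<Sum>i<n. \<bar>cmod (u k i)\<bar> * \<bar>cmod (r i)\<bar>)"
  proof (intro order_trans[OF norm_sum] sum_mono)
    fix i assume "i \<in> {..<n}"
    then have "cmod (u k i) * cmod (p i) * cmod (r i) \<le> cmod (u k i) * 1 * cmod (r i)"
      using assms(2) by (intro mult_right_mono mult_left_mono) auto
    then show "cmod (cnj (u k i) * p i * r i) \<le> \<bar>cmod (u k i)\<bar> * \<bar>cmod (r i)\<bar>"
      by (simp add: norm_mult)
  qed
  also have "\<dots> \<le> L2_set (\<lambda>i. cmod (u k i)) {..<n} * L2_set (\<lambda>i. cmod (r i)) {..<n}"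
    by (rule L2_set_mult_ineq)
  finally show ?thesis by (simp add: L2_set_u[OF assms(1)])
qed

lemma cmod_M_le:
  assumes "k < n" "j < n" "\<And>i. i < n \<Longrightarrow> cmod (p i) \<le> 1"
  shows "cmod (M p k j) \<le> 1"
  using cmod_pairing_le[OF assms(1), of p "u j"] assms(3) by (simp add: M_def L2_set_u[OF assms(2)])

lemma cmod_q_le: "j < n \<Longrightarrow> cmod (q j) \<le> 1"
  unfolding q_def
proof (rule cmod_M_le)
  fix i show "cmod (c i * \<theta> i) \<le> 1" using c_cases[of i] \<theta>_cases[of i] by auto
qed

definition comm :: "nat \<Rightarrow> nat \<Rightarrow> complex" where
  "comm j i = (\<Sum>k<n. (\<theta> i - \<theta> k) * a i k * u j k)"

text \<open>In \<langle>u_k, X [\<theta>, H] u_j\<rangle> one term lets \<open>H\<close> act on u_j;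
  in the other \<open>H\<close> is moved to the left through X, which costs the sign
  \<open>s\<close>, and acts on u_k. The choice X = 1, s = 1 gives e_j - e_k; the choice X = C, s =
  -1 gives e_j + e_k.\<close>

lemma commutator_pairing:
  assumes jk: "j < n" "k < n"
    and x: "\<And>i l. i < n \<Longrightarrow> l < n \<Longrightarrow> x i * a i l = s * (a i l * x l)"
  shows "(\<Sum>i<n. cnj (u k i) * x i * comm j i)
    = (of_real (e j) - s * of_real (e k)) * M (\<lambda>i. x i * \<theta> i) k j"
proof -
  have "(\<Sum>i<n. cnj (u k i) * x i * comm j i)
      = (\<Sum>i<n. cnj (u k i) * x i * \<theta> i * (\<Sum>l<n. a i l * u j l))
        - (\<Sum>i<n. \<Sum>l<n. cnj (u k i) * (x i * a i l) * (\<theta> l * u j l))"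
    by (simp add: comm_def left_diff_distrib sum_subtractf right_diff_distrib sum_distrib_left mult_ac)
  also have "(\<Sum>i<n. cnj (u k i) * x i * \<theta> i * (\<Sum>l<n. a i l * u j l))
      = of_real (e j) * M (\<lambda>i. x i * \<theta> i) k j"
    unfolding M_def sum_distrib_left[of "of_real (e j)"]
    by (intro sum.cong refl) (simp add: eig[OF jk(1)] mult_ac)
  also have "(\<Sum>i<n. \<Sum>l<n. cnj (u k i) * (x i * a i l) * (\<theta> l * u j l))
      = (\<Sum>i<n. \<Sum>l<n. s * (cnj (u k i) * a i l * (x l * \<theta> l * u j l)))"
    by (intro sum.cong refl) (simp add: x mult_ac)
  also have "\<dots> = (\<Sum>l<n. s * ((\<Sum>i<n. cnj (u k i) * a i l) * (x l * \<theta> l * u j l)))"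
    by (subst sum.swap) (simp only: sum_distrib_left sum_distrib_right)
  also have "\<dots> = s * of_real (e k) * M (\<lambda>i. x i * \<theta> i) k j"
    unfolding M_def sum_distrib_left[of "s * _"]
    by (intro sum.cong refl) (subst left_eig[OF jk(2)], auto simp: mult_ac)
  finally show ?thesis by (simp add: left_diff_distrib)
qed

text \<open>For s = 1 and s = -1 these are the diagonals of the projections onto the two sublattices
  inside the region \<theta> = 1; their difference is C \<theta>.\<close>

definition \<pi> :: "complex \<Rightarrow> nat \<Rightarrow> complex" where "\<pi> s i = \<theta> i * (1 + s * c i) / 2"

lemma pi_cases: "s = 1 \<or> s = -1 \<Longrightarrow> \<pi> s i = 0 \<or> \<pi> s i = 1"
  using c_cases[of i] \<theta>_cases[of i] by (auto simp: \<pi>_def)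

lemma M_pi: "M (\<pi> s) k j = (M (\<lambda>i. 1 * \<theta> i) k j + s * M (\<lambda>i. c i * \<theta> i) k j) / 2"
proof -
  have "M (\<pi> s) k j =
      (\<Sum>i<n. (cnj (u k i) * (1 * \<theta> i) * u j i + s * (cnj (u k i) * (c i * \<theta> i) * u j i)) / 2)"
    unfolding M_def by (intro sum.cong refl) (simp add: \<pi>_def field_simps)
  then show ?thesis by (simp only: M_def sum_divide_distrib[symmetric] sum.distrib sum_distrib_left)
qed

lemma q_eq: "q j = M (\<pi> 1) j j - M (\<pi> (-1)) j j"
  unfolding M_pi q_def by (simp add: field_simps)

lemma M_herm:
  assumes "\<And>i. cnj (p i) = p i"
  shows "M p j k = cnj (M p k j)"
  by (simp add: M_def assms mult_ac)

lemma M_idem: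
  assumes p: "\<And>i. p i * p i = p i"
  shows "(\<Sum>k<n. M p i k * M p k j) = M p i j"
proof -
  have "(\<Sum>k<n. M p i k * M p k j)
      = (\<Sum>k<n. \<Sum>l<n. \<Sum>r<n. cnj (u i l) * p l * (u k l * cnj (u k r)) * (p r * u j r))"
    unfolding M_def sum_product by (intro sum.cong refl) (simp add: mult_ac)
  also have "\<dots> = (\<Sum>l<n. \<Sum>k<n. \<Sum>r<n. cnj (u i l) * p l * (u k l * cnj (u k r)) * (p r * u j r))"
    by (rule sum.swap)
  also have "\<dots> = (\<Sum>l<n. \<Sum>r<n. \<Sum>k<n. cnj (u i l) * p l * (u k l * cnj (u k r)) * (p r * u j r))"
    by (intro sum.cong refl sum.swap)
  also have "\<dots> = (\<Sum>l<n. \<Sum>r<n. cnj (u i l) * p l * (\<Sum>k<n. u k l * cnj (u k r)) * (p r * u j r))"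
    by (simp only: sum_distrib_left sum_distrib_right)
  also have "\<dots> = (\<Sum>l<n. \<Sum>r<n. if l = r then cnj (u i l) * p l * (p r * u j r) else 0)"
    by (intro sum.cong refl) (simp add: orthonormal_complete[OF u])
  also have "\<dots> = (\<Sum>l<n. cnj (u i l) * (p l * p l) * u j l)"
    by (intro sum.cong refl) (simp add: mult_ac)
  also have "\<dots> = M p i j" by (simp add: M_def p)
  finally show ?thesis .
qed

text \<open>On the full eigenbasis \<open>M p\<close> is an exact projection. After restriction to
  \<open>J\<close>, the defect of idempotence is the sum over k outside \<open>J\<close> of products
  of two off-diagonal elements, hence quadratic: each entry is at most n \<epsilon>^2, and the
  almost-projection bound contributes 2 n^3.\<close>

lemma compressed_trace_near_integer:
  assumes p: "\<And>i. p i = 0 \<or> p i = 1"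
    and off: "\<And>k j. k < n \<Longrightarrow> j < n \<Longrightarrow> j \<in> J \<Longrightarrow> k \<notin> J \<Longrightarrow> cmod (M p k j) \<le> \<epsilon>"
  shows "\<exists>m::int. cmod ((\<Sum>j | j < n \<and> j \<in> J. M p j j) - of_int m) \<le> 2 * real n ^ 4 * \<epsilon>\<^sup>2"
proof -
  define N where "N i j = (if i \<in> J \<and> j \<in> J then M p i j else 0)" for i j
  have preal: "cnj (p i) = p i" and pidem: "p i * p i = p i" for i using p[of i] by auto
  have "\<exists>m::int. cmod ((\<Sum>i<n. N i i) - of_int m) \<le> 2 * real n ^ 3 * (real n * \<epsilon>\<^sup>2)"
  proof (rule almost_projection_trace[where a = N])
    show "N j i = cnj (N i j)" for i j using M_herm[of p j i, OF preal] by (simp add: N_def)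
    fix i j assume ij: "i < n" "j < n"
    show "cmod ((\<Sum>k<n. N i k * N k j) - N i j) \<le> real n * \<epsilon>\<^sup>2"
    proof (cases "i \<in> J \<and> j \<in> J")
      case True
      have "(\<Sum>k<n. N i k * N k j) - N i j = (\<Sum>k<n. N i k * N k j - M p i k * M p k j)"
        using True by (simp add: sum_subtractf M_idem[OF pidem] N_def)
      also have "cmod \<dots> \<le> (\<Sum>k<n. \<epsilon>\<^sup>2)"
      proof (intro order_trans[OF norm_sum] sum_mono)
        fix k assume k: "k \<in> {..<n}"
        show "cmod (N i k * N k j - M p i k * M p k j) \<le> \<epsilon>\<^sup>2"
        proof (cases "k \<in> J")
          case kJ: False
          have b1: "cmod (M p k j) \<le> \<epsilon>" using off[of k j] True k kJ ij by auto
          have "cmod (M p i k) = cmod (M p k i)" using M_herm[of p i k, OF preal] by simp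
          then have b2: "cmod (M p i k) \<le> \<epsilon>" using off[of k i] True k kJ ij by auto
          have "cmod (M p i k) * cmod (M p k j) \<le> \<epsilon> * \<epsilon>"
            by (rule mult_mono[OF b2 b1]) (use order_trans[OF norm_ge_zero b1] in auto)
          then show ?thesis using kJ by (simp add: N_def norm_mult power2_eq_square)
        qed (use True in \<open>simp add: N_def\<close>)
      qed
      finally show ?thesis by simp
    qed (auto simp: N_def)
  qed
  moreover have "(\<Sum>i<n. N i i) = (\<Sum>j | j < n \<and> j \<in> J. M p j j)"
    by (simp add: N_def sum.If_cases lessThan_def Int_def)
  moreover have "2 * real n ^ 3 * (real n * \<epsilon>\<^sup>2) = 2 * real n ^ 4 * \<epsilon>\<^sup>2"
    by (simp add: eval_nat_numeral)
  ultimately show ?thesis by simp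
qed

text \<open>The eigenvalues fall into three classes. In \<open>J\<close> the weight is replaced by
  1; the error tanh^2 |q_j| is at most |e_j| |q_j| / \<delta> \<le> \<eta> / \<delta>, however small
  e_j is. Between the cut and \<Delta>/2 one has |e_j| \<ge> g and so |q_j| \<le> \<eta> / g. Above
  \<Delta>/2 the weight itself is small. The unweighted sum left over \<open>J\<close> is a
  difference of two compressed traces.\<close>

lemma index_near_integer:
  assumes \<Delta>: "0 < \<Delta>" and \<delta>: "0 < \<delta>"
    and comm: "\<And>j. j < n \<Longrightarrow> \<bar>e j\<bar> \<le> \<Delta> / 2 \<Longrightarrow> L2_set (\<lambda>i. cmod (comm j i)) {..<n} \<le> \<eta>"
    and \<eta>: "0 \<le> \<eta>"
  defines "g \<equiv> \<Delta> / (2 * (real n + 1))"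
  shows "\<exists>m::int. cmod ((\<Sum>j<n. of_real (1 - (tanh (e j / \<delta>))\<^sup>2) * q j) - of_int m)
    \<le> real n * (\<eta> / \<delta> + \<eta> / g + 4 * exp (- \<Delta> / \<delta>)) + 4 * real n ^ 4 * (\<eta> / g)\<^sup>2"
proof -
  have g: "0 < g" using \<Delta> by (simp add: g_def)
  obtain b where b: "0 \<le> b" "b + g \<le> \<Delta> / 2" "\<And>j. j < n \<Longrightarrow> \<bar>e j\<bar> \<le> b \<or> b + g < \<bar>e j\<bar>"
    using pigeonhole_gap[of "\<Delta> / 2" n "\<lambda>j. \<bar>e j\<bar>"] \<Delta> by (auto simp: g_def divide_divide_eq_left)
  define J where "J = {j. \<bar>e j\<bar> \<le> b}"
  have pair: "\<bar>e j - e k\<bar> * cmod (M (\<lambda>i. 1 * \<theta> i) k j) \<le> \<eta>"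
    "\<bar>e j + e k\<bar> * cmod (M (\<lambda>i. c i * \<theta> i) k j) \<le> \<eta>"
    if "j < n" "k < n" "\<bar>e j\<bar> \<le> \<Delta> / 2" for j k
  proof -
    have "cmod ((of_real (e j) - 1 * of_real (e k)) * M (\<lambda>i. 1 * \<theta> i) k j) \<le> \<eta>"
      using commutator_pairing[OF that(1,2), of "\<lambda>_. 1" 1]
        cmod_pairing_le[OF that(2), of "\<lambda>_. 1" "comm j"] comm[OF that(1,3)] by simp
    then show "\<bar>e j - e k\<bar> * cmod (M (\<lambda>i. 1 * \<theta> i) k j) \<le> \<eta>"
      unfolding norm_mult by (simp flip: of_real_diff)
    have "cmod (c i) \<le> 1" for i using c_cases[of i] by auto
    then have "cmod ((of_real (e j) - (-1) * of_real (e k)) * M (\<lambda>i. c i * \<theta> i) k j) \<le> \<eta>"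
      using commutator_pairing[OF that(1,2), of c "-1"] chiral
        cmod_pairing_le[OF that(2), of c "comm j"] comm[OF that(1,3)] by simp
    then show "\<bar>e j + e k\<bar> * cmod (M (\<lambda>i. c i * \<theta> i) k j) \<le> \<eta>"
      unfolding norm_mult by (simp flip: of_real_add)
  qed
  have off: "cmod (M (\<pi> s) k j) \<le> \<eta> / g" if s: "s = 1 \<or> s = -1" and kj: "k < n" "j < n" "j \<in> J" "k \<notin> J" for s k j
  proof -
    have ej: "\<bar>e j\<bar> \<le> b" and ek: "b + g < \<bar>e k\<bar>" using kj b(3)[of k] by (auto simp: J_def)
    then have gap: "g \<le> \<bar>e j - e k\<bar>" "g \<le> \<bar>e j + e k\<bar>" by linarith+
    have "\<bar>e j\<bar> \<le> \<Delta> / 2" using ej b g by linarith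
    note pr = pair[OF kj(2,1) this]
    have "g * cmod (M (\<lambda>i. 1 * \<theta> i) k j) \<le> \<eta>"
      by (rule order_trans[OF mult_right_mono[OF gap(1)] pr(1)]) simp
    moreover have "g * cmod (M (\<lambda>i. c i * \<theta> i) k j) \<le> \<eta>"
      by (rule order_trans[OF mult_right_mono[OF gap(2)] pr(2)]) simp
    moreover have "cmod (M (\<pi> s) k j) \<le> (cmod (M (\<lambda>i. 1 * \<theta> i) k j) + cmod (M (\<lambda>i. c i * \<theta> i) k j)) / 2"
    proof -
      have "cmod s = 1" using s by auto
      then show ?thesis unfolding M_pi norm_divide
        using norm_triangle_ineq[of "M (\<lambda>i. 1 * \<theta> i) k j" "s * M (\<lambda>i. c i * \<theta> i) k j"]
        by (simp add: norm_mult)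
    qed
    then have "g * cmod (M (\<pi> s) k j)
        \<le> g * ((cmod (M (\<lambda>i. 1 * \<theta> i) k j) + cmod (M (\<lambda>i. c i * \<theta> i) k j)) / 2)"
      using g by (intro mult_left_mono) auto
    ultimately have "g * cmod (M (\<pi> s) k j) \<le> \<eta>" by (simp add: distrib_left)
    then show ?thesis using g by (simp add: pos_le_divide_eq mult.commute)
  qed
  obtain m1 :: int where m1: "cmod ((\<Sum>j | j < n \<and> j \<in> J. M (\<pi> 1) j j) - of_int m1) \<le> 2 * real n ^ 4 * (\<eta> / g)\<^sup>2"
    using compressed_trace_near_integer[of "\<pi> 1" J "\<eta> / g", OF pi_cases off] by auto
  obtain m2 :: int where m2: "cmod ((\<Sum>j | j < n \<and> j \<in> J. M (\<pi> (-1)) j j) - of_int m2) \<le> 2 * real n ^ 4 * (\<eta> / g)\<^sup>2"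
    using compressed_trace_near_integer[of "\<pi> (-1)" J "\<eta> / g", OF pi_cases off] by auto
  have near: "cmod ((\<Sum>j | j < n \<and> j \<in> J. q j) - of_int (m1 - m2)) \<le> 4 * real n ^ 4 * (\<eta> / g)\<^sup>2"
  proof -
    have "(\<Sum>j | j < n \<and> j \<in> J. q j) - of_int (m1 - m2)
      = ((\<Sum>j | j < n \<and> j \<in> J. M (\<pi> 1) j j) - of_int m1) - ((\<Sum>j | j < n \<and> j \<in> J. M (\<pi> (-1)) j j) - of_int m2)"
      by (simp add: q_eq sum_subtractf)
    also have "cmod \<dots> \<le> 2 * real n ^ 4 * (\<eta> / g)\<^sup>2 + 2 * real n ^ 4 * (\<eta> / g)\<^sup>2"
      by (rule order_trans[OF norm_triangle_ineq4 add_mono[OF m1 m2]])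
    finally show ?thesis by simp
  qed
  define f where "f j = 1 - (tanh (e j / \<delta>))\<^sup>2" for j
  have f01: "0 \<le> f j" "f j \<le> 1" for j
  proof -
    have "\<bar>tanh (e j / \<delta>)\<bar> \<le> 1" using tanh_real_bounds[of "e j / \<delta>"] by auto
    then have "(tanh (e j / \<delta>))\<^sup>2 \<le> 1" by (simp add: abs_square_le_1)
    then show "0 \<le> f j" "f j \<le> 1" by (auto simp: f_def)
  qed
  have eq2: "\<bar>e j\<bar> * cmod (q j) \<le> \<eta>" if "j < n" "\<bar>e j\<bar> \<le> \<Delta> / 2" for j
  proof -
    have "\<bar>e j\<bar> * cmod (q j) \<le> \<bar>e j + e j\<bar> * cmod (q j)" by (intro mult_right_mono) auto
    also have "\<dots> \<le> \<eta>" unfolding q_def by (rule pair(2)[OF that(1,1,2)])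
    finally show ?thesis .
  qed
  have err: "cmod (of_real (f j) * q j - (if j \<in> J then q j else 0))
      \<le> \<eta> / \<delta> + \<eta> / g + 4 * exp (- \<Delta> / \<delta>)" if j: "j < n" for j
  proof -
    have "0 \<le> \<eta> / \<delta>" "0 \<le> \<eta> / g" "0 \<le> 4 * exp (- \<Delta> / \<delta>)" using \<eta> \<delta> g by simp_all
    then have tot: "\<eta> / \<delta> \<le> \<eta> / \<delta> + \<eta> / g + 4 * exp (- \<Delta> / \<delta>)"
      "\<eta> / g \<le> \<eta> / \<delta> + \<eta> / g + 4 * exp (- \<Delta> / \<delta>)"
      "4 * exp (- \<Delta> / \<delta>) \<le> \<eta> / \<delta> + \<eta> / g + 4 * exp (- \<Delta> / \<delta>)" by linarith+
    have nf: "cmod (of_real (f j) * q j - 0) = f j * cmod (q j)" using f01[of j] by (simp add: norm_mult)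
    consider (low) "j \<in> J" | (mid) "j \<notin> J" "\<bar>e j\<bar> \<le> \<Delta> / 2" | (high) "j \<notin> J" "\<Delta> / 2 < \<bar>e j\<bar>" by linarith
    then show ?thesis
    proof cases
      case low
      have "\<bar>e j\<bar> \<le> \<Delta> / 2" using low b g by (simp add: J_def)
      have "of_real (f j) * q j - q j = - of_real ((tanh (e j / \<delta>))\<^sup>2) * q j"
        by (simp add: f_def algebra_simps)
      then have "cmod (of_real (f j) * q j - q j) = (tanh (e j / \<delta>))\<^sup>2 * cmod (q j)"
        by (simp only: norm_mult norm_minus_cancel norm_of_real) simp
      also have "\<dots> \<le> \<bar>e j / \<delta>\<bar> * cmod (q j)"
      proof (intro mult_right_mono)
        have "\<bar>tanh (e j / \<delta>)\<bar> * \<bar>tanh (e j / \<delta>)\<bar> \<le> \<bar>e j / \<delta>\<bar> * 1"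
          using tanh_real_bounds[of "e j / \<delta>"] by (intro mult_mono abs_tanh_le) auto
        then show "(tanh (e j / \<delta>))\<^sup>2 \<le> \<bar>e j / \<delta>\<bar>" by (simp add: power2_eq_square flip: abs_mult)
      qed simp
      also have "\<dots> = \<bar>e j\<bar> * cmod (q j) / \<delta>" using \<delta> by (simp add: abs_divide)
      also have "\<dots> \<le> \<eta> / \<delta>" using eq2[OF j] \<open>\<bar>e j\<bar> \<le> \<Delta> / 2\<close> \<delta> by (intro divide_right_mono) auto
      also note tot(1)
      finally show ?thesis unfolding if_P[OF low] .
    next
      case mid
      then have "g \<le> \<bar>e j\<bar>" using b(1) b(3)[OF j] by (auto simp: J_def)
      then have "g * cmod (q j) \<le> \<bar>e j\<bar> * cmod (q j)" by (intro mult_right_mono) auto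
      also have "\<dots> \<le> \<eta>" by (rule eq2[OF j mid(2)])
      finally have "cmod (q j) \<le> \<eta> / g" using g by (simp add: field_simps)
      moreover have "f j * cmod (q j) \<le> 1 * cmod (q j)" by (intro mult_right_mono f01) auto
      ultimately show ?thesis unfolding if_not_P[OF mid(1)] nf using tot(2) by linarith
    next
      case high
      have "f j \<le> 4 * exp (- 2 * \<bar>e j / \<delta>\<bar>)" unfolding f_def by (rule one_minus_tanh_square_le)
      also have "\<dots> \<le> 4 * exp (- \<Delta> / \<delta>)" using high \<delta> by (simp add: abs_divide field_simps)
      finally have "f j * cmod (q j) \<le> 4 * exp (- \<Delta> / \<delta>) * 1"
        using cmod_q_le[OF j] by (intro mult_mono) auto
      then show ?thesis unfolding if_not_P[OF high(1)] nf using tot(3) by linarith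
    qed
  qed
  have "(\<Sum>j<n. of_real (f j) * q j) - (\<Sum>j | j < n \<and> j \<in> J. q j)
      = (\<Sum>j<n. of_real (f j) * q j - (if j \<in> J then q j else 0))"
    by (simp add: sum_subtractf sum.If_cases lessThan_def Int_def)
  also have "cmod \<dots> \<le> (\<Sum>j<n. \<eta> / \<delta> + \<eta> / g + 4 * exp (- \<Delta> / \<delta>))"
    by (intro order_trans[OF norm_sum] sum_mono err) auto
  finally have "cmod ((\<Sum>j<n. of_real (f j) * q j) - (\<Sum>j | j < n \<and> j \<in> J. q j))
      \<le> real n * (\<eta> / \<delta> + \<eta> / g + 4 * exp (- \<Delta> / \<delta>))" by simp
  then have "cmod ((\<Sum>j<n. of_real (f j) * q j) - of_int (m1 - m2))
      \<le> real n * (\<eta> / \<delta> + \<eta> / g + 4 * exp (- \<Delta> / \<delta>)) + 4 * real n ^ 4 * (\<eta> / g)\<^sup>2"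
    using near by (rule norm_diff_triangle_le)
  then show ?thesis unfolding f_def by blast
qed

text \<open>\<open>C\<close> maps an eigenvector of energy e to one of energy -e. For odd
  \<open>F\<close> the matrix -C F(H) C therefore acts on each u_l as multiplication by F(e_l), so
  it equals F(H).\<close>

lemma spectral_fun_anticommute:
  assumes odd: "\<And>z. F (- z) = - F z" and ik: "i < n" "k < n"
  shows "c i * spectral_fun F i k = - (spectral_fun F i k * c k)"
proof -
  have cc: "c i * c i = 1" for i using c_cases[of i] by auto
  have "- (c i * spectral_fun F i k * c k) = (\<Sum>j<n. F (of_real (e j)) * u j i * cnj (u j k))"
  proof (rule spectral_expansion[OF u _ ik(2), of "\<lambda>i k. - (c i * spectral_fun F i k * c k)"])
    fix l assume l: "l < n"
    have "(\<Sum>k<n. spectral_fun F i k * (c k * u l k)) = F (- of_real (e l)) * (c i * u l i)"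
    proof (rule spectral_fun_apply[OF _ ik(1)])
      fix i assume i: "i < n"
      have "(\<Sum>k<n. a i k * (c k * u l k)) = (\<Sum>k<n. - c i * (a i k * u l k))"
      proof (intro sum.cong refl)
        fix k assume "k \<in> {..<n}"
        then have "a i k * c k = - (c i * a i k)" using chiral[OF i] by simp
        then show "a i k * (c k * u l k) = - c i * (a i k * u l k)" by (simp flip: mult.assoc)
      qed
      also have "\<dots> = - c i * (of_real (e l) * u l i)"
        by (simp only: sum_distrib_left[symmetric] eig[OF l i])
      finally show "(\<Sum>k<n. a i k * (c k * u l k)) = - of_real (e l) * (c i * u l i)" by simp
    qed
    then have "c i * (\<Sum>k<n. spectral_fun F i k * (c k * u l k)) = - (c i * c i * (F (of_real (e l)) * u l i))"
      by (simp add: odd mult_ac)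
    then show "(\<Sum>k<n. - (c i * spectral_fun F i k * c k) * u l k) = F (of_real (e l)) * u l i"
      by (simp add: cc sum_negf sum_distrib_left mult_ac)
  qed
  then have "- (c i * spectral_fun F i k * c k) = spectral_fun F i k" by (simp add: spectral_fun_def)
  then have "- (c i * spectral_fun F i k * c k) * c k = spectral_fun F i k * c k" by simp
  then have "- (c i * spectral_fun F i k) * (c k * c k) = spectral_fun F i k * c k"
    by (simp add: mult.assoc)
  then have "- (c i * spectral_fun F i k) = spectral_fun F i k * c k" by (simp add: cc)
  then show ?thesis by (metis minus_minus)
qed

lemma edge_index_eq:
  "(\<Sum>i<n. c i * \<theta> i * (1 - (\<Sum>k<n. spectral_fun F i k * spectral_fun F k i)))
    = (\<Sum>j<n. (1 - (F (of_real (e j)))\<^sup>2) * q j)"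
proof -
  have "c i * \<theta> i * (1 - (\<Sum>k<n. spectral_fun F i k * spectral_fun F k i))
      = (\<Sum>j<n. (1 - (F (of_real (e j)))\<^sup>2) * (cnj (u j i) * (c i * \<theta> i) * u j i))" if i: "i < n" for i
  proof -
    have one: "(1::complex) = (\<Sum>j<n. u j i * cnj (u j i))" using orthonormal_complete[OF u i i] by simp
    have "1 - (\<Sum>k<n. spectral_fun F i k * spectral_fun F k i)
        = (\<Sum>j<n. (1 - (F (of_real (e j)))\<^sup>2) * (u j i * cnj (u j i)))"
      unfolding spectral_fun_mult[OF i]
      by (subst (1) one) (simp add: left_diff_distrib sum_subtractf mult.assoc)
    then show ?thesis by (simp add: sum_distrib_left mult_ac)
  qed
  then have "(\<Sum>i<n. c i * \<theta> i * (1 - (\<Sum>k<n. spectral_fun F i k * spectral_fun F k i)))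
      = (\<Sum>i<n. \<Sum>j<n. (1 - (F (of_real (e j)))\<^sup>2) * (cnj (u j i) * (c i * \<theta> i) * u j i))"
    by (intro sum.cong refl) auto
  also have "\<dots> = (\<Sum>j<n. (1 - (F (of_real (e j)))\<^sup>2) * q j)"
    unfolding q_def M_def sum_distrib_left by (rule sum.swap)
  finally show ?thesis .
qed

text \<open>Writing S^2-terms out, Tr(C S \<theta> S) becomes -Tr(C \<theta> S^2) by anticommutation
  and cyclicity, which is here the exchange of the two summation indices. The other half of the
  commutator gives -Tr(C \<theta> S^2) directly, and the factor 1/2 merges the two. The edge index
  differs from the result by Tr(C \<theta>), which is zero.\<close>

lemma bulk_index_eq:
  assumes odd: "\<And>z. F (- z) = - F z"
  shows "(\<Sum>i<n. c i * (\<Sum>k<n. spectral_fun F i k * ((\<theta> k - \<theta> i) * spectral_fun F k i))) / 2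
    = - (\<Sum>i<n. c i * \<theta> i * (\<Sum>k<n. spectral_fun F i k * spectral_fun F k i))"
proof -
  let ?s = "spectral_fun F"
  let ?X = "\<Sum>i<n. c i * \<theta> i * (\<Sum>k<n. ?s i k * ?s k i)"
  have "(\<Sum>i<n. c i * (\<Sum>k<n. ?s i k * ((\<theta> k - \<theta> i) * ?s k i)))
      = (\<Sum>i<n. \<Sum>k<n. (c i * ?s i k) * (\<theta> k * ?s k i)) - ?X"
    by (simp add: sum_distrib_left left_diff_distrib right_diff_distrib sum_subtractf mult_ac)
  also have "(\<Sum>i<n. \<Sum>k<n. (c i * ?s i k) * (\<theta> k * ?s k i))
      = (\<Sum>i<n. \<Sum>k<n. - (c k * \<theta> k * (?s k i * ?s i k)))"
  proof (intro sum.cong refl)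
    fix i k assume "i \<in> {..<n}" "k \<in> {..<n}"
    then have "c i * ?s i k = - (?s i k * c k)" by (intro spectral_fun_anticommute odd) auto
    then show "c i * ?s i k * (\<theta> k * ?s k i) = - (c k * \<theta> k * (?s k i * ?s i k))"
      by (simp only:) (simp add: mult_ac)
  qed
  also have "\<dots> = (\<Sum>k<n. \<Sum>i<n. - (c k * \<theta> k * (?s k i * ?s i k)))" by (rule sum.swap)
  also have "\<dots> = - ?X" by (simp add: sum_negf sum_distrib_left)
  finally show ?thesis by simp
qed

end

section \<open>The open chain\<close>

text \<open>Passes from a sum over the merged index to a sum over sites of the two sublattice
  components, the form used in \<open>in_l2\<close> and \<open>bulk_apply\<close>.\<close>

lemma summable_infsum_even_odd:
  fixes F :: "int \<Rightarrow> 'a::banach"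
  assumes "F summable_on UNIV"
  shows "(\<lambda>y. F (2 * y) + F (2 * y + 1)) summable_on UNIV"
    and "infsum F UNIV = (\<Sum>\<^sub>\<infinity>y. F (2 * y) + F (2 * y + 1))"
proof -
  let ?ev = "\<lambda>y::int. 2 * y" and ?od = "\<lambda>y::int. 2 * y + 1"
  have inj: "inj ?ev" "inj ?od" by (auto simp: inj_on_def)
  have un: "range ?ev \<union> range ?od = UNIV"
  proof -
    have "x \<in> range ?ev \<union> range ?od" for x
      by (cases "even x") (auto elim!: evenE oddE)
    then show ?thesis by blast
  qed
  have disj: "range ?ev \<inter> range ?od = {}" by (auto, presburger)
  have s: "F summable_on range ?ev" "F summable_on range ?od"
    using summable_on_subset_banach[OF assms] by auto
  have s': "(\<lambda>y. F (2 * y)) summable_on UNIV" "(\<lambda>y. F (2 * y + 1)) summable_on UNIV"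
    using s summable_on_reindex[OF inj(1), of F] summable_on_reindex[OF inj(2), of F] by (auto simp: o_def)
  then show "(\<lambda>y. F (2 * y) + F (2 * y + 1)) summable_on UNIV" by (rule summable_on_add)
  have "infsum F UNIV = infsum F (range ?ev) + infsum F (range ?od)"
    using infsum_Un_disjoint[OF s disj] unfolding un .
  also have "\<dots> = (\<Sum>\<^sub>\<infinity>y. F (2 * y)) + (\<Sum>\<^sub>\<infinity>y. F (2 * y + 1))"
    by (simp add: infsum_reindex[OF inj(1)] infsum_reindex[OF inj(2)] o_def)
  also have "\<dots> = (\<Sum>\<^sub>\<infinity>y. F (2 * y) + F (2 * y + 1))" using s' by (rule infsum_add[symmetric])
  finally show "infsum F UNIV = (\<Sum>\<^sub>\<infinity>y. F (2 * y) + F (2 * y + 1))" .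
qed

lemma mat_adjoint_index:
  fixes A :: "complex mat"
  assumes "A \<in> carrier_mat m n" "i < n" "j < m"
  shows "mat_adjoint A $$ (i,j) = cnj (A $$ (j,i))"
  using assms by (simp add: mat_adjoint_def mat_of_rows_index conjugate_complex_def)

lemma cvec_norm_L2_set: "cvec_norm v = L2_set (\<lambda>i. cmod (v $ i)) {..<dim_vec v}"
  by (simp add: cvec_norm_def L2_set_def)

text \<open>Evaluation on a basis vector. Most of the work shows that the set in
  \<open>mat_opnorm\<close> is bounded above, since otherwise its \<open>Sup\<close> would carry no
  information.\<close>

lemma entry_le_opnorm:
  assumes B: "B \<in> carrier_mat m n" and st: "s < m" "t < n"
  shows "cmod (B $$ (s,t)) \<le> mat_opnorm B"
proof -
  let ?X = "{cvec_norm (B *\<^sub>v v) | v. v \<in> carrier_vec (dim_col B) \<and> cvec_norm v \<le> 1}"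
  have bdd: "bdd_above ?X"
  proof (rule bdd_aboveI[where M = "\<Sum>i<m. \<Sum>j<n. cmod (B $$ (i,j))"])
    fix r assume "r \<in> ?X"
    then obtain v where v: "v \<in> carrier_vec n" "cvec_norm v \<le> 1" "r = cvec_norm (B *\<^sub>v v)" using B by auto
    have vj: "cmod (v $ j) \<le> 1" if "j < n" for j
    proof -
      have "cmod (v $ j) \<le> L2_set (\<lambda>i. cmod (v $ i)) {..<n}" using that by (intro member_le_L2_set) auto
      then show ?thesis using v by (simp add: cvec_norm_L2_set)
    qed
    have dim: "dim_vec (B *\<^sub>v v) = m" using B by simp
    have "r \<le> (\<Sum>i<m. cmod ((B *\<^sub>v v) $ i))"
      unfolding v(3) cvec_norm_L2_set dim by (rule L2_set_le_sum) simp
    also have "\<dots> \<le> (\<Sum>i<m. \<Sum>j<n. cmod (B $$ (i,j)))"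
    proof (rule sum_mono)
      fix i assume i: "i \<in> {..<m}"
      have "cmod ((B *\<^sub>v v) $ i) = cmod (\<Sum>j<n. B $$ (i,j) * v $ j)"
        using i B v(1) by (simp add: scalar_prod_def atLeast0LessThan)
      also have "\<dots> \<le> (\<Sum>j<n. cmod (B $$ (i,j)))"
        by (intro order_trans[OF norm_sum] sum_mono) (simp add: norm_mult mult_left_le vj)
      finally show "cmod ((B *\<^sub>v v) $ i) \<le> (\<Sum>j<n. cmod (B $$ (i,j)))" .
    qed
    finally show "r \<le> (\<Sum>i<m. \<Sum>j<n. cmod (B $$ (i,j)))" .
  qed
  have nv: "cvec_norm (unit_vec n t) = 1"
  proof -
    have "(\<Sum>i<n. (cmod (unit_vec n t $ i))\<^sup>2) = (\<Sum>i<n. if i = t then 1 else 0)"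
      by (intro sum.cong refl) (auto simp: unit_vec_def)
    then show ?thesis using st by (simp add: cvec_norm_def)
  qed
  have Bt: "(B *\<^sub>v unit_vec n t) $ s = B $$ (s,t)" using B st by simp
  have "cmod (B $$ (s,t)) = cmod ((B *\<^sub>v unit_vec n t) $ s)" by (simp add: Bt)
  also have "\<dots> \<le> cvec_norm (B *\<^sub>v unit_vec n t)"
    unfolding cvec_norm_L2_set using B st by (intro member_le_L2_set) auto
  also have "\<dots> \<le> mat_opnorm B"
    unfolding mat_opnorm_def using B nv by (intro cSup_upper bdd) auto
  finally show ?thesis .
qed

lemma chiral2_anticommute_diag:
  assumes B: "B \<in> carrier_mat 2 2" and ac: "chiral2 * B + B * chiral2 = 0\<^sub>m 2 2" and s: "s < 2"
  shows "B $$ (s,s) = 0"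
proof -
  have "(chiral2 * B + B * chiral2) $$ (s,s) = 0" unfolding ac using s by simp
  then show ?thesis using B s less_2_cases[OF s]
    by (auto simp: chiral2_def scalar_prod_def numeral_2_eq_2)
qed

locale gapped_chain =
  fixes Hb :: "int \<Rightarrow> int \<Rightarrow> complex mat" and d K \<Delta> :: real
  assumes carrier: "Hb x y \<in> carrier_mat 2 2"
    and adjoint: "Hb y x = mat_adjoint (Hb x y)"
    and chiral_symmetry: "chiral2 * Hb x y + Hb x y * chiral2 = 0\<^sub>m 2 2"
    and d_pos: "0 < d" and K_pos: "0 < K" and gap_pos: "0 < \<Delta>"
    and short_range: "(\<lambda>x'. mat_opnorm (Hb x x') * exp (real_of_int \<bar>x - x'\<bar> / d)) summable_on UNIV"
      "(\<Sum>\<^sub>\<infinity>x'. mat_opnorm (Hb x x') * exp (real_of_int \<bar>x - x'\<bar> / d)) \<le> K"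
    and gap: "\<bar>E\<bar> < \<Delta> \<Longrightarrow> complex_of_real E \<notin> bulk_spectrum Hb"
begin

text \<open>The basis vector \<open>|x,s\<rangle>\<close> of the bulk has index \<open>2x + s\<close>, as for the finite chain.\<close>

definition h :: "int \<Rightarrow> int \<Rightarrow> complex" where
  "h i j = Hb (i div 2) (j div 2) $$ (nat (i mod 2), nat (j mod 2))"

lemma nat_mod2_less: "nat (i mod 2) < 2" for i :: int
  using pos_mod_bound[of 2 i] by linarith

lemma h_hermitian: "h j i = cnj (h i j)"
  unfolding h_def adjoint[of "j div 2" "i div 2"]
  by (rule mat_adjoint_index[OF carrier nat_mod2_less nat_mod2_less])

lemma h_chiral: "i mod 2 = j mod 2 \<Longrightarrow> h i j = 0"
  unfolding h_def using chiral2_anticommute_diag[OF carrier chiral_symmetry nat_mod2_less] by simp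

lemma opnorm_nonneg: "0 \<le> mat_opnorm (Hb x y)"
  by (rule order_trans[OF norm_ge_zero entry_le_opnorm[OF carrier, of 0 0]]) auto

text \<open>Passing from 2x2 blocks to scalar entries loses no factor 2: by chiral symmetry a row
  meets each site in at most one nonzero entry, so \<open>j div 2\<close> is injective on the
  relevant indices and the constant remains \<open>K\<close>.\<close>

lemma h_row_sum:
  assumes G: "finite G"
  shows "(\<Sum>j\<in>G. cmod (h i j) * exp (real_of_int \<bar>i div 2 - j div 2\<bar> / d)) \<le> K"
proof -
  let ?w = "\<lambda>x'. mat_opnorm (Hb (i div 2) x') * exp (real_of_int \<bar>i div 2 - x'\<bar> / d)"
  define G' where "G' = {j\<in>G. j mod 2 \<noteq> i mod 2}"
  have finG': "finite G'" using G by (simp add: G'_def)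
  have inj: "inj_on (\<lambda>j. j div 2) G'"
  proof (rule inj_onI)
    fix j k assume "j \<in> G'" "k \<in> G'" and div: "j div 2 = k div 2"
    then have "j mod 2 = k mod 2" unfolding G'_def by auto
    with div show "j = k" by (metis mult_div_mod_eq)
  qed
  have "(\<Sum>j\<in>G. cmod (h i j) * exp (real_of_int \<bar>i div 2 - j div 2\<bar> / d))
      = (\<Sum>j\<in>G'. cmod (h i j) * exp (real_of_int \<bar>i div 2 - j div 2\<bar> / d))"
  proof (rule sum.mono_neutral_right[OF G])
    show "\<forall>j\<in>G - G'. cmod (h i j) * exp (real_of_int \<bar>i div 2 - j div 2\<bar> / d) = 0"
      by (auto simp: G'_def h_chiral)
  qed (auto simp: G'_def)
  also have "\<dots> \<le> (\<Sum>j\<in>G'. ?w (j div 2))"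
    unfolding h_def
    by (intro sum_mono mult_right_mono entry_le_opnorm[OF carrier] nat_mod2_less) auto
  also have "\<dots> = sum ?w ((\<lambda>j. j div 2) ` G')" by (simp add: sum.reindex[OF inj])
  also have "\<dots> \<le> (\<Sum>\<^sub>\<infinity>x'. ?w x')"
    using finG' by (intro finite_sum_le_infsum short_range) (auto simp: opnorm_nonneg)
  also have "\<dots> \<le> K" by (rule short_range)
  finally show ?thesis .
qed

lemma h_row_sum': "finite G \<Longrightarrow> (\<Sum>j\<in>G. cmod (h i j)) \<le> K"
  by (rule order_trans[OF sum_mono h_row_sum[of G i]])
    (use d_pos in \<open>auto simp: mult_le_cancel_left1\<close>)

lemma h_row_summable: "(\<lambda>j. cmod (h i j)) summable_on UNIV"
  by (rule nonneg_bdd_above_summable_on) (auto intro!: bdd_aboveI2 h_row_sum')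

sublocale kernel: hermitian_kernel h K
proof
  show "h j i = cnj (h i j)" for i j by (rule h_hermitian)
  show "(\<lambda>j. cmod (h i j)) summable_on UNIV" for i by (rule h_row_summable)
  show "(\<Sum>\<^sub>\<infinity>j. cmod (h i j)) \<le> K" for i
    by (rule infsum_le_finite_sums[OF h_row_summable h_row_sum'])
qed

text \<open>Translates the absence of a real energy from \<open>bulk_spectrum\<close> into
  solvability for sequences over the merged index; \<open>div\<close> and \<open>mod\<close> recover
  site and sublattice.\<close>

lemma resolvent_solvable:
  assumes E: "\<bar>E\<bar> < \<Delta>" and g: "square_summable g"
  shows "\<exists>f. square_summable f \<and> (\<forall>i. (\<Sum>\<^sub>\<infinity>j. h i j * f j) - of_real E * f i = g i)"
proof -
  define g' where "g' x s = (if s < 2 then g (2 * x + int s) else 0)" for x s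
  have "in_l2 g'"
    using summable_infsum_even_odd(1)[OF g[unfolded square_summable_def]]
    by (simp add: in_l2_def g'_def numeral_2_eq_2)
  then obtain \<psi> where \<psi>: "in_l2 \<psi>" "\<And>x s. bulk_apply Hb \<psi> x s - of_real E * \<psi> x s = g' x s"
    using gap[OF E] unfolding bulk_spectrum_def by blast
  define f where "f i = \<psi> (i div 2) (nat (i mod 2))" for i
  have f2: "f (2 * y) = \<psi> y 0" "f (2 * y + 1) = \<psi> y 1" for y by (auto simp: f_def)
  have sum2: "(\<lambda>x. (cmod (\<psi> x 0))\<^sup>2 + (cmod (\<psi> x 1))\<^sup>2) summable_on UNIV"
    using \<psi>(1) by (simp add: in_l2_def numeral_2_eq_2)
  have ssf: "square_summable f"
    unfolding square_summable_def
  proof (rule nonneg_bdd_above_summable_on)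
    show "bdd_above (sum (\<lambda>i. (cmod (f i))\<^sup>2) ` {F. F \<subseteq> UNIV \<and> finite F})"
    proof (rule bdd_aboveI2)
      fix F :: "int set" assume "F \<in> {F. F \<subseteq> UNIV \<and> finite F}"
      then have F: "finite F" by simp
      define X where "X = (\<lambda>i. i div 2) ` F"
      have finX: "finite X" using F by (simp add: X_def)
      have "F \<subseteq> (\<lambda>(x,s). 2 * x + s) ` (X \<times> {0,1})"
      proof
        fix i assume "i \<in> F"
        then have "(i div 2, i mod 2) \<in> X \<times> {0,1}" by (auto simp: X_def)
        then show "i \<in> (\<lambda>(x,s). 2 * x + s) ` (X \<times> {0,1})" by (intro image_eqI[of _ _ "(i div 2, i mod 2)"]) auto
      qed
      then have "(\<Sum>i\<in>F. (cmod (f i))\<^sup>2) \<le> (\<Sum>i\<in>(\<lambda>(x,s). 2 * x + s) ` (X \<times> {0,1}). (cmod (f i))\<^sup>2)"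
        using finX by (intro sum_mono2) auto
      also have "\<dots> = (\<Sum>(x,s)\<in>X \<times> {0,1}. (cmod (f (2 * x + s)))\<^sup>2)"
        by (subst sum.reindex) (auto simp: inj_on_def o_def case_prod_unfold, presburger+)
      also have "\<dots> = (\<Sum>x\<in>X. (cmod (\<psi> x 0))\<^sup>2 + (cmod (\<psi> x 1))\<^sup>2)"
        by (simp add: sum.cartesian_product[symmetric] f2 f2(1)[simplified])
      also have "\<dots> \<le> (\<Sum>\<^sub>\<infinity>x. (cmod (\<psi> x 0))\<^sup>2 + (cmod (\<psi> x 1))\<^sup>2)"
        by (rule finite_sum_le_infsum[OF sum2 finX]) auto
      finally show "(\<Sum>i\<in>F. (cmod (f i))\<^sup>2) \<le> (\<Sum>\<^sub>\<infinity>x. (cmod (\<psi> x 0))\<^sup>2 + (cmod (\<psi> x 1))\<^sup>2)" .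
    qed
  qed simp
  have "(\<Sum>\<^sub>\<infinity>j. h i j * f j) - of_real E * f i = g i" for i
  proof -
    let ?x = "i div 2" and ?s = "nat (i mod 2)"
    have "(\<lambda>j. h i j * f j) summable_on UNIV"
      using kernel.summable_row[of i "of_coord f"] ssf by (simp add: of_coord_inverse)
    then have "(\<Sum>\<^sub>\<infinity>j. h i j * f j) = (\<Sum>\<^sub>\<infinity>y. h i (2 * y) * f (2 * y) + h i (2 * y + 1) * f (2 * y + 1))"
      by (rule summable_infsum_even_odd(2))
    also have "\<dots> = (\<Sum>\<^sub>\<infinity>y. \<Sum>t<2. Hb ?x y $$ (?s,t) * \<psi> y t)"
      by (intro infsum_cong) (simp add: f2 h_def numeral_2_eq_2)
    also have "\<dots> = bulk_apply Hb \<psi> ?x ?s" using nat_mod2_less[of i] by (simp add: bulk_apply_def)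
    finally have "(\<Sum>\<^sub>\<infinity>j. h i j * f j) - of_real E * f i = g' ?x ?s" using \<psi>(2)[of ?x ?s] by (simp add: f_def)
    also have "\<dots> = g i" using nat_mod2_less[of i] by (simp add: g'_def)
    finally show ?thesis .
  qed
  with ssf show ?thesis by blast
qed

sublocale gapped_kernel h d K \<Delta>
proof
  show "h j i = cnj (h i j)" for i j by (rule h_hermitian)
  show "finite G \<Longrightarrow> (\<Sum>j\<in>G. cmod (h i j) * exp (real_of_int \<bar>i div 2 - j div 2\<bar> / d)) \<le> K" for G i
    by (rule h_row_sum)
  show "\<Delta> * L2_set (\<lambda>j. cmod (f j)) G \<le> B"
    if "finite G" "\<And>F. finite F \<Longrightarrow> L2_set (\<lambda>i. cmod (\<Sum>j\<in>G. h i j * f j)) F \<le> B" for G f B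
    by (rule kernel.spectral_gap_coercive[OF resolvent_solvable that])
qed (fact d_pos K_pos gap_pos)+

end

section \<open>Traces as explicit sums and the numerical error bound\<close>

lemma diag_mult_left:
  assumes "A \<in> carrier_mat n n"
  shows "mat n n (\<lambda>(i,j). if i = j then f i else 0) * A = mat n n (\<lambda>(i,j). f i * A $$ (i,j))"
proof (rule eq_matI)
  fix i j assume "i < dim_row (mat n n (\<lambda>(i,j). f i * A $$ (i,j)))" "j < dim_col (mat n n (\<lambda>(i,j). f i * A $$ (i,j)))"
  then have ij: "i < n" "j < n" by auto
  have "(mat n n (\<lambda>(i,j). if i = j then f i else 0) * A) $$ (i,j) = (\<Sum>k<n. (if i = k then f i else 0) * A $$ (k,j))"
    using ij assms by (simp add: scalar_prod_def atLeast0LessThan)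
  also have "\<dots> = (\<Sum>k<n. if i = k then f i * A $$ (k,j) else 0)" by (intro sum.cong) auto
  also have "\<dots> = f i * A $$ (i,j)" using ij by simp
  finally show "(mat n n (\<lambda>(i,j). if i = j then f i else 0) * A) $$ (i,j) = mat n n (\<lambda>(i,j). f i * A $$ (i,j)) $$ (i,j)"
    using ij by simp
qed (use assms in auto)

lemma diag_mult_right:
  assumes "A \<in> carrier_mat n n"
  shows "A * mat n n (\<lambda>(i,j). if i = j then f i else 0) = mat n n (\<lambda>(i,j). A $$ (i,j) * f j)"
proof (rule eq_matI)
  fix i j assume "i < dim_row (mat n n (\<lambda>(i,j). A $$ (i,j) * f j))" "j < dim_col (mat n n (\<lambda>(i,j). A $$ (i,j) * f j))"
  then have ij: "i < n" "j < n" by auto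
  have "(A * mat n n (\<lambda>(i,j). if i = j then f i else 0)) $$ (i,j) = (\<Sum>k<n. A $$ (i,k) * (if k = j then f k else 0))"
    using ij assms by (simp add: scalar_prod_def atLeast0LessThan)
  also have "\<dots> = (\<Sum>k<n. if k = j then A $$ (i,k) * f k else 0)" by (intro sum.cong) auto
  also have "\<dots> = A $$ (i,j) * f j" using ij by simp
  finally show "(A * mat n n (\<lambda>(i,j). if i = j then f i else 0)) $$ (i,j) = mat n n (\<lambda>(i,j). A $$ (i,j) * f j) $$ (i,j)"
    using ij by simp
qed (use assms in auto)

lemma edge_trace_eq:
  fixes n :: nat and s :: "nat \<Rightarrow> nat \<Rightarrow> complex" and c \<theta> :: "nat \<Rightarrow> complex"
  defines "S \<equiv> mat n n (\<lambda>(i,k). s i k)"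
    and "C \<equiv> mat n n (\<lambda>(i,j). if i = j then c i else 0)"
    and "\<Theta> \<equiv> mat n n (\<lambda>(i,j). if i = j then \<theta> i else 0)"
  shows "mat_trace (C * \<Theta> * (1\<^sub>m n - S * S)) = (\<Sum>i<n. c i * \<theta> i * (1 - (\<Sum>k<n. s i k * s k i)))"
proof -
  have S: "S \<in> carrier_mat n n" and C: "C \<in> carrier_mat n n" and T: "\<Theta> \<in> carrier_mat n n"
    by (auto simp: S_def C_def \<Theta>_def)
  define R where "R = 1\<^sub>m n - S * S"
  have R: "R \<in> carrier_mat n n" using S by (simp add: R_def minus_carrier_mat)
  have "C * \<Theta> * R = C * (\<Theta> * R)" by (rule assoc_mult_mat[OF C T R])
  also have "\<Theta> * R = mat n n (\<lambda>(i,j). \<theta> i * R $$ (i,j))" unfolding \<Theta>_def by (rule diag_mult_left[OF R])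
  also have "C * \<dots> = mat n n (\<lambda>(i,j). c i * mat n n (\<lambda>(i,j). \<theta> i * R $$ (i,j)) $$ (i,j))"
    unfolding C_def by (rule diag_mult_left) simp
  finally have "mat_trace (C * \<Theta> * R) = (\<Sum>i<n. c i * (\<theta> i * R $$ (i,i)))" by (simp add: mat_trace_def)
  also have "\<dots> = (\<Sum>i<n. c i * \<theta> i * (1 - (\<Sum>k<n. s i k * s k i)))"
    by (intro sum.cong refl) (simp add: R_def S_def scalar_prod_def atLeast0LessThan)
  finally show ?thesis unfolding R_def .
qed

lemma bulk_trace_eq:
  fixes n :: nat and s :: "nat \<Rightarrow> nat \<Rightarrow> complex" and c \<theta> :: "nat \<Rightarrow> complex"
  defines "S \<equiv> mat n n (\<lambda>(i,k). s i k)"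
    and "C \<equiv> mat n n (\<lambda>(i,j). if i = j then c i else 0)"
    and "\<Theta> \<equiv> mat n n (\<lambda>(i,j). if i = j then \<theta> i else 0)"
  shows "mat_trace (C * S * commutator \<Theta> S) = (\<Sum>i<n. c i * (\<Sum>k<n. s i k * ((\<theta> k - \<theta> i) * s k i)))"
proof -
  have S: "S \<in> carrier_mat n n" and C: "C \<in> carrier_mat n n" and T: "\<Theta> \<in> carrier_mat n n"
    by (auto simp: S_def C_def \<Theta>_def)
  have R: "commutator \<Theta> S = mat n n (\<lambda>(i,j). (\<theta> i - \<theta> j) * s i j)"
  proof -
    have "\<Theta> * S = mat n n (\<lambda>(i,j). \<theta> i * S $$ (i,j))" unfolding \<Theta>_def by (rule diag_mult_left[OF S])
    moreover have "S * \<Theta> = mat n n (\<lambda>(i,j). S $$ (i,j) * \<theta> j)" unfolding \<Theta>_def by (rule diag_mult_right[OF S])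
    ultimately show ?thesis unfolding commutator_def
      by (intro eq_matI) (auto simp: S_def algebra_simps)
  qed
  have "C * S = mat n n (\<lambda>(i,j). c i * S $$ (i,j))" unfolding C_def by (rule diag_mult_left[OF S])
  then have "mat_trace (C * S * commutator \<Theta> S)
      = (\<Sum>i<n. \<Sum>k<n. c i * s i k * ((\<theta> k - \<theta> i) * s k i))"
    unfolding R mat_trace_def by (simp add: scalar_prod_def atLeast0LessThan S_def)
  then show ?thesis by (simp add: sum_distrib_left mult.assoc)
qed

lemma tanh_complex_of_real: "tanh (complex_of_real x) = of_real (tanh x)"
  by (simp add: tanh_def sinh_def cosh_def exp_of_real scaleR_conv_of_real flip: of_real_minus)

text \<open>This is Tr(C \<theta>): the two sublattices of a site have the same \<theta> and
  opposite chirality. Separating \<open>L'\<close> from \<open>L\<close> keeps the switch fixed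
  during the induction.\<close>

lemma chiral_switch_sum_eq_0:
  "(\<Sum>i<2 * L. (if i mod 2 = 0 then 1 else - 1) * switch L' (i div 2)) = 0"
  by (induction L) simp_all

text \<open>As y \<ge> 1 gives sqrt y \<le> y, the factor e^(-16y) in \<eta> has room for the factor
  sqrt y in \<eta> / \<delta>. The largest power of L comes from n^4 (\<eta> / g)^2: \<eta> / g is
  of order L^3, hence L^10 with coefficient 4 * 16 * 36 = 2304. All coefficients together give 2326,
  rounded up to 3000.\<close>

lemma index_error_bound:
  fixes y L \<Delta> \<eta> \<delta> :: real and n :: nat
  assumes L: "1 \<le> L" and y: "1 \<le> y" and \<Delta>: "0 < \<Delta>" and \<delta>: "\<Delta> / \<delta> = sqrt y" "0 < \<delta>"
    and n: "real n = 2 * L" and \<eta>: "\<eta> = \<Delta> * L\<^sup>2 * exp (- 16 * y)"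
    and g: "g = \<Delta> / (2 * (real n + 1))"
  shows "real n * (\<eta> / \<delta> + \<eta> / g + 4 * exp (- \<Delta> / \<delta>)) + 4 * real n ^ 4 * (\<eta> / g)\<^sup>2
    \<le> 3000 * L ^ 10 * exp (- sqrt y)"
proof -
  define z where "z = exp (- sqrt y)"
  have z: "0 < z" "z \<le> 1" using y by (auto simp: z_def)
  have "1 \<le> sqrt y" using y by simp
  then have "sqrt y * 1 \<le> sqrt y * sqrt y" by (intro mult_left_mono) auto
  then have sy: "sqrt y \<le> y" using y by simp
  have e16: "exp (- 16 * y) \<le> z" unfolding z_def using sy y by simp
  have "sqrt y \<le> exp y" using sy exp_ge_add_one_self[of y] by linarith
  then have "sqrt y * exp (- 16 * y) \<le> exp y * exp (- 16 * y)" by (intro mult_right_mono) auto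
  also have "\<dots> = exp (- 15 * y)" by (simp flip: exp_add)
  also have "\<dots> \<le> z" unfolding z_def using sy y by simp
  finally have sz: "sqrt y * exp (- 16 * y) \<le> z" .
  have Lpow: "L ^ k \<le> L ^ 10" if "k \<le> 10" for k using L that by (intro power_increasing) auto
  have t1: "\<eta> / \<delta> \<le> L\<^sup>2 * z"
  proof -
    have "\<eta> / \<delta> = L\<^sup>2 * (\<Delta> / \<delta> * exp (- 16 * y))" by (simp add: \<eta>)
    also have "\<dots> \<le> L\<^sup>2 * z" unfolding \<delta>(1) using sz by (intro mult_left_mono) auto
    finally show ?thesis .
  qed
  have t2: "\<eta> / g \<le> 6 * L ^ 3 * z" and t20: "0 \<le> \<eta> / g"
  proof -
    have "\<eta> / g = (2 * (real n + 1)) * L\<^sup>2 * exp (- 16 * y)" using \<Delta> by (simp add: \<eta> g)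
    also have "\<dots> \<le> (6 * L) * L\<^sup>2 * z"
    proof (rule mult_mono[OF mult_right_mono e16])
      show "2 * (real n + 1) \<le> 6 * L" using L by (simp add: n)
    qed (use L in auto)
    finally show "\<eta> / g \<le> 6 * L ^ 3 * z" by (simp add: power2_eq_square power3_eq_cube)
    show "0 \<le> \<eta> / g" using \<Delta> by (simp add: \<eta> g)
  qed
  have t3: "(\<eta> / g)\<^sup>2 \<le> 36 * L ^ 6 * z"
  proof -
    have "(\<eta> / g)\<^sup>2 \<le> (6 * L ^ 3 * z)\<^sup>2" using t2 t20 by (intro power_mono)
    also have "\<dots> = 36 * L ^ 6 * (z * z)" by (simp add: power_mult_distrib power2_eq_square flip: power_add)
    also have "\<dots> \<le> 36 * L ^ 6 * (z * 1)" using z L by (intro mult_left_mono) auto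
    finally show ?thesis by simp
  qed
  have t4: "exp (- \<Delta> / \<delta>) = z" using \<delta> by (simp add: z_def)
  have "real n * (\<eta> / \<delta> + \<eta> / g + 4 * exp (- \<Delta> / \<delta>)) + 4 * real n ^ 4 * (\<eta> / g)\<^sup>2
      \<le> (2 * L) * (L\<^sup>2 * z + 6 * L ^ 3 * z + 4 * z) + 4 * (2 * L) ^ 4 * (36 * L ^ 6 * z)"
    unfolding n t4 using t1 t2 t3 L by (intro add_mono mult_left_mono) auto
  also have "\<dots> = (2 * L ^ 3 + 12 * L ^ 4 + 8 * L ^ 1 + 2304 * L ^ 10) * z"
    by (simp add: algebra_simps eval_nat_numeral)
  also have "\<dots> \<le> (2 * L ^ 10 + 12 * L ^ 10 + 8 * L ^ 10 + 2304 * L ^ 10) * z"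
    using z by (intro mult_right_mono add_mono mult_left_mono Lpow) auto
  also have "\<dots> \<le> 3000 * L ^ 10 * z" using z L by (simp add: algebra_simps)
  finally show ?thesis by (simp add: z_def)
qed

context gapped_chain
begin

lemma chain_index_near_integer:
  fixes L :: nat
  assumes L: "1 \<le> L"
  defines "y \<equiv> real L * \<Delta> / (128 * d * K)"
  defines "\<delta> \<equiv> sqrt (128 * \<Delta> * d * K / real L)"
  defines "S \<equiv> mat_fun (\<lambda>z. tanh (z / complex_of_real \<delta>)) (restrict_chain L Hb)"
  shows "mat_trace (chiral_chain L * S * commutator (theta_chain L) S) / 2
      = mat_trace (chiral_chain L * theta_chain L * (1\<^sub>m (2*L) - S * S))"
    and "\<exists>m::int. cmod (mat_trace (chiral_chain L * theta_chain L * (1\<^sub>m (2*L) - S * S)) - of_int m)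
      \<le> 3000 * real L ^ 10 * exp (- sqrt y)"
proof -
  define n where "n = 2 * L"
  define a where "a i k = h (int i) (int k)" for i k
  define c where "c i = (if i mod 2 = 0 then 1 else -1 :: complex)" for i :: nat
  define \<theta> where "\<theta> i = switch L (i div 2)" for i
  have a_herm: "a j i = cnj (a i j)" for i j unfolding a_def by (rule h_hermitian)
  obtain e :: "nat \<Rightarrow> real" and u where u: "orthonormal n u"
    and ev: "\<And>j i. j < n \<Longrightarrow> i < n \<Longrightarrow> (\<Sum>k<n. a i k * u j k) = of_real (e j) * u j i"
    using hermitian_spectral_theorem[of n a] a_herm by blast
  interpret chiral_eigensystem n a e u c \<theta>
  proof
    fix i k
    show "a k i = cnj (a i k)" by (rule a_herm)
    show "orthonormal n u" by (rule u)
    show "(\<Sum>k<n. a i k * u j k) = of_real (e j) * u j i" if "j < n" "i < n" for j i by (rule ev[OF that])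
    show "c i * a i k = - (a i k * c k)"
    proof (cases "i mod 2 = k mod 2")
      case True
      then have "int i mod 2 = int k mod 2" by (metis of_nat_mod of_nat_numeral)
      then show ?thesis by (simp add: a_def h_chiral)
    next
      case False
      then have "c k = - c i" by (auto simp: c_def)
      then show ?thesis by simp
    qed
    show "c i = 1 \<or> c i = -1" by (simp add: c_def)
    show "\<theta> i = 0 \<or> \<theta> i = 1" by (simp add: \<theta>_def switch_def)
  qed
  define F where "F z = tanh (z / complex_of_real \<delta>)" for z
  have F_odd: "F (- z) = - F z" for z by (simp add: F_def)
  have \<delta>0: "0 < \<delta>" using L gap_pos d_pos K_pos by (simp add: \<delta>_def)
  have F_real: "F (of_real x) = of_real (tanh (x / \<delta>))" for x
    unfolding F_def by (simp only: of_real_divide[symmetric] tanh_complex_of_real)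
  have S: "S = mat n n (\<lambda>(i,k). spectral_fun F i k)"
    unfolding S_def F_def[symmetric]
  proof (rule mat_fun_eq)
    show "restrict_chain L Hb \<in> carrier_mat n n" by (simp add: restrict_chain_def n_def)
    fix i k assume "i < n" "k < n"
    then show "restrict_chain L Hb $$ (i,k) = a i k"
      by (simp add: restrict_chain_def n_def a_def h_def zdiv_int zmod_int nat_mod_distrib)
  qed
  have C: "chiral_chain L = mat n n (\<lambda>(i,j). if i = j then c i else 0)"
    unfolding chiral_chain_def n_def c_def by (rule cong_mat) auto
  have T: "theta_chain L = mat n n (\<lambda>(i,j). if i = j then \<theta> i else 0)"
    unfolding theta_chain_def n_def \<theta>_def by (rule cong_mat) auto
  have edge: "mat_trace (chiral_chain L * theta_chain L * (1\<^sub>m (2*L) - S * S))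
      = (\<Sum>i<n. c i * \<theta> i * (1 - (\<Sum>k<n. spectral_fun F i k * spectral_fun F k i)))"
    unfolding C T S n_def[symmetric] by (rule edge_trace_eq)
  have bulk: "mat_trace (chiral_chain L * S * commutator (theta_chain L) S)
      = (\<Sum>i<n. c i * (\<Sum>k<n. spectral_fun F i k * ((\<theta> k - \<theta> i) * spectral_fun F k i)))"
    unfolding C T S by (rule bulk_trace_eq)
  have "(\<Sum>i<n. c i * \<theta> i) = 0"
    unfolding c_def \<theta>_def n_def by (rule chiral_switch_sum_eq_0)
  then show "mat_trace (chiral_chain L * S * commutator (theta_chain L) S) / 2
      = mat_trace (chiral_chain L * theta_chain L * (1\<^sub>m (2*L) - S * S))"
    unfolding edge bulk bulk_index_eq[of F, OF F_odd] by (simp add: right_diff_distrib sum_subtractf)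
  have edge': "mat_trace (chiral_chain L * theta_chain L * (1\<^sub>m (2*L) - S * S))
      = (\<Sum>j<n. of_real (1 - (tanh (e j / \<delta>))\<^sup>2) * q j)"
    unfolding edge edge_index_eq F_real by simp
  show "\<exists>m::int. cmod (mat_trace (chiral_chain L * theta_chain L * (1\<^sub>m (2*L) - S * S)) - of_int m)
      \<le> 3000 * real L ^ 10 * exp (- sqrt y)"
  proof (cases "1 \<le> y")
    \<comment> \<open>The nearest integer is taken to be 0: the index is a sum of 2L terms of
      modulus at most 1, while e^(-sqrt y) is at least 1/3.\<close>
    case False
    have "cmod (\<Sum>j<n. of_real (1 - (tanh (e j / \<delta>))\<^sup>2) * q j) \<le> (\<Sum>j<n. 1)"
    proof (intro order_trans[OF norm_sum] sum_mono)
      fix j assume j: "j \<in> {..<n}"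
      have "\<bar>tanh (e j / \<delta>)\<bar> \<le> 1" using tanh_real_bounds[of "e j / \<delta>"] by auto
      then have "\<bar>1 - (tanh (e j / \<delta>))\<^sup>2\<bar> \<le> 1" by (simp add: abs_square_le_1)
      then have "\<bar>1 - (tanh (e j / \<delta>))\<^sup>2\<bar> * cmod (q j) \<le> 1 * 1"
        using cmod_q_le j by (intro mult_mono) auto
      then show "cmod (of_real (1 - (tanh (e j / \<delta>))\<^sup>2) * q j) \<le> 1" by (simp add: norm_mult del: of_real_diff)
    qed
    also have "\<dots> = 2 * real L" by (simp add: n_def)
    also have "\<dots> \<le> 1000 * real L ^ 10"
      using self_le_power[of "real L" 10] L by linarith
    also have "\<dots> \<le> 3000 * real L ^ 10 * exp (- sqrt y)"
    proof -
      have "exp (sqrt y) \<le> exp 1" using False by simp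
      then have "exp (sqrt y) \<le> 3" using exp_le by linarith
      then have "1 / 3 \<le> exp (- sqrt y)" by (simp add: exp_minus field_simps)
      then have "3000 * real L ^ 10 * (1 / 3) \<le> 3000 * real L ^ 10 * exp (- sqrt y)"
        by (intro mult_left_mono) auto
      then show ?thesis by simp
    qed
    finally show ?thesis unfolding edge' by (intro exI[of _ 0]) simp
  next
    case True
    define \<eta> where "\<eta> = \<Delta> * (real L)\<^sup>2 * exp (- 16 * y)"
    define G where "G = {0..<2 * int L}"
    have G: "G = int ` {..<n}" by (simp add: G_def n_def image_int_atLeastLessThan lessThan_atLeast0)
    have inj: "inj_on int {..<n}" by simp
    have comm_le: "L2_set (\<lambda>i. cmod (comm j i)) {..<n} \<le> \<eta>" if j: "j < n" and ej: "\<bar>e j\<bar> \<le> \<Delta> / 2" for j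
    proof -
      define v where "v i = u j (nat i)" for i
      define \<theta>' where "\<theta>' i = (if i div 2 < int (L div 2) then 1 else 0 :: complex)" for i :: int
      have \<theta>': "\<theta>' (int i) = \<theta> i" for i
        unfolding \<theta>'_def \<theta>_def switch_def by (metis nat_int_comparison(2) of_nat_numeral zdiv_int)
      have L2G: "L2_set f G = L2_set (\<lambda>i. f (int i)) {..<n}" for f
        unfolding L2_set_def G by (simp add: sum.reindex)
      have sumG: "sum f G = (\<Sum>i<n. f (int i))" for f :: "int \<Rightarrow> complex"
        unfolding G by (simp add: sum.reindex)
      have "L2_set (\<lambda>i. cmod (\<Sum>k\<in>G. (\<theta>' i - \<theta>' k) * h i k * v k)) G \<le> \<eta>"
        unfolding \<eta>_def y_def G_def
      proof (rule eigenvector_commutator_bound[OF _ ej], fold G_def)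
        show "(\<Sum>k\<in>G. h i k * v k) = of_real (e j) * v i" if iG: "i \<in> G" for i
        proof -
          obtain i' where "i = int i'" "i' < n" using iG G by auto
          then show ?thesis using ev[OF j] by (simp add: sumG v_def a_def)
        qed
        show "L2_set (\<lambda>i. cmod (v i)) G = 1" using L2_set_u[OF j] by (simp add: L2G v_def)
        show "\<theta>' i = (if i div 2 < int (L div 2) then 1 else 0)" for i by (simp add: \<theta>'_def)
        show "1 \<le> real L * \<Delta> / (128 * d * K)" using True by (simp add: y_def)
      qed
      then show ?thesis by (simp add: L2G sumG \<theta>' comm_def a_def v_def)
    qed
    \<comment> \<open>This identity makes the tail of 1 - tanh^2 above \<Delta>/2 decay exactly at
      the claimed rate.\<close>
    have \<delta>y: "\<Delta> / \<delta> = sqrt y"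
    proof -
      have "sqrt y = sqrt (\<Delta>\<^sup>2 / (128 * \<Delta> * d * K / real L))"
        using gap_pos L d_pos K_pos by (simp add: y_def power2_eq_square mult_ac)
      also have "\<dots> = sqrt (\<Delta>\<^sup>2) / \<delta>" unfolding \<delta>_def by (rule real_sqrt_divide)
      also have "\<dots> = \<Delta> / \<delta>" using gap_pos by simp
      finally show ?thesis ..
    qed
    have "0 \<le> \<eta>" using gap_pos by (simp add: \<eta>_def)
    from index_near_integer[OF gap_pos \<delta>0 comm_le this]
    obtain m :: int where "cmod ((\<Sum>j<n. of_real (1 - (tanh (e j / \<delta>))\<^sup>2) * q j) - of_int m)
        \<le> real n * (\<eta> / \<delta> + \<eta> / (\<Delta> / (2 * (real n + 1))) + 4 * exp (- \<Delta> / \<delta>))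
          + 4 * real n ^ 4 * (\<eta> / (\<Delta> / (2 * (real n + 1))))\<^sup>2" by blast
    also have "\<dots> \<le> 3000 * real L ^ 10 * exp (- sqrt y)"
      by (rule index_error_bound[OF _ True gap_pos \<delta>y \<delta>0 _ \<eta>_def refl]) (use L in \<open>auto simp: n_def\<close>)
    finally show ?thesis unfolding edge' by blast
  qed
qed

end

theorem theorem1:
  "\<exists>N c. \<forall>(L::nat) (Hb :: int \<Rightarrow> int \<Rightarrow> complex mat) (d::real) (Kd::real) (\<Delta>::real).
     (\<forall>x y. Hb x y \<in> carrier_mat 2 2)
   \<longrightarrow> (\<forall>x y. Hb y x = mat_adjoint (Hb x y))
   \<longrightarrow> (\<forall>x y. chiral2 * Hb x y + Hb x y * chiral2 = 0\<^sub>m 2 2)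
   \<longrightarrow> 0 < d \<longrightarrow> 0 < Kd
   \<longrightarrow> (\<forall>x. (\<lambda>x'. mat_opnorm (Hb x x') * exp (real_of_int \<bar>x - x'\<bar> / d)) summable_on UNIV
            \<and> (\<Sum>\<^sub>\<infinity>x'. mat_opnorm (Hb x x') * exp (real_of_int \<bar>x - x'\<bar> / d)) \<le> Kd)
   \<longrightarrow> 0 < \<Delta>
   \<longrightarrow> (\<forall>E::real. \<bar>E\<bar> < \<Delta> \<longrightarrow> complex_of_real E \<notin> bulk_spectrum Hb)
   \<longrightarrow> (let H = restrict_chain L Hb;
            \<delta> = sqrt (128 * \<Delta> * d * Kd / real L);
            S = mat_fun (\<lambda>z. tanh (z / complex_of_real \<delta>)) H;
            C = chiral_chain L;
            \<Theta> = theta_chain L;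
            Ibulk = mat_trace (C * S * commutator \<Theta> S) / 2;
            Iedge = mat_trace (C * \<Theta> * (1\<^sub>m (2*L) - S * S));
            bound = \<bar>poly3 N c Kd d (real L)\<bar> * exp (- sqrt (real L * \<Delta> / (128 * d * Kd)))
        in (\<exists>n::int. cmod (Ibulk - of_int n) \<le> bound)
         \<and> (\<exists>n::int. cmod (Iedge - of_int n) \<le> bound))"
proof -
  \<comment> \<open>Coefficients of the single monomial 3000 L^10.\<close>
  define c :: "nat \<Rightarrow> nat \<Rightarrow> nat \<Rightarrow> real" where
    "c = (\<lambda>i j k. if i = 0 then if j = 0 then if k = 10 then 3000 else 0 else 0 else 0)"
  have poly: "poly3 10 c a b (real L) = 3000 * real L ^ 10" for a b :: real and L :: nat
  proof -
    have k: "(\<Sum>k\<le>10. c i j k * a ^ i * b ^ j * real L ^ k) = (if i = 0 \<and> j = 0 then 3000 * real L ^ 10 else 0)" for i j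
    proof (cases "i = 0 \<and> j = 0")
      case True
      have "(\<Sum>k\<le>10. c i j k * a ^ i * b ^ j * real L ^ k) = (\<Sum>k\<le>10. if k = 10 then 3000 * real L ^ k else 0)"
        using True by (intro sum.cong) (auto simp: c_def)
      then show ?thesis using True by simp
    qed (auto simp: c_def)
    have "(\<Sum>j\<le>10::nat. if i = 0 \<and> j = 0 then 3000 * real L ^ 10 else 0)
        = (if i = 0 then 3000 * real L ^ 10 else 0)" for i :: nat
      by (cases "i = 0") simp_all
    then have "poly3 10 c a b (real L) = (\<Sum>i\<le>10::nat. if i = 0 then 3000 * real L ^ 10 else 0)"
      unfolding poly3_def k by simp
    then show ?thesis by simp
  qed
  show ?thesis
  proof (intro exI[of _ 10] exI[of _ c] allI impI)
    fix L :: nat and Hb :: "int \<Rightarrow> int \<Rightarrow> complex mat" and d Kd \<Delta> :: real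
    assume as: "\<forall>x y. Hb x y \<in> carrier_mat 2 2" "\<forall>x y. Hb y x = mat_adjoint (Hb x y)"
      "\<forall>x y. chiral2 * Hb x y + Hb x y * chiral2 = 0\<^sub>m 2 2" "0 < d" "0 < Kd"
      "\<forall>x. (\<lambda>x'. mat_opnorm (Hb x x') * exp (real_of_int \<bar>x - x'\<bar> / d)) summable_on UNIV
            \<and> (\<Sum>\<^sub>\<infinity>x'. mat_opnorm (Hb x x') * exp (real_of_int \<bar>x - x'\<bar> / d)) \<le> Kd"
      "0 < \<Delta>" "\<forall>E::real. \<bar>E\<bar> < \<Delta> \<longrightarrow> complex_of_real E \<notin> bulk_spectrum Hb"
    interpret gapped_chain Hb d Kd \<Delta>
      by (rule gapped_chain.intro; use as in blast)
    define S where "S = mat_fun (\<lambda>z. tanh (z / complex_of_real (sqrt (128 * \<Delta> * d * Kd / real L)))) (restrict_chain L Hb)"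
    define Ib where "Ib = mat_trace (chiral_chain L * S * commutator (theta_chain L) S) / 2"
    define Ie where "Ie = mat_trace (chiral_chain L * theta_chain L * (1\<^sub>m (2*L) - S * S))"
    define B where "B = \<bar>poly3 10 c Kd d (real L)\<bar> * exp (- sqrt (real L * \<Delta> / (128 * d * Kd)))"
    have B: "B = 3000 * real L ^ 10 * exp (- sqrt (real L * \<Delta> / (128 * d * Kd)))" by (simp add: B_def poly)
    have "(\<exists>n::int. cmod (Ib - of_int n) \<le> B) \<and> (\<exists>n::int. cmod (Ie - of_int n) \<le> B)"
    proof (cases "L = 0")
      \<comment> \<open>Both traces run over the empty index set and the bound is 0 as well; the
        division by L inside \<delta> yields 0 by convention.\<close>
      case True
      then have "Ib = 0" "Ie = 0" by (simp_all add: Ib_def Ie_def mat_trace_def chiral_chain_def)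
      then show ?thesis using True by (auto simp: B intro!: exI[of _ 0])
    next
      case False
      then have "1 \<le> L" by simp
      note main = chain_index_near_integer[OF this, folded S_def]
      have "Ib = Ie" unfolding Ib_def Ie_def by (rule main(1))
      then show ?thesis using main(2) unfolding Ie_def B by simp
    qed
    then show "let H = restrict_chain L Hb;
            \<delta> = sqrt (128 * \<Delta> * d * Kd / real L);
            S = mat_fun (\<lambda>z. tanh (z / complex_of_real \<delta>)) H;
            C = chiral_chain L;
            \<Theta> = theta_chain L;
            Ibulk = mat_trace (C * S * commutator \<Theta> S) / 2;
            Iedge = mat_trace (C * \<Theta> * (1\<^sub>m (2*L) - S * S));
            bound = \<bar>poly3 10 c Kd d (real L)\<bar> * exp (- sqrt (real L * \<Delta> / (128 * d * Kd)))
        in (\<exists>n::int. cmod (Ibulk - of_int n) \<le> bound)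
         \<and> (\<exists>n::int. cmod (Iedge - of_int n) \<le> bound)"
      unfolding Let_def S_def[symmetric] Ib_def[symmetric] Ie_def[symmetric] B_def[symmetric] .
  qed
qed

end
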